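(* For each dynamical diagram \(D\) there is a geometrically fast set \(X_D\subseteq \operatorname{PL}_+(I)\) such that whenever \(X\subseteq\operatorname{Homeo}_+(I)\) is geometrically fast, has finitely many transition points, and has dynamical diagram isomorphic to \(D\), there are a marked isomorphism \(\phi:\langle X\rangle\to\langle X_D\rangle\) and a continuous order preserving surjection \(\hat\theta: I\to I\) such that \(x f\hat\theta = x\hat\theta\,\phi(f)\) for all \(f\in\langle X\rangle\) and \(x\in I\).
   Context: \(I=[0,1]\); \(\operatorname{Homeo}_+(I)\) is the group of orientation preserving homeomorphisms of \(I\) acting on the right (\(tg\) is the image of \(t\), \(fg\) means apply \(f\) first), and \(\operatorname{PL}_+(I)\) its subgroup of piecewise linear elements. The support of \(f\) is \(\operatorname{supt}(f)=\{t : tf\neq t\}\); orbitals are its components. A left (right) transition point of \(f\) is \(t\notin\operatorname{supt}(f)\) with \((t,t+\epsilon)\cap\operatorname{supt}(f)\ne\emptyset\) (resp. \((t-\epsilon,t)\cap\operatorname{supt}(f)\neq\emptyset\)) for all \(\epsilon>0\). A bump is an element with exactly one orbital, positive if \(ta>t\) on its support; \(b\) is a signed bump of \(f\) if \(b\) agrees with \(f\) on \(\operatorname{supt}(b)\); a positive bump \(a\) is used in \(X\) if some \(f\in X\) agrees with \(a\) or \(a^{-1}\) on \(\operatorname{supt}(a)\). \(X\) is geometrically proper if no point is a left transition point of two distinct elements of \(X\) or a right transition point of two distinct elements of \(X\). A marking of a set \(A\) of positive bumps assigns each \(a\) a marker \(t\in\operatorname{supt}(a)\); for \(a\) with orbital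 \((x,y)\), \(\operatorname{src}(a)=(x,t)\), \(\operatorname{dest}(a)=[ta,y)\), \(\operatorname{src}(a^{-1})=\operatorname{dest}(a)\), \(\operatorname{dest}(a^{-1})=\operatorname{src}(a)\) (the feet). \(A\) is geometrically fast if geometrically proper and some marking makes all feet pairwise disjoint; \(X\) is geometrically fast if it is geometrically proper and the set of bumps used in \(X\) is geometrically fast. A dynamical diagram is a finite directed graph with edge labels and a linear order on its vertices in which every vertex has total degree 1. The dynamical diagram of a geometrically fast \(X\) with finitely many transition points has as vertices the feet (of a marking with disjoint feet), ordered as in \(I\), as edges the signed bumps of elements of \(X\) directed from source to destination, labeled by the element of \(X\) they come from; isomorphisms are order preserving directed graph isomorphisms inducing a bijection of labels. For finite geometrically proper sets, enumerate each in increasing order of least transition points; \(\phi:\langle X\rangle\to\langle Y\rangle\) is a marked isomorphism if it is an isomorphism sending the \(i\)-th element of \(X\) to the \(i\)-th element of \(Y\) for each \(i\). *)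

theory Defs
  imports "HOL-Analysis.Analysis"
begin

text \<open>An element of Homeo_+(I) is represented as a function real => real which is an
 orientation preserving homeomorphism of [0,1] and the identity outside [0,1]
 (the latter only to make the representation unique). The right action t f is
 written f t; the product fg (apply f first) is g o f.\<close>

definition homeo_plus :: "(real \<Rightarrow> real) \<Rightarrow> bool" where
  "homeo_plus f \<longleftrightarrow> continuous_on {0..1} f \<and> strict_mono_on {0..1} f \<and>
     f ` {0..1} = {0..1} \<and> (\<forall>t. t \<notin> {0..1} \<longrightarrow> f t = t)"

definition piecewise_linear :: "(real \<Rightarrow> real) \<Rightarrow> bool" where
  "piecewise_linear f \<longleftrightarrow> (\<exists>S. finite S \<and> S \<subseteq> {0..1} \<and> 0 \<in> S \<and> 1 \<in> S \<and>
     (\<forall>a\<in>S. \<forall>b\<in>S. a < b \<and> {a<..<b} \<inter> S = {} \<longrightarrow>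
        (\<exists>m c. \<forall>t\<in>{a..b}. f t = m * t + c)))"

definition PL_plus :: "(real \<Rightarrow> real) \<Rightarrow> bool" where
  "PL_plus f \<longleftrightarrow> homeo_plus f \<and> piecewise_linear f"

inductive_set gen_group :: "(real \<Rightarrow> real) set \<Rightarrow> (real \<Rightarrow> real) set" for X where
  gen_id: "id \<in> gen_group X"
| gen_base: "f \<in> X \<Longrightarrow> f \<in> gen_group X"
| gen_mult: "f \<in> gen_group X \<Longrightarrow> g \<in> gen_group X \<Longrightarrow> g \<circ> f \<in> gen_group X"
| gen_inv: "f \<in> gen_group X \<Longrightarrow> inv f \<in> gen_group X"

definition supt :: "(real \<Rightarrow> real) \<Rightarrow> real set" where
  "supt f = {t \<in> {0..1}. f t \<noteq> t}"

definition orbitals :: "(real \<Rightarrow> real) \<Rightarrow> real set set" where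
  "orbitals f = {connected_component_set (supt f) t | t. t \<in> supt f}"

definition left_tp :: "(real \<Rightarrow> real) \<Rightarrow> real \<Rightarrow> bool" where
  "left_tp f t \<longleftrightarrow> t \<in> {0..1} \<and> t \<notin> supt f \<and>
     (\<forall>\<epsilon>>0. {t<..<t+\<epsilon>} \<inter> supt f \<noteq> {})"

definition right_tp :: "(real \<Rightarrow> real) \<Rightarrow> real \<Rightarrow> bool" where
  "right_tp f t \<longleftrightarrow> t \<in> {0..1} \<and> t \<notin> supt f \<and>
     (\<forall>\<epsilon>>0. {t-\<epsilon><..<t} \<inter> supt f \<noteq> {})"

definition transition_points :: "(real \<Rightarrow> real) set \<Rightarrow> real set" where
  "transition_points X = {t. \<exists>f\<in>X. left_tp f t \<or> right_tp f t}"

definition bump :: "(real \<Rightarrow> real) \<Rightarrow> bool" where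
  "bump a \<longleftrightarrow> homeo_plus a \<and> (\<exists>!J. J \<in> orbitals a)"

definition positive_bump :: "(real \<Rightarrow> real) \<Rightarrow> bool" where
  "positive_bump a \<longleftrightarrow> bump a \<and> (\<forall>t\<in>supt a. a t > t)"

definition agrees_on :: "(real \<Rightarrow> real) \<Rightarrow> (real \<Rightarrow> real) \<Rightarrow> real set \<Rightarrow> bool" where
  "agrees_on f b S \<longleftrightarrow> (\<forall>t\<in>S. f t = b t)"

definition used_bumps :: "(real \<Rightarrow> real) set \<Rightarrow> (real \<Rightarrow> real) set" where
  "used_bumps X = {a. positive_bump a \<and>
     (\<exists>f\<in>X. agrees_on f a (supt a) \<or> agrees_on f (inv a) (supt a))}"

definition geom_proper :: "(real \<Rightarrow> real) set \<Rightarrow> bool" where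
  "geom_proper X \<longleftrightarrow> X \<subseteq> {f. homeo_plus f} \<and>
     (\<forall>f\<in>X. \<forall>g\<in>X. \<forall>t. f \<noteq> g \<longrightarrow> \<not> (left_tp f t \<and> left_tp g t)) \<and>
     (\<forall>f\<in>X. \<forall>g\<in>X. \<forall>t. f \<noteq> g \<longrightarrow> \<not> (right_tp f t \<and> right_tp g t))"

text \<open>For a bump a with orbital (x,y): x = Inf (supt a), y = Sup (supt a).\<close>
definition src_foot :: "(real \<Rightarrow> real) \<Rightarrow> real \<Rightarrow> real set" where
  "src_foot a t = {Inf (supt a)<..<t}"

definition dest_foot :: "(real \<Rightarrow> real) \<Rightarrow> real \<Rightarrow> real set" where
  "dest_foot a t = {a t..<Sup (supt a)}"

text \<open>A marking with pairwise disjoint feet (feet of a^-1 are those of a, swapped).\<close>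
definition good_marking :: "(real \<Rightarrow> real) set \<Rightarrow> ((real \<Rightarrow> real) \<Rightarrow> real) \<Rightarrow> bool" where
  "good_marking A m \<longleftrightarrow> (\<forall>a\<in>A. m a \<in> supt a) \<and>
     (\<forall>a\<in>A. src_foot a (m a) \<inter> dest_foot a (m a) = {}) \<and>
     (\<forall>a\<in>A. \<forall>b\<in>A. a \<noteq> b \<longrightarrow>
        (src_foot a (m a) \<union> dest_foot a (m a)) \<inter> (src_foot b (m b) \<union> dest_foot b (m b)) = {})"

definition geom_fast_bumps :: "(real \<Rightarrow> real) set \<Rightarrow> bool" where
  "geom_fast_bumps A \<longleftrightarrow> (\<forall>a\<in>A. positive_bump a) \<and> geom_proper A \<and> (\<exists>m. good_marking A m)"

definition geom_fast :: "(real \<Rightarrow> real) set \<Rightarrow> bool" where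
  "geom_fast X \<longleftrightarrow> geom_proper X \<and> geom_fast_bumps (used_bumps X)"

text \<open>A diagram is (V, lt, E, lab): vertex set V with strict linear order lt,
 directed edges E (pairs; every vertex has total degree 1, so there are no
 loops or parallel edges) and edge labels lab.\<close>
definition dyn_diagram :: "'v set \<Rightarrow> ('v \<Rightarrow> 'v \<Rightarrow> bool) \<Rightarrow> ('v \<times> 'v) set \<Rightarrow> ('v \<times> 'v \<Rightarrow> 'l) \<Rightarrow> bool" where
  "dyn_diagram V lt E lab \<longleftrightarrow> finite V \<and> E \<subseteq> V \<times> V \<and>
     (\<forall>u\<in>V. \<not> lt u u) \<and>
     (\<forall>u\<in>V. \<forall>v\<in>V. \<forall>w\<in>V. lt u v \<and> lt v w \<longrightarrow> lt u w) \<and>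
     (\<forall>u\<in>V. \<forall>v\<in>V. u \<noteq> v \<longrightarrow> lt u v \<or> lt v u) \<and>
     (\<forall>v\<in>V. card {e\<in>E. fst e = v} + card {e\<in>E. snd e = v} = 1)"

definition diagram_iso ::
  "'v set \<Rightarrow> ('v \<Rightarrow> 'v \<Rightarrow> bool) \<Rightarrow> ('v \<times> 'v) set \<Rightarrow> ('v \<times> 'v \<Rightarrow> 'l) \<Rightarrow>
   'w set \<Rightarrow> ('w \<Rightarrow> 'w \<Rightarrow> bool) \<Rightarrow> ('w \<times> 'w) set \<Rightarrow> ('w \<times> 'w \<Rightarrow> 'k) \<Rightarrow> bool" where
  "diagram_iso V1 lt1 E1 lab1 V2 lt2 E2 lab2 \<longleftrightarrow>
     (\<exists>h. bij_betw h V1 V2 \<and>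
        (\<forall>u\<in>V1. \<forall>v\<in>V1. lt1 u v \<longleftrightarrow> lt2 (h u) (h v)) \<and>
        (\<forall>u\<in>V1. \<forall>v\<in>V1. (u, v) \<in> E1 \<longleftrightarrow> (h u, h v) \<in> E2) \<and>
        (\<exists>\<sigma>. bij_betw \<sigma> (lab1 ` E1) (lab2 ` E2) \<and>
           (\<forall>e\<in>E1. lab2 (h (fst e), h (snd e)) = \<sigma> (lab1 e))))"

definition diag_vertices :: "(real \<Rightarrow> real) set \<Rightarrow> ((real \<Rightarrow> real) \<Rightarrow> real) \<Rightarrow> real set set" where
  "diag_vertices X m = (\<lambda>a. src_foot a (m a)) ` used_bumps X \<union> (\<lambda>a. dest_foot a (m a)) ` used_bumps X"

definition diag_lt :: "real set \<Rightarrow> real set \<Rightarrow> bool" where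
  "diag_lt A B \<longleftrightarrow> A \<noteq> B \<and> (\<forall>x\<in>A. \<forall>y\<in>B. x < y)"

definition sb_edge :: "(real \<Rightarrow> real) set \<Rightarrow> ((real \<Rightarrow> real) \<Rightarrow> real) \<Rightarrow> (real \<Rightarrow> real) \<Rightarrow> real set \<times> real set \<Rightarrow> bool" where
  "sb_edge X m f e \<longleftrightarrow> f \<in> X \<and> (\<exists>a\<in>used_bumps X.
     (e = (src_foot a (m a), dest_foot a (m a)) \<and> agrees_on f a (supt a)) \<or>
     (e = (dest_foot a (m a), src_foot a (m a)) \<and> agrees_on f (inv a) (supt a)))"

definition diag_edges :: "(real \<Rightarrow> real) set \<Rightarrow> ((real \<Rightarrow> real) \<Rightarrow> real) \<Rightarrow> (real set \<times> real set) set" where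
  "diag_edges X m = {e. \<exists>f. sb_edge X m f e}"

definition diag_label :: "(real \<Rightarrow> real) set \<Rightarrow> ((real \<Rightarrow> real) \<Rightarrow> real) \<Rightarrow> real set \<times> real set \<Rightarrow> (real \<Rightarrow> real)" where
  "diag_label X m e = (SOME f. sb_edge X m f e)"

definition has_diagram_iso ::
  "(real \<Rightarrow> real) set \<Rightarrow> 'v set \<Rightarrow> ('v \<Rightarrow> 'v \<Rightarrow> bool) \<Rightarrow> ('v \<times> 'v) set \<Rightarrow> ('v \<times> 'v \<Rightarrow> 'l) \<Rightarrow> bool" where
  "has_diagram_iso X V lt E lab \<longleftrightarrow> (\<exists>m. good_marking (used_bumps X) m \<and>
     diagram_iso (diag_vertices X m) diag_lt (diag_edges X m) (diag_label X m) V lt E lab)"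

definition least_tp :: "(real \<Rightarrow> real) \<Rightarrow> real" where
  "least_tp f = Inf {t. left_tp f t \<or> right_tp f t}"

text \<open>Group isomorphism gen X -> gen Y sending the i-th non-identity element of X
 (ordered by least transition points) to the i-th non-identity element of Y.\<close>
definition marked_iso :: "(real \<Rightarrow> real) set \<Rightarrow> (real \<Rightarrow> real) set \<Rightarrow> ((real \<Rightarrow> real) \<Rightarrow> (real \<Rightarrow> real)) \<Rightarrow> bool" where
  "marked_iso X Y \<phi> \<longleftrightarrow> bij_betw \<phi> (gen_group X) (gen_group Y) \<and>
     (\<forall>f\<in>gen_group X. \<forall>g\<in>gen_group X. \<phi> (g \<circ> f) = \<phi> g \<circ> \<phi> f) \<and>
     bij_betw \<phi> (X - {id}) (Y - {id}) \<and>
     (\<forall>f\<in>X - {id}. \<forall>g\<in>X - {id}. least_tp f < least_tp g \<longleftrightarrow> least_tp (\<phi> f) < least_tp (\<phi> g))"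

end

theory Submission
  imports Defs
begin

text \<open>In the model the feet of all bumps are intervals of equal length that fill \<open>[0,1]\<close>, apart from a
  gap between the two feet of a bump when these are adjacent in the diagram, and each bump is linear on
  its source foot and on the complement of that foot in its orbital. The equation
  \<open>\<theta> x = a'\<inverse> (\<theta> (a x))\<close> for \<open>x\<close> in the source of a signed bump \<open>a\<close>, together with fixed
  values between the feet, then has a contraction on its right-hand side, and its unique solution
  \<open>\<theta>\<close> is a monotone continuous semiconjugacy.

  Since \<open>\<theta>\<close> is onto, it induces a homomorphism between the two groups. For injectivity let a word act
  trivially on the model and let \<open>z \<in> I\<close>. To the right of \<open>\<theta> z\<close> the word acts as a product of signed
  bumps, each of which moves the points it is applied to; the same product gives the action of the
  original word at \<open>z\<close>. By ping-pong a reduced nonempty product of this kind is not the identity on an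
  interval, so the product cancels freely and the original word fixes \<open>z\<close>.\<close>

section \<open>Homeomorphisms of the interval\<close>

text \<open>Realizations of one diagram differ in the room between consecutive feet, and there may
  be none. A continuous map carrying feet onto feet can then only reach a model without such room;
  the exception is the room between adjacent feet of one bump, since a marker and its image never
  coincide. That room also makes an orbital without one of its feet at least two foot lengths long,
  which is the origin of the factor \<open>1/2\<close>. The map \<open>\<theta>\<close> may collapse
  intervals, so a relation in the model says nothing directly about points with the same image. What
  survives is which orbitals a point lies in; hence a word is rewritten, separately for each
  \<open>z\<close>, as the list of signed bumps that it really uses. Reading this list at the single
  point \<open>\<theta> z\<close> would be too weak: reduced products can have isolated fixed
  points, and the ends of orbitals are fixed. On a small interval to the right of
  \<open>\<theta> z\<close> each letter moves all points or none, and two distinct points there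
  contradict uniform contraction or expansion.\<close>

lemma strict_mono_surj_isCont:
  fixes f :: "real \<Rightarrow> real"
  assumes "strict_mono f" "surj f"
  shows "isCont f x"
proof -
  have "continuous_on UNIV f"
    using assms by (intro continuous_onI_mono) (auto simp: strict_mono_less_eq)
  then show ?thesis
    by (simp add: continuous_on_eq_continuous_at)
qed

text \<open>Extended by the identity, an element is a strictly increasing bijection of the whole
  line, so order, composition and \<open>inv\<close> can be handled without domain conditions on
  \<open>{0..1}\<close>.\<close>

lemma homeo_plus_iff:
  "homeo_plus f \<longleftrightarrow> strict_mono f \<and> surj f \<and> (\<forall>t. t \<notin> {0<..<1} \<longrightarrow> f t = t)"
proof
  assume h: "homeo_plus f"
  then have m: "\<And>s t. s \<in> {0..1} \<Longrightarrow> t \<in> {0..1} \<Longrightarrow> s < t \<Longrightarrow> f s < f t"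
    and im: "f ` {0..1} = {0..1}" and out: "\<And>t. t \<notin> {0..1} \<Longrightarrow> f t = t"
    unfolding homeo_plus_def by (auto simp: strict_mono_on_def)
  have in01: "\<And>t. t \<in> {0..1} \<Longrightarrow> f t \<in> {0..1}" using im by blast
  have "(0::real) \<in> f ` {0..1}" "(1::real) \<in> f ` {0..1}" using im by auto
  then obtain s s' where s: "s \<in> {0..1}" "f s = 0" and s': "s' \<in> {0..1}" "f s' = 1"
    by (metis imageE)
  have f0: "f 0 = 0" using s m[of 0 s] in01[of 0] by (cases "s = 0") auto
  have f1: "f 1 = 1" using s' m[of s' 1] in01[of 1] by (cases "s' = 1") auto
  have mono: "f s < f t" if "s < t" for s t
  proof (cases "s \<in> {0..1}")
    case True
    then show ?thesis using that m[of s t] in01[of s] out[of t] by (cases "t \<in> {0..1}") auto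
  next
    case False
    then show ?thesis using that out[of s] in01[of t] out[of t]
      by (cases "t \<in> {0..1}") auto
  qed
  moreover have "surj f"
    unfolding surj_def using im out by (metis imageE)
  ultimately show "strict_mono f \<and> surj f \<and> (\<forall>t. t \<notin> {0<..<1} \<longrightarrow> f t = t)"
    using f0 f1 out by (metis atLeastAtMost_iff greaterThanLessThan_iff order_le_less strict_monoI)
next
  assume h: "strict_mono f \<and> surj f \<and> (\<forall>t. t \<notin> {0<..<1} \<longrightarrow> f t = t)"
  then have sm: "strict_mono f" and su: "surj f" and f0: "f 0 = 0" and f1: "f 1 = 1"
    and out: "\<And>t. t \<notin> {0..1} \<Longrightarrow> f t = t" by auto
  have iff: "f t \<in> {0..1} \<longleftrightarrow> t \<in> {0..1}" for t
    using strict_mono_less_eq[OF sm, of 0 t] strict_mono_less_eq[OF sm, of t 1] f0 f1 by auto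
  have "f ` {0..1} = {0..1}"
  proof safe
    fix y :: real assume y: "y \<in> {0..1}"
    then obtain t where "y = f t" using su by (metis surjD)
    then show "y \<in> f ` {0..1}" using iff y by blast
  qed (use iff in auto)
  then show "homeo_plus f"
    unfolding homeo_plus_def using strict_mono_surj_isCont[OF sm su] sm out
    by (auto simp: continuous_at_imp_continuous_on strict_mono_on_def strict_mono_def)
qed

lemma homeo_plus_outside: "homeo_plus f \<Longrightarrow> t \<notin> {0<..<1} \<Longrightarrow> f t = t"
  by (auto simp: homeo_plus_iff)

lemma homeo_plus_isCont: "homeo_plus f \<Longrightarrow> isCont f x"
  by (simp add: homeo_plus_iff strict_mono_surj_isCont)

lemma homeo_plus_bij: "homeo_plus f \<Longrightarrow> bij f"
  by (simp add: bij_def homeo_plus_iff strict_mono_imp_inj_on)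

lemma homeo_plus_less: "homeo_plus f \<Longrightarrow> f s < f t \<longleftrightarrow> s < t"
  and homeo_plus_le: "homeo_plus f \<Longrightarrow> f s \<le> f t \<longleftrightarrow> s \<le> t"
  and homeo_plus_eq: "homeo_plus f \<Longrightarrow> f s = f t \<longleftrightarrow> s = t"
  by (auto simp: homeo_plus_iff strict_mono_less strict_mono_less_eq strict_mono_eq)

lemma homeo_plus_inv_f: "homeo_plus f \<Longrightarrow> inv f (f t) = t"
  and homeo_plus_f_inv: "homeo_plus f \<Longrightarrow> f (inv f t) = t"
  using homeo_plus_bij[of f] by (auto simp: bij_def inv_f_f surj_f_inv_f)

lemma homeo_plus_in_unit: "homeo_plus f \<Longrightarrow> f t \<in> {0..1} \<longleftrightarrow> t \<in> {0..1}"
  using homeo_plus_le[of f 0 t] homeo_plus_le[of f t 1] homeo_plus_outside[of f 0]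
    homeo_plus_outside[of f 1] by auto

lemma homeo_plus_id: "homeo_plus id"
  by (simp add: homeo_plus_iff strict_mono_def)

lemma homeo_plus_comp:
  assumes "homeo_plus f" "homeo_plus g" shows "homeo_plus (g \<circ> f)"
  unfolding homeo_plus_iff
proof (intro conjI allI impI)
  show "strict_mono (g \<circ> f)"
    using assms by (auto simp: strict_mono_def homeo_plus_less)
  show "surj (g \<circ> f)"
    by (intro bij_is_surj bij_comp homeo_plus_bij assms)
  show "(g \<circ> f) t = t" if "t \<notin> {0<..<1}" for t
    using that assms by (simp add: homeo_plus_outside)
qed

lemma homeo_plus_inv:
  assumes "homeo_plus f" shows "homeo_plus (inv f)"
  unfolding homeo_plus_iff
proof (intro conjI allI impI)
  show "strict_mono (inv f)"
    using homeo_plus_less[OF assms, of "inv f _" "inv f _"]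
    by (intro strict_monoI) (simp add: homeo_plus_f_inv[OF assms])
  show "surj (inv f)"
    by (intro bij_is_surj bij_imp_bij_inv homeo_plus_bij assms)
  show "inv f t = t" if "t \<notin> {0<..<1}" for t
    using homeo_plus_outside[OF assms that] homeo_plus_inv_f[OF assms, of t] by simp
qed

lemma homeo_plus_inv_inv: "homeo_plus f \<Longrightarrow> inv (inv f) = f"
  by (simp add: homeo_plus_bij inv_inv_eq)

lemma homeo_plus_inv_comp: "homeo_plus f \<Longrightarrow> homeo_plus g \<Longrightarrow> inv (g \<circ> f) = inv f \<circ> inv g"
  by (simp add: homeo_plus_bij o_inv_distrib)

lemma homeo_plus_inv_comp_self: "homeo_plus f \<Longrightarrow> inv f \<circ> f = id" "homeo_plus f \<Longrightarrow> f \<circ> inv f = id"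
  by (auto simp: homeo_plus_inv_f homeo_plus_f_inv fun_eq_iff)

lemma homeo_plus_eventually_at_right:
  assumes f: "homeo_plus f" and ev: "eventually P (at_right (f p))"
  shows "eventually (\<lambda>q. P (f q)) (at_right p)"
proof -
  obtain b where b: "b > f p" "\<And>y. y > f p \<Longrightarrow> y < b \<Longrightarrow> P y"
    using ev eventually_at_right_field by metis
  have "p < inv f b"
    using b(1) homeo_plus_less[OF f, of p "inv f b"] homeo_plus_f_inv[OF f] by simp
  moreover have "P (f q)" if "p < q" "q < inv f b" for q
    using that b(2)[of "f q"] homeo_plus_less[OF f] homeo_plus_f_inv[OF f, of b] by metis
  ultimately show ?thesis
    unfolding eventually_at_right_field by blast
qed

lemma eventually_at_right_two:
  fixes P :: real
  assumes "\<forall>\<^sub>F q in at_right P. Q q"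
  shows "\<exists>q q'. q \<noteq> q' \<and> Q q \<and> Q q'"
proof -
  obtain b where b: "b > P" "\<And>q. q > P \<Longrightarrow> q < b \<Longrightarrow> Q q"
    using assms eventually_at_right_field by metis
  obtain q where "P < q" "q < b" using dense[OF b(1)] by blast
  moreover obtain q' where "P < q'" "q' < q" using dense[OF \<open>P < q\<close>] by blast
  ultimately have "q \<noteq> q'" "Q q" "Q q'" using b(2) by auto
  then show ?thesis by blast
qed

text \<open>Right germs fit half-open intervals: just to the right of \<open>P\<close> membership is
  decided, even when \<open>P\<close> is an end point. The half-open feet of the model rely on
  this.\<close>

lemma eventually_at_right_interval:
  fixes P :: real
  shows "(a \<le> P \<and> P < b \<longrightarrow> (\<forall>\<^sub>F q in at_right P. q \<in> {a<..<b})) \<and>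
    (\<not> (a \<le> P \<and> P < b) \<longrightarrow> (\<forall>\<^sub>F q in at_right P. q \<notin> {a..<b}))"
proof (intro conjI impI)
  assume "a \<le> P \<and> P < b"
  then show "\<forall>\<^sub>F q in at_right P. q \<in> {a<..<b}"
    unfolding eventually_at_right_field by (intro exI[of _ b]) auto
next
  assume "\<not> (a \<le> P \<and> P < b)"
  then show "\<forall>\<^sub>F q in at_right P. q \<notin> {a..<b}"
    unfolding eventually_at_right_field by (intro exI[of _ "if P < a then a else P + 1"]) auto
qed

section \<open>Supports, bumps and transition points\<close>

lemma homeo_plus_supt: "homeo_plus f \<Longrightarrow> supt f = {t. f t \<noteq> t}"
  unfolding supt_def using homeo_plus_outside[of f]
  by (metis (no_types, opaque_lifting) atLeastAtMost_iff greaterThanLessThan_iff less_imp_le)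

lemma open_supt:
  assumes "homeo_plus f" shows "open (supt f)"
proof -
  have "open {t. f t \<noteq> t}"
    using homeo_plus_isCont[OF assms]
    by (intro open_Collect_neq continuous_at_imp_continuous_on) auto
  then show ?thesis using assms by (simp add: homeo_plus_supt)
qed

lemma supt_inv:
  assumes "homeo_plus f" shows "supt (inv f) = supt f"
proof -
  have "inv f t = t \<longleftrightarrow> f t = t" for t
    using homeo_plus_inv_f[OF assms, of t] homeo_plus_f_inv[OF assms, of t] by metis
  then show ?thesis using assms by (simp add: homeo_plus_supt homeo_plus_inv)
qed

lemma supt_empty_iff:
  assumes "homeo_plus f" shows "supt f = {} \<longleftrightarrow> f = id"
  using assms by (auto simp: homeo_plus_supt fun_eq_iff)

lemma open_interval_Inf_Sup:
  fixes S :: "real set"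
  assumes "open S" "connected S" "S \<noteq> {}" "bdd_below S" "bdd_above S"
  shows "S = {Inf S<..<Sup S}"
proof (intro equalityI subsetI)
  fix s assume s: "s \<in> S"
  obtain e where e: "e > 0" "ball s e \<subseteq> S" using \<open>open S\<close> s open_contains_ball by blast
  then have "s - e/2 \<in> S" "s + e/2 \<in> S" by (auto simp: dist_real_def)
  then have "Inf S \<le> s - e/2" "s + e/2 \<le> Sup S"
    using assms by (auto intro: cInf_lower cSup_upper)
  then show "s \<in> {Inf S<..<Sup S}" using e by auto
next
  fix s assume s: "s \<in> {Inf S<..<Sup S}"
  then obtain u v where "u \<in> S" "u < s" "v \<in> S" "s < v"
    using assms cInf_less_iff[of S s] less_cSup_iff[of S s] by auto
  then show "s \<in> S" using \<open>connected S\<close> connectedD_interval[of S u v s] by auto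
qed

lemma connected_supt_bump:
  assumes "bump a"
  shows "connected (supt a)" "supt a \<noteq> {}"
proof -
  obtain J where J: "J \<in> orbitals a" "\<And>K. K \<in> orbitals a \<Longrightarrow> K = J"
    using assms unfolding bump_def by (elim conjE ex1E) blast
  obtain s where s: "s \<in> supt a" "J = connected_component_set (supt a) s"
    using J(1) unfolding orbitals_def by auto
  have "supt a \<subseteq> J"
  proof
    fix t assume t: "t \<in> supt a"
    then have "connected_component_set (supt a) t = J" using J(2) unfolding orbitals_def by blast
    moreover have "t \<in> connected_component_set (supt a) t" using t by simp
    ultimately show "t \<in> J" by simp
  qed
  then have "supt a = J" using s connected_component_subset by blast
  then show "connected (supt a)" using connected_connected_component[of "supt a" s] s(2) by simp
  show "supt a \<noteq> {}" using s by auto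
qed

lemma supt_bump:
  assumes "bump a"
  shows "supt a = {Inf (supt a)<..<Sup (supt a)}" "0 \<le> Inf (supt a)"
    "Inf (supt a) < Sup (supt a)" "Sup (supt a) \<le> 1"
proof -
  have h: "homeo_plus a" using assms bump_def by auto
  have bd: "bdd_below (supt a)" "bdd_above (supt a)"
    by (rule bdd_belowI[of _ 0], simp add: supt_def, rule bdd_aboveI[of _ 1], simp add: supt_def)
  show *: "supt a = {Inf (supt a)<..<Sup (supt a)}"
    using open_interval_Inf_Sup[OF open_supt[OF h] connected_supt_bump[OF assms] bd] .
  show "0 \<le> Inf (supt a)" "Sup (supt a) \<le> 1"
    using connected_supt_bump(2)[OF assms]
    by (auto intro!: cInf_greatest cSup_least simp: supt_def)
  show "Inf (supt a) < Sup (supt a)"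
    using * connected_supt_bump(2)[OF assms] by (metis greaterThanLessThan_empty not_le less_imp_le)
qed

lemma bump_of_interval:
  assumes "homeo_plus a" "supt a = {x<..<y}" "x < y"
  shows "bump a"
proof -
  have "connected_component_set {x<..<y} t = {x<..<y}" if "t \<in> {x<..<y}" for t
    using that by (simp add: connected_component_eq_self)
  moreover have "(x + y) / 2 \<in> {x<..<y}" using assms by auto
  ultimately have "orbitals a = {{x<..<y}}"
    unfolding orbitals_def assms(2) by blast
  then show ?thesis using assms unfolding bump_def by auto
qed

lemma agrees_on_inv_iff:
  assumes a: "homeo_plus a" and f: "homeo_plus f"
  shows "agrees_on f (inv a) (supt a) \<longleftrightarrow> agrees_on (inv f) a (supt a)"
proof -
  have inv_supt: "a t \<in> supt a \<longleftrightarrow> t \<in> supt a" "inv a t \<in> supt a \<longleftrightarrow> t \<in> supt a" for t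
    using a homeo_plus_f_inv[OF a] homeo_plus_eq[OF a] by (auto simp: homeo_plus_supt) metis+
  show ?thesis
  proof
    assume "agrees_on f (inv a) (supt a)"
    then have "f (a t) = t" if "t \<in> supt a" for t
      using that inv_supt homeo_plus_inv_f[OF a] by (auto simp: agrees_on_def)
    then show "agrees_on (inv f) a (supt a)"
      using homeo_plus_inv_f[OF f] by (metis agrees_on_def)
  next
    assume "agrees_on (inv f) a (supt a)"
    then have "inv f (inv a t) = t" if "t \<in> supt a" for t
      using that inv_supt homeo_plus_f_inv[OF a] by (auto simp: agrees_on_def)
    then show "agrees_on f (inv a) (supt a)"
      using homeo_plus_f_inv[OF f] by (metis agrees_on_def)
  qed
qed

lemma frequently_at_right_interval_iff:
  "(\<forall>\<epsilon>>0. {t<..<t+\<epsilon>} \<inter> S \<noteq> {}) \<longleftrightarrow> (\<exists>\<^sub>F q in at_right (t::real). q \<in> S)"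
proof -
  have "(\<exists>\<^sub>F q in at_right t. q \<in> S) \<longleftrightarrow> (\<forall>b>t. \<exists>q>t. q < b \<and> q \<in> S)"
    unfolding frequently_def eventually_at_right_field by auto
  also have "\<dots> \<longleftrightarrow> (\<forall>\<epsilon>>0. {t<..<t+\<epsilon>} \<inter> S \<noteq> {})"
  proof safe
    fix e :: real assume "\<forall>b>t. \<exists>q>t. q < b \<and> q \<in> S" "e > 0" "{t<..<t+e} \<inter> S = {}"
    then obtain q where "q > t" "q < t + e" "q \<in> S" by (meson less_add_same_cancel1)
    then show False using \<open>{t<..<t+e} \<inter> S = {}\<close> by auto
  next
    fix b assume "\<forall>e>0. {t<..<t+e} \<inter> S \<noteq> {}" "b > t"
    then have "{t<..<t+(b-t)} \<inter> S \<noteq> {}" by (meson diff_gt_0_iff_gt)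
    then show "\<exists>q>t. q < b \<and> q \<in> S" by auto
  qed
  finally show ?thesis by simp
qed

lemma frequently_at_left_interval_iff:
  "(\<forall>\<epsilon>>0. {t-\<epsilon><..<t} \<inter> S \<noteq> {}) \<longleftrightarrow> (\<exists>\<^sub>F q in at_left (t::real). q \<in> S)"
proof -
  have "(\<exists>\<^sub>F q in at_left t. q \<in> S) \<longleftrightarrow> (\<forall>b<t. \<exists>q<t. q > b \<and> q \<in> S)"
    unfolding frequently_def eventually_at_left_field by auto
  also have "\<dots> \<longleftrightarrow> (\<forall>\<epsilon>>0. {t-\<epsilon><..<t} \<inter> S \<noteq> {})"
  proof safe
    fix e :: real assume "\<forall>b<t. \<exists>q<t. q > b \<and> q \<in> S" "e > 0" "{t-e<..<t} \<inter> S = {}"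
    then obtain q where "q < t" "q > t - e" "q \<in> S" by (meson diff_less_eq less_add_same_cancel1)
    then show False using \<open>{t-e<..<t} \<inter> S = {}\<close> by auto
  next
    fix b assume "\<forall>e>0. {t-e<..<t} \<inter> S \<noteq> {}" "b < t"
    then have "{t-(t-b)<..<t} \<inter> S \<noteq> {}" by (meson diff_gt_0_iff_gt)
    then show "\<exists>q<t. q > b \<and> q \<in> S" by auto
  qed
  finally show ?thesis by simp
qed

text \<open>Finiteness of \<open>I\<close> makes the points of the support that accumulate at
  \<open>t\<close> from the right do so within a single interval; lying outside that interval,
  \<open>t\<close> must be its left end.\<close>

lemma left_tp_supt_Union:
  assumes "finite I" "supt f = (\<Union>i\<in>I. {x i<..<y i})" "left_tp f t"
  shows "\<exists>i\<in>I. t = x i"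
proof -
  have "\<exists>\<^sub>F q in at_right t. \<exists>i\<in>I. q \<in> {x i<..<y i}"
    using assms(3,2) unfolding left_tp_def frequently_at_right_interval_iff by auto
  then obtain i where i: "i \<in> I" "\<exists>\<^sub>F q in at_right t. q \<in> {x i<..<y i}"
    using frequently_bex_finite[OF assms(1), of "\<lambda>q i. q \<in> {x i<..<y i}" "at_right t"] by blast
  have nt: "t \<notin> {x i<..<y i}" using assms i(1) unfolding left_tp_def by auto
  have inter: "\<And>e. e > 0 \<Longrightarrow> {t<..<t+e} \<inter> {x i<..<y i} \<noteq> {}"
    using i(2) unfolding frequently_at_right_interval_iff[symmetric] by auto
  have "x i \<le> t"
  proof (rule ccontr)
    assume "\<not> x i \<le> t"
    then show False using inter[of "x i - t"] by auto
  qed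
  moreover have "t < y i" using inter[of 1] by auto
  ultimately show ?thesis using nt i(1) by force
qed

lemma right_tp_supt_Union:
  assumes "finite I" "supt f = (\<Union>i\<in>I. {x i<..<y i})" "right_tp f t"
  shows "\<exists>i\<in>I. t = y i"
proof -
  have "\<exists>\<^sub>F q in at_left t. \<exists>i\<in>I. q \<in> {x i<..<y i}"
    using assms(3,2) unfolding right_tp_def frequently_at_left_interval_iff by auto
  then obtain i where i: "i \<in> I" "\<exists>\<^sub>F q in at_left t. q \<in> {x i<..<y i}"
    using frequently_bex_finite[OF assms(1), of "\<lambda>q i. q \<in> {x i<..<y i}" "at_left t"] by blast
  have nt: "t \<notin> {x i<..<y i}" using assms i(1) unfolding right_tp_def by auto
  have inter: "\<And>e. e > 0 \<Longrightarrow> {t-e<..<t} \<inter> {x i<..<y i} \<noteq> {}"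
    using i(2) unfolding frequently_at_left_interval_iff[symmetric] by auto
  have "t \<le> y i"
  proof (rule ccontr)
    assume "\<not> t \<le> y i"
    then show False using inter[of "t - y i"] by auto
  qed
  moreover have "x i < t" using inter[of 1] by auto
  ultimately show ?thesis using nt i(1) by force
qed

text \<open>The support is open, so its infimum lies outside it and is approached from the right;
  below the infimum there is no support and hence no transition point.\<close>

lemma least_tp_eq_Inf_supt:
  assumes f: "homeo_plus f" "f \<noteq> id"
  shows "least_tp f = Inf (supt f)" "left_tp f (Inf (supt f))"
proof -
  let ?m = "Inf (supt f)"
  have ne: "supt f \<noteq> {}" using f supt_empty_iff by blast
  have bd: "bdd_below (supt f)" by (rule bdd_belowI[of _ 0]) (simp add: supt_def)
  have le: "\<And>t. t \<in> supt f \<Longrightarrow> ?m \<le> t" using bd by (rule cInf_lower[rotated])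
  have ns: "?m \<notin> supt f"
  proof
    assume "?m \<in> supt f"
    then obtain e where e: "e > 0" "ball ?m e \<subseteq> supt f"
      using open_supt[OF f(1)] open_contains_ball by blast
    then have "?m - e/2 \<in> supt f" by (auto simp: dist_real_def)
    then show False using le[of "?m - e/2"] e by auto
  qed
  have "?m \<in> {0..1}"
    using ne le by (auto intro!: cInf_greatest simp: supt_def) (force simp: supt_def)
  moreover have "{?m<..<?m+e} \<inter> supt f \<noteq> {}" if "e > 0" for e
  proof -
    obtain s where "s \<in> supt f" "s < ?m + e" 
      using cInf_lessD[OF ne, of "?m + e"] \<open>e > 0\<close> by (metis less_add_same_cancel1)
    moreover have "?m < s" using le[of s] ns \<open>s \<in> supt f\<close> by (cases "s = ?m") auto
    ultimately show ?thesis by (simp add: disjoint_iff) (metis)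
  qed
  ultimately show l: "left_tp f ?m" using ns unfolding left_tp_def by auto
  have "?m \<le> t" if "left_tp f t \<or> right_tp f t" for t
  proof (rule ccontr)
    assume "\<not> ?m \<le> t"
    then have "{t<..<t+(?m-t)} \<inter> supt f = {}" "{t-1<..<t} \<inter> supt f = {}"
      using le by force+
    moreover have "{t<..<t+(?m-t)} \<inter> supt f \<noteq> {} \<or> {t-1<..<t} \<inter> supt f \<noteq> {}"
      using that \<open>\<not> ?m \<le> t\<close> unfolding left_tp_def right_tp_def
      by (meson diff_gt_0_iff_gt not_le zero_less_one)
    ultimately show False by blast
  qed
  then show "least_tp f = ?m"
    unfolding least_tp_def using l by (intro cInf_eq_minimum) auto
qed

text \<open>By continuity both \<open>f\<close> and \<open>inv f\<close> move \<open>x\<close>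
  weakly to the right and \<open>y\<close> weakly to the left, which is possible only if both points
  are fixed.\<close>

lemma interval_endpoints_fixed:
  assumes f: "homeo_plus f" and "x < y"
    and inv: "\<And>t. t \<in> {x<..<y} \<Longrightarrow> f t \<in> {x<..<y}"
    and ivl: "\<And>t. t \<in> {x<..<y} \<Longrightarrow> inv f t \<in> {x<..<y}"
  shows "f x = x" "f y = y"
proof -
  have le: "x \<le> g x \<and> g y \<le> y" if g: "homeo_plus g" and gi: "\<And>t. t \<in> {x<..<y} \<Longrightarrow> g t \<in> {x<..<y}" for g
  proof
    have "(g \<longlongrightarrow> g x) (at_right x)" "(g \<longlongrightarrow> g y) (at_left y)"
      using homeo_plus_isCont[OF g] by (auto simp: isCont_def intro: filterlim_at_within_not_equal tendsto_within_subset)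
    moreover have "\<forall>\<^sub>F t in at_right x. x \<le> g t" "\<forall>\<^sub>F t in at_left y. g t \<le> y"
      using \<open>x < y\<close> gi unfolding eventually_at_right_field eventually_at_left_field
      by (meson greaterThanLessThan_iff less_imp_le)+
    ultimately show "x \<le> g x" "g y \<le> y"
      by (auto intro: tendsto_lowerbound tendsto_upperbound)
  qed
  have 1: "x \<le> f x" "f y \<le> y" using le[OF f inv] by auto
  have 2: "x \<le> inv f x" "inv f y \<le> y" using le[OF homeo_plus_inv[OF f] ivl] by auto
  show "f x = x" using 1(1) 2(1) homeo_plus_le[OF f, of x "inv f x"] homeo_plus_f_inv[OF f] by simp
  show "f y = y" using 1(2) 2(2) homeo_plus_le[OF f, of "inv f y" y] homeo_plus_f_inv[OF f] by simp
qed

text \<open>The bump maps its support onto itself, hence so does \<open>f\<close>, and the ends of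
  an invariant interval are fixed. Thus the support of the bump is a full orbital of
  \<open>f\<close>.\<close>

lemma bump_agrees_fixes_endpoints:
  assumes f: "homeo_plus f" and a: "bump a"
    and ag: "agrees_on f a (supt a) \<or> agrees_on f (inv a) (supt a)"
  shows "f (Inf (supt a)) = Inf (supt a)" "f (Sup (supt a)) = Sup (supt a)"
    "supt a \<subseteq> supt f" "left_tp f (Inf (supt a))"
proof -
  let ?x = "Inf (supt a)" and ?y = "Sup (supt a)"
  have ha: "homeo_plus a" using a bump_def by auto
  note S = supt_bump[OF a]
  have main: "g ?x = ?x \<and> g ?y = ?y \<and> supt a \<subseteq> supt g" if g: "homeo_plus g" and ag: "agrees_on g a (supt a)" for g
  proof -
    have ina: "a t \<in> supt a" "inv a t \<in> supt a" if "t \<in> supt a" for t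
      using that homeo_plus_eq[OF ha] homeo_plus_f_inv[OF ha, of t]
      by (auto simp: homeo_plus_supt[OF ha])
    have 1: "g t \<in> supt a" if "t \<in> supt a" for t
      using that ag ina by (simp add: agrees_on_def)
    have 2: "inv g t \<in> supt a" if "t \<in> supt a" for t
    proof -
      have "g (inv a t) = t" using ag ina(2)[OF that] homeo_plus_f_inv[OF ha, of t] by (simp add: agrees_on_def)
      then have "inv g t = inv a t" using homeo_plus_inv_f[OF g] by metis
      then show ?thesis using ina(2)[OF that] by simp
    qed
    have "g ?x = ?x" "g ?y = ?y"
      using interval_endpoints_fixed[OF g S(3)] 1 2 S(1) by metis+
    moreover have "supt a \<subseteq> supt g"
      using ag by (auto simp: homeo_plus_supt[OF g] homeo_plus_supt[OF ha] agrees_on_def)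
    ultimately show ?thesis by auto
  qed
  have m: "f ?x = ?x \<and> f ?y = ?y \<and> supt a \<subseteq> supt f"
  proof (cases "agrees_on f a (supt a)")
    case False
    then have *: "agrees_on (inv f) a (supt a)" using ag agrees_on_inv_iff[OF ha f] by auto
    have "inv f ?x = ?x \<and> inv f ?y = ?y \<and> supt a \<subseteq> supt (inv f)"
      using main[OF homeo_plus_inv[OF f] *] .
    then show ?thesis using supt_inv[OF f] homeo_plus_f_inv[OF f] by metis
  qed (use main f in auto)
  then show "f ?x = ?x" "f ?y = ?y" "supt a \<subseteq> supt f" by auto
  have "{?x<..<?x+e} \<inter> supt f \<noteq> {}" if "e > 0" for e
  proof -
    define s where "s = min (?x + e/2) ((?x+?y)/2)"
    have "s \<in> {?x<..<?y}" "s < ?x + e" using S(3) that by (auto simp: s_def min_def)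
    moreover have "s \<in> supt f" using m S(1) \<open>s \<in> {?x<..<?y}\<close> by blast
    ultimately show ?thesis by auto
  qed
  moreover have "?x \<in> {0..1}" using S by auto
  ultimately show "left_tp f ?x" using m f by (auto simp: left_tp_def homeo_plus_supt)
qed

text \<open>\<open>f\<close> fixes the ends of both supports and moves every point inside them, so
  no end of one interval lies in the other.\<close>

lemma overlapping_bumps_same_supt:
  assumes f: "homeo_plus f" and a: "bump a" and b: "bump b"
    and ag: "agrees_on f a (supt a) \<or> agrees_on f (inv a) (supt a)"
      "agrees_on f b (supt b) \<or> agrees_on f (inv b) (supt b)"
    and ne: "supt a \<inter> supt b \<noteq> {}"
  shows "supt a = supt b"
proof -
  note A = bump_agrees_fixes_endpoints[OF f a ag(1)] supt_bump(1)[OF a]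
  note B = bump_agrees_fixes_endpoints[OF f b ag(2)] supt_bump(1)[OF b]
  have "Inf (supt a) \<notin> supt b" "Sup (supt a) \<notin> supt b" "Inf (supt b) \<notin> supt a" "Sup (supt b) \<notin> supt a"
    using A B homeo_plus_supt[OF f] by blast+
  moreover obtain q where "q \<in> supt a" "q \<in> supt b" using ne by blast
  ultimately have "Inf (supt a) = Inf (supt b)" "Sup (supt a) = Sup (supt b)"
    using A(5) B(5) by (metis greaterThanLessThan_iff less_trans linorder_neqE_linordered_idom)+
  then show ?thesis using A(5) B(5) by simp
qed

lemma positive_bump_restriction:
  assumes g: "homeo_plus g" and xy: "x < y" "g x = x" "g y = y"
    and up: "\<And>t. x < t \<Longrightarrow> t < y \<Longrightarrow> t < g t"
  defines "a \<equiv> \<lambda>t. if x < t \<and> t < y then g t else t"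
  shows "homeo_plus a" "supt a = {x<..<y}" "positive_bump a"
proof -
  have iff: "x < g t \<and> g t < y \<longleftrightarrow> x < t \<and> t < y" for t
    using homeo_plus_less[OF g, of x t] homeo_plus_less[OF g, of t y] xy by auto
  have "strict_mono a"
  proof (rule strict_monoI)
    fix s t :: real assume "s < t"
    then show "a s < a t"
      using iff[of s] iff[of t] homeo_plus_less[OF g, of s t] unfolding a_def by (auto split: if_splits)
  qed
  moreover have "surj a"
    unfolding surj_def
  proof
    fix t show "\<exists>s. t = a s"
      using iff[of "inv g t"] homeo_plus_f_inv[OF g, of t] unfolding a_def by metis
  qed
  moreover have "a t = t" if "t \<notin> {0<..<1}" for t
    using homeo_plus_outside[OF g that] unfolding a_def by auto
  ultimately show h: "homeo_plus a" by (auto simp: homeo_plus_iff)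
  have "a t \<noteq> t \<longleftrightarrow> t \<in> {x<..<y}" for t
    using up[of t] by (auto simp: a_def)
  then show s: "supt a = {x<..<y}"
    unfolding homeo_plus_supt[OF h] by blast
  show "positive_bump a"
    unfolding positive_bump_def using bump_of_interval[OF h s xy(1)] s up by (auto simp: a_def)
qed

lemma ex_positive_bump_at:
  assumes f: "homeo_plus f" and q: "q \<in> supt f"
  shows "\<exists>a. positive_bump a \<and> q \<in> supt a \<and> (agrees_on f a (supt a) \<or> agrees_on f (inv a) (supt a))"
proof -
  define C where "C = connected_component_set (supt f) q"
  define x y where "x = Inf C" and "y = Sup C"
  have sub: "C \<subseteq> supt f" unfolding C_def by (rule connected_component_subset)
  have conn: "connected C" unfolding C_def by (rule connected_connected_component)
  have qC: "q \<in> C" unfolding C_def using q by simp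
  have "bdd_below C" "bdd_above C" "open C"
    using sub open_supt[OF f] supt_def
    by (auto intro!: bdd_belowI[of _ 0] bdd_aboveI[of _ 1] simp: C_def open_connected_component supt_def)
  then have C: "C = {x<..<y}"
    unfolding x_def y_def using open_interval_Inf_Sup conn qC by blast
  have qxy: "x < q" "q < y" using qC C by auto
  have max: "T \<subseteq> C" if "q \<in> T" "connected T" "T \<subseteq> supt f" for T
    unfolding C_def using that by (rule connected_component_maximal)
  have fx: "f x = x"
  proof (rule ccontr)
    assume "f x \<noteq> x"
    then have "x \<in> supt f" using homeo_plus_supt[OF f] by auto
    then have "{x..<y} \<subseteq> supt f" using sub C by (force simp: le_less)
    then show False using max[of "{x..<y}"] qxy C by force
  qed
  have fy: "f y = y"
  proof (rule ccontr)
    assume "f y \<noteq> y"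
    then have "y \<in> supt f" using homeo_plus_supt[OF f] by auto
    then have "{x<..y} \<subseteq> supt f" using sub C by (force simp: le_less)
    then show False using max[of "{x<..y}"] qxy C by force
  qed
  have main: "\<exists>a. positive_bump a \<and> q \<in> supt a \<and> agrees_on g a (supt a)"
    if g: "homeo_plus g" "g x = x" "g y = y" "C \<subseteq> supt g" "q < g q" for g
  proof -
    \<comment> \<open>The displacement has no zero on the connected set \<open>C\<close>, so its
      sign at \<open>q\<close> is its sign on all of \<open>C\<close>.\<close>
    have up: "t < g t" if t: "x < t" "t < y" for t
    proof (rule ccontr)
      assume "\<not> t < g t"
      have nz: "g s - s \<noteq> 0" if "s \<in> C" for s using that g(4) homeo_plus_supt[OF g(1)] by auto
      have cont: "continuous_on C (\<lambda>s. g s - s)"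
        using homeo_plus_isCont[OF g(1)] by (intro continuous_intros continuous_at_imp_continuous_on) auto
      have "connected ((\<lambda>s. g s - s) ` C)" using cont conn by (rule connected_continuous_image)
      moreover have "g t - t \<in> (\<lambda>s. g s - s) ` C" "g q - q \<in> (\<lambda>s. g s - s) ` C" using t qC C by auto
      ultimately have "0 \<in> (\<lambda>s. g s - s) ` C"
        using \<open>\<not> t < g t\<close> g(5) by (auto intro: connectedD_interval)
      then show False using nz by force
    qed
    define a where "a = (\<lambda>t. if x < t \<and> t < y then g t else t)"
    have "supt a = {x<..<y}" "positive_bump a"
      unfolding a_def using positive_bump_restriction[OF g(1) _ g(2,3) up] qxy by auto
    moreover have "agrees_on g a {x<..<y}" by (auto simp: agrees_on_def a_def)
    ultimately show ?thesis using qxy by auto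
  qed
  have ne: "f q \<noteq> q" using q homeo_plus_supt[OF f] by auto
  show ?thesis
  proof (cases "q < f q")
    case True
    then show ?thesis using main[OF f fx fy sub] by blast
  next
    case False
    then have "q < inv f q"
      using ne homeo_plus_less[OF f, of q "inv f q"] homeo_plus_f_inv[OF f, of q] by auto
    moreover have "inv f x = x" "inv f y = y" using fx fy homeo_plus_inv_f[OF f] by metis+
    ultimately obtain a where a: "positive_bump a" "q \<in> supt a" "agrees_on (inv f) a (supt a)"
      using main[OF homeo_plus_inv[OF f]] sub supt_inv[OF f] by auto
    then have "agrees_on f (inv a) (supt a)"
      using agrees_on_inv_iff[of a f] f by (auto simp: positive_bump_def bump_def)
    then show ?thesis using a by blast
  qed
qed

text \<open>The sign of \<open>f q - q\<close> shows whether \<open>f\<close> agrees with a positive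
  bump or with its inverse, so the same alternative holds for \<open>a\<close> and
  \<open>b\<close>.\<close>

lemma positive_bump_eqI:
  assumes f: "homeo_plus f" and a: "positive_bump a" and b: "positive_bump b"
    and ag: "agrees_on f a (supt a) \<or> agrees_on f (inv a) (supt a)"
      "agrees_on f b (supt b) \<or> agrees_on f (inv b) (supt b)"
    and eq: "supt a = supt b"
  shows "a = b"
proof
  have h: "homeo_plus a" "homeo_plus b" using a b by (auto simp: positive_bump_def bump_def)
  fix q
  show "a q = b q"
  proof (cases "q \<in> supt a")
    case False
    then show ?thesis using eq h by (auto simp: homeo_plus_supt)
  next
    case True
    have up: "q < a q" "q < b q" using True a b eq by (auto simp: positive_bump_def)
    have "inv a q < q" "inv b q < q"
      using up homeo_plus_less[OF h(1), of "inv a q" q] homeo_plus_less[OF h(2), of "inv b q" q]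
      by (auto simp: homeo_plus_f_inv h)
    moreover have "f q = a q \<or> f q = inv a q" "f q = b q \<or> f q = inv b q"
      using ag True eq by (auto simp: agrees_on_def)
    moreover have "f q = a q \<longleftrightarrow> agrees_on f a (supt a)" "f q = b q \<longleftrightarrow> agrees_on f b (supt b)"
      using ag True eq calculation up by (auto simp: agrees_on_def)
    ultimately consider "agrees_on f a (supt a)" "agrees_on f b (supt b)"
      | "agrees_on f (inv a) (supt a)" "agrees_on f (inv b) (supt b)"
      using up ag by fastforce
    then show ?thesis
    proof cases
      case 1
      then show ?thesis using True eq by (auto simp: agrees_on_def)
    next
      case 2
      then have "agrees_on (inv f) a (supt a)" "agrees_on (inv f) b (supt b)"
        using agrees_on_inv_iff f h by auto
      then show ?thesis using True eq by (auto simp: agrees_on_def)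
    qed
  qed
qed

lemma geom_fast_bumps_subset:
  assumes "geom_fast_bumps B" "A \<subseteq> B" shows "geom_fast_bumps A"
proof -
  obtain m where "good_marking B m" using assms geom_fast_bumps_def by auto
  then have "good_marking A m" using assms(2) unfolding good_marking_def by (meson subsetD)
  moreover have "geom_proper A"
    using assms unfolding geom_fast_bumps_def geom_proper_def by (meson subsetD subset_trans)
  ultimately show ?thesis using assms unfolding geom_fast_bumps_def by (meson subsetD)
qed

section \<open>Piecewise linear bumps\<close>

text \<open>Affine from \<open>[x,t]\<close> to \<open>[x,s]\<close> and from \<open>[t,y]\<close>
  to \<open>[s,y]\<close>, each piece being a scaling about an end of the orbital. Exchanging
  \<open>t\<close> and \<open>s\<close> gives the inverse.\<close>

definition pl_bump :: "real \<Rightarrow> real \<Rightarrow> real \<Rightarrow> real \<Rightarrow> real \<Rightarrow> real" where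
  "pl_bump x t s y q =
     (if q \<le> x \<or> y \<le> q then q
      else if q \<le> t then x + (q - x) * ((s - x) / (t - x))
      else y - (y - q) * ((y - s) / (y - t)))"

lemma pl_bump_left: "x < t \<Longrightarrow> t < y \<Longrightarrow> x \<le> q \<Longrightarrow> q \<le> t \<Longrightarrow> pl_bump x t s y q = x + (q - x) * ((s - x) / (t - x))"
  by (auto simp: pl_bump_def)

lemma pl_bump_right: "x < t \<Longrightarrow> t < y \<Longrightarrow> t \<le> q \<Longrightarrow> q \<le> y \<Longrightarrow> pl_bump x t s y q = y - (y - q) * ((y - s) / (y - t))"
  by (cases "q = t") (auto simp: pl_bump_def)

lemma pl_bump_outside: "q \<le> x \<or> y \<le> q \<Longrightarrow> pl_bump x t s y q = q"
  by (auto simp: pl_bump_def)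

lemma pl_bump_marker: "x < t \<Longrightarrow> t < y \<Longrightarrow> pl_bump x t s y t = s"
  by (simp add: pl_bump_left)

lemma pl_bump_left_range:
  assumes "x < t" "t < y" "x < s" "x < q" "q \<le> t"
  shows "x < pl_bump x t s y q" "pl_bump x t s y q \<le> s"
  using assms mult_right_mono[of "q - x" "t - x" "(s-x)/(t-x)"] by (auto simp: pl_bump_left)

lemma pl_bump_right_range:
  assumes "x < t" "t < y" "s < y" "t \<le> q" "q < y"
  shows "s \<le> pl_bump x t s y q" "pl_bump x t s y q < y"
  using assms mult_right_mono[of "y - q" "y - t" "(y-s)/(y-t)"] by (auto simp: pl_bump_right)

lemma pl_bump_inverse:
  assumes "x < t" "t < y" "x < s" "s < y"
  shows "pl_bump x s t y (pl_bump x t s y q) = q"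
proof -
  consider "q \<le> x \<or> y \<le> q" | "x < q" "q \<le> t" | "t \<le> q" "q < y" by linarith
  then show ?thesis
  proof cases
    case 1
    then show ?thesis by (simp add: pl_bump_outside)
  next
    case 2
    then show ?thesis using assms pl_bump_left_range[of x t y s q]
      by (simp add: pl_bump_left)
  next
    case 3
    then show ?thesis using assms pl_bump_right_range[of x t y s q]
      by (simp add: pl_bump_right)
  qed
qed

lemma pl_bump_strict_mono:
  assumes "x < t" "t < y" "x < s" "s < y"
  shows "strict_mono (pl_bump x t s y)"
proof (rule strict_monoI)
  fix q q' :: real assume "q < q'"
  have L: "pl_bump x t s y u < pl_bump x t s y u'" if "x \<le> u" "u < u'" "u' \<le> t" for u u'
    using assms that mult_strict_right_mono[of "u - x" "u' - x" "(s-x)/(t-x)"]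
    by (simp add: pl_bump_left)
  have R: "pl_bump x t s y u < pl_bump x t s y u'" if "t \<le> u" "u < u'" "u' \<le> y" for u u'
    using assms that mult_strict_right_mono[of "y - u'" "y - u" "(y-s)/(y-t)"]
    by (simp add: pl_bump_right)
  consider "q' \<le> x \<or> y \<le> q" | "q < x" "y < q'" | "q \<le> x" "x < q'" "q' \<le> y" | "x \<le> q" "q < y" "y \<le> q'"
    | "x \<le> q" "q' \<le> y" using \<open>q < q'\<close> by linarith
  then show "pl_bump x t s y q < pl_bump x t s y q'"
  proof cases
    case 1 then show ?thesis using \<open>q < q'\<close> by (auto simp: pl_bump_outside)
  next
    case 2 then show ?thesis using \<open>q < q'\<close> by (auto simp: pl_bump_outside)
  next
    case 3 then show ?thesis
      using assms pl_bump_left_range[of x t y s q'] pl_bump_right_range[of x t y s q'] pl_bump_outside[of q x y]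
        pl_bump_outside[of q' x y] by (cases "q' = y"; cases "q' \<le> t") (force)+
  next
    case 4 then show ?thesis
      using assms pl_bump_left_range[of x t y s q] pl_bump_right_range[of x t y s q] pl_bump_outside[of q x y]
        pl_bump_outside[of q' x y] by (cases "q = x"; cases "q \<le> t") (force)+
  next
    case 5
    then show ?thesis using L[of q q'] R[of q q'] L[of q t] R[of t q'] \<open>q < q'\<close>
      by (cases "q' \<le> t"; cases "t \<le> q") (auto simp: le_less)
  qed
qed

lemma pl_bump_homeo_plus:
  assumes "0 \<le> x" "x < t" "t < y" "x < s" "s < y" "y \<le> 1"
  shows "homeo_plus (pl_bump x t s y)" "inv (pl_bump x t s y) = pl_bump x s t y"
proof -
  have "surj (pl_bump x t s y)"
    using pl_bump_inverse[of x s y t] assms by (metis surjI)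
  moreover have "pl_bump x t s y q = q" if "q \<notin> {0<..<1}" for q
    using that assms by (intro pl_bump_outside) auto
  ultimately show "homeo_plus (pl_bump x t s y)"
    using pl_bump_strict_mono[of x t y s] assms by (simp add: homeo_plus_iff)
  show "inv (pl_bump x t s y) = pl_bump x s t y"
    using pl_bump_inverse[of x s y t] pl_bump_inverse[of x t y s] assms
    by (intro inv_unique_comp) (auto simp: fun_eq_iff)
qed

lemma pl_bump_above:
  assumes "x < t" "t < s" "s < y" "x < q" "q < y"
  shows "q < pl_bump x t s y q"
proof (cases "q \<le> t")
  case True
  have "(q - x) * 1 < (q - x) * ((s - x) / (t - x))"
    using assms by (intro mult_strict_left_mono) auto
  then show ?thesis using True assms by (simp add: pl_bump_left)
next
  case False
  have "(y - q) * ((y - s) / (y - t)) < (y - q) * 1"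
    using assms False by (intro mult_strict_left_mono) auto
  then show ?thesis using False assms by (simp add: pl_bump_right)
qed

lemma pl_bump_affine:
  assumes "x < t" "t < y" "a < b" "{a<..<b} \<inter> {x, t, y} = {}"
  shows "\<exists>m c. \<forall>q\<in>{a..b}. pl_bump x t s y q = m * q + c"
proof -
  have "b \<le> x \<or> y \<le> a \<or> (x \<le> a \<and> b \<le> t) \<or> (t \<le> a \<and> b \<le> y)"
  proof -
    have "\<not> (a < x \<and> x < b)" "\<not> (a < t \<and> t < b)" "\<not> (a < y \<and> y < b)"
      using assms(4) by auto
    then show ?thesis using assms(1-3) by linarith
  qed
  then consider "b \<le> x \<or> y \<le> a" | "x \<le> a" "b \<le> t" | "t \<le> a" "b \<le> y" by blast
  then show ?thesis
  proof cases
    case 1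
    then have "pl_bump x t s y q = 1 * q + 0" if "q \<in> {a..b}" for q
      using that by (auto simp: pl_bump_outside)
    then show ?thesis by blast
  next
    case 2
    then have "pl_bump x t s y q = ((s-x)/(t-x)) * q + (x - x * ((s-x)/(t-x)))" if "q \<in> {a..b}" for q
      using that pl_bump_left[OF assms(1,2), of q s] by (simp del: times_divide_eq_right times_divide_eq_left add: left_diff_distrib mult.commute)
    then show ?thesis by blast
  next
    case 3
    then have "pl_bump x t s y q = ((y-s)/(y-t)) * q + (y - y * ((y-s)/(y-t)))" if "q \<in> {a..b}" for q
      using that pl_bump_right[OF assms(1,2), of q s] by (simp del: times_divide_eq_right times_divide_eq_left add: left_diff_distrib mult.commute)
    then show ?thesis by blast
  qed
qed

lemma homeo_plus_disjoint_sum: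
  assumes "finite F" "\<And>e. e \<in> F \<Longrightarrow> homeo_plus (k e)"
    "\<And>e e'. e \<in> F \<Longrightarrow> e' \<in> F \<Longrightarrow> e \<noteq> e' \<Longrightarrow> supt (k e) \<inter> supt (k e') = {}"
  shows "homeo_plus (\<lambda>q. q + (\<Sum>e\<in>F. k e q - q))"
  using assms
proof (induction F rule: finite_induct)
  case empty
  then show ?case using homeo_plus_id by (simp add: id_def)
next
  case (insert e F)
  have IH: "homeo_plus (\<lambda>q. q + (\<Sum>e\<in>F. k e q - q))" using insert by auto
  have he: "homeo_plus (k e)" using insert by auto
  \<comment> \<open>Applying \<open>k e\<close> first does not disturb the other summands: a point
    moved by \<open>k e\<close> stays in the support of \<open>k e\<close>, where the other maps are
    the identity.\<close>
  have "q + (\<Sum>e\<in>insert e F. k e q - q) = k e q + (\<Sum>e'\<in>F. k e' (k e q) - k e q)" for q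
  proof (cases "k e q = q")
    case False
    then have ks: "q \<in> supt (k e)" "k e q \<in> supt (k e)"
      using homeo_plus_supt[OF he] homeo_plus_eq[OF he] by auto
    have z: "k e' u = u" if "u \<in> supt (k e)" "e' \<in> F" for u e'
    proof -
      have "u \<notin> supt (k e')" using that insert.prems(2)[of e e'] insert.hyps by blast
      then show ?thesis using insert.prems(1)[of e'] that by (auto simp: homeo_plus_supt)
    qed
    have "(\<Sum>e'\<in>F. k e' q - q) = 0" "(\<Sum>e'\<in>F. k e' (k e q) - k e q) = 0"
      using z ks by (auto intro!: sum.neutral)
    then show ?thesis using insert.hyps by simp
  qed (use insert.hyps in simp)
  then have "(\<lambda>q. q + (\<Sum>e\<in>insert e F. k e q - q)) = (\<lambda>q. q + (\<Sum>e\<in>F. k e q - q)) \<circ> k e"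
    by (simp add: fun_eq_iff)
  then show ?case using homeo_plus_comp[OF he IH] by simp
qed

section \<open>Realizations of a diagram\<close>

definition lower_end :: "('v \<Rightarrow> 'v \<Rightarrow> bool) \<Rightarrow> ('v \<Rightarrow> 'v) \<Rightarrow> 'v \<Rightarrow> 'v" where
  "lower_end lt p v = (if lt v (p v) then v else p v)"

definition upper_end :: "('v \<Rightarrow> 'v \<Rightarrow> bool) \<Rightarrow> ('v \<Rightarrow> 'v) \<Rightarrow> 'v \<Rightarrow> 'v" where
  "upper_end lt p v = (if lt v (p v) then p v else v)"

text \<open>\<open>p\<close> leads to the other end of the edge at a vertex. The axiom
  \<open>sep\<close> does not follow from total degree 1: edges with one label must span disjoint
  stretches of the order, because they stand for different orbitals of a single element. Every
  diagram of a geometrically fast set satisfies it.\<close>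

locale diagram_pairing =
  fixes V :: "'v set" and lt :: "'v \<Rightarrow> 'v \<Rightarrow> bool" and p :: "'v \<Rightarrow> 'v"
    and E :: "('v \<times> 'v) set" and lab :: "'v \<times> 'v \<Rightarrow> 'l"
  assumes finV: "finite V" and V_ne: "V \<noteq> {}"
    and lt_irrefl: "v \<in> V \<Longrightarrow> \<not> lt v v"
    and lt_trans: "u \<in> V \<Longrightarrow> v \<in> V \<Longrightarrow> w \<in> V \<Longrightarrow> lt u v \<Longrightarrow> lt v w \<Longrightarrow> lt u w"
    and lt_total: "u \<in> V \<Longrightarrow> v \<in> V \<Longrightarrow> u \<noteq> v \<Longrightarrow> lt u v \<or> lt v u"
    and p_in: "v \<in> V \<Longrightarrow> p v \<in> V"
    and p_p: "v \<in> V \<Longrightarrow> p (p v) = v"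
    and p_ne: "v \<in> V \<Longrightarrow> p v \<noteq> v"
    and E_edge: "e \<in> E \<Longrightarrow> fst e \<in> V \<and> snd e = p (fst e)"
    and E_ex: "v \<in> V \<Longrightarrow> (v, p v) \<in> E \<or> (p v, v) \<in> E"
    and E_asym: "(u, v) \<in> E \<Longrightarrow> (v, u) \<notin> E"
    and sep: "e \<in> E \<Longrightarrow> e' \<in> E \<Longrightarrow> e \<noteq> e' \<Longrightarrow> lab e = lab e' \<Longrightarrow>
      lt (upper_end lt p (fst e)) (lower_end lt p (fst e')) \<or>
      lt (upper_end lt p (fst e')) (lower_end lt p (fst e))"
begin

abbreviation "lo \<equiv> lower_end lt p"
abbreviation "hi \<equiv> upper_end lt p"

lemma lt_p_iff: "v \<in> V \<Longrightarrow> lt (p v) v \<longleftrightarrow> \<not> lt v (p v)"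
  using lt_total[of v "p v"] p_in p_ne lt_trans[of v "p v" v] lt_irrefl by metis

lemma lo_in: "v \<in> V \<Longrightarrow> lo v \<in> V" and hi_in: "v \<in> V \<Longrightarrow> hi v \<in> V"
  and lo_p: "v \<in> V \<Longrightarrow> lo (p v) = lo v" and hi_p: "v \<in> V \<Longrightarrow> hi (p v) = hi v"
  and p_lo: "v \<in> V \<Longrightarrow> p (lo v) = hi v" and lt_lo: "v \<in> V \<Longrightarrow> lt (lo v) (p (lo v))"
  using lt_p_iff p_in p_p by (auto simp: lower_end_def upper_end_def)

lemma finE: "finite E"
proof -
  have "E \<subseteq> V \<times> V" using E_edge p_in by force
  then show ?thesis using finV finite_subset by blast
qed

end

text \<open>The vertex \<open>v\<close> stands for the signed bump \<open>K v\<close> whose source foot runs from \<open>l v\<close> to \<open>r v\<close>;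
  its inverse is \<open>K (p v)\<close>.\<close>

locale fast_realization = diagram_pairing V lt p E lab
  for V :: "'v set" and lt :: "'v \<Rightarrow> 'v \<Rightarrow> bool" and p :: "'v \<Rightarrow> 'v"
    and E :: "('v \<times> 'v) set" and lab :: "'v \<times> 'v \<Rightarrow> 'l" +
  fixes l r :: "'v \<Rightarrow> real" and K :: "'v \<Rightarrow> real \<Rightarrow> real" and g :: "'l \<Rightarrow> real \<Rightarrow> real"
  assumes l_ge: "v \<in> V \<Longrightarrow> 0 \<le> l v" and r_le: "v \<in> V \<Longrightarrow> r v \<le> 1"
    and l_less_r: "v \<in> V \<Longrightarrow> l v < r v"
    and r_le_l: "v \<in> V \<Longrightarrow> w \<in> V \<Longrightarrow> lt v w \<Longrightarrow> r v \<le> l w"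
    and r_less_l: "v \<in> V \<Longrightarrow> lt v (p v) \<Longrightarrow> r v < l (p v)"
    and K_homeo: "v \<in> V \<Longrightarrow> homeo_plus (K v)"
    and K_p: "v \<in> V \<Longrightarrow> K (p v) = inv (K v)"
    and K_r: "v \<in> V \<Longrightarrow> lt v (p v) \<Longrightarrow> K v (r v) = l (p v)"
    and K_out: "v \<in> V \<Longrightarrow> lt v (p v) \<Longrightarrow> q \<le> l v \<or> r (p v) \<le> q \<Longrightarrow> K v q = q"
    and K_up: "v \<in> V \<Longrightarrow> lt v (p v) \<Longrightarrow> l v < q \<Longrightarrow> q < r (p v) \<Longrightarrow> q < K v q"
    and g_homeo: "lb \<in> lab ` E \<Longrightarrow> homeo_plus (g lb)"
    and g_orb: "e \<in> E \<Longrightarrow> l (lower_end lt p (fst e)) < q \<Longrightarrow> q < r (upper_end lt p (fst e)) \<Longrightarrow>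
      g (lab e) q = K (fst e) q"
    and g_fix: "lb \<in> lab ` E \<Longrightarrow> (\<And>e. e \<in> E \<Longrightarrow> lab e = lb \<Longrightarrow>
      q \<notin> {l (lower_end lt p (fst e))<..<r (upper_end lt p (fst e))}) \<Longrightarrow> g lb q = q"
begin

definition orb :: "'v \<Rightarrow> real set" where
  "orb v = {l (lo v)<..<r (hi v)}"

lemma orb_p: "v \<in> V \<Longrightarrow> orb (p v) = orb v"
  by (simp add: orb_def lo_p hi_p)

lemma orb_lo: "v \<in> V \<Longrightarrow> lt v (p v) \<Longrightarrow> orb v = {l v<..<r (p v)}"
  by (simp add: orb_def lower_end_def upper_end_def)

lemma l_less_r_p: "v \<in> V \<Longrightarrow> lt v (p v) \<Longrightarrow> l v < r (p v)"
  using l_less_r[of v] r_less_l[of v] l_less_r[of "p v"] p_in[of v] by simp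

lemma K_p_K: "v \<in> V \<Longrightarrow> K (p v) (K v q) = q"
  using K_p homeo_plus_inv_f[OF K_homeo] by simp

lemma K_K_p: "v \<in> V \<Longrightarrow> K v (K (p v) q) = q"
  using K_p homeo_plus_f_inv[OF K_homeo] by simp

lemma K_neq_iff: "v \<in> V \<Longrightarrow> K v q \<noteq> q \<longleftrightarrow> q \<in> orb v"
proof -
  have lo: "K v q \<noteq> q \<longleftrightarrow> q \<in> orb v" if v: "v \<in> V" "lt v (p v)" for v q
    using K_out[OF v, of q] K_up[OF v, of q] orb_lo[OF v] by force
  assume v: "v \<in> V"
  show ?thesis
  proof (cases "lt v (p v)")
    case False
    then have "K (p v) q \<noteq> q \<longleftrightarrow> q \<in> orb v"
      using lo[of "p v" q] v p_in orb_p lt_p_iff p_p by simp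
    then show ?thesis using K_p_K[OF v] K_K_p[OF v] by metis
  qed (use lo v in auto)
qed

lemma supt_K: "v \<in> V \<Longrightarrow> supt (K v) = orb v"
  using K_neq_iff K_homeo by (auto simp: homeo_plus_supt)

lemma K_orb_iff: "v \<in> V \<Longrightarrow> K v q \<in> orb v \<longleftrightarrow> q \<in> orb v"
  using K_neq_iff[of v] homeo_plus_eq[OF K_homeo, of v] by metis

lemma K_l: "v \<in> V \<Longrightarrow> lt v (p v) \<Longrightarrow> K v (l v) = l v"
  and K_r_p: "v \<in> V \<Longrightarrow> lt v (p v) \<Longrightarrow> K v (r (p v)) = r (p v)"
  using K_out by auto

lemma K_hi:
  assumes "v \<in> V" "\<not> lt v (p v)"
  shows "K v (l (p v)) = l (p v)" "K v (l v) = r (p v)" "K v (r v) = r v"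
proof -
  have pv: "p v \<in> V" "lt (p v) (p (p v))" using assms p_in lt_p_iff p_p by auto
  show "K v (l (p v)) = l (p v)" "K v (l v) = r (p v)" "K v (r v) = r v"
    using K_l[OF pv] K_r[OF pv] K_r_p[OF pv] K_K_p[OF assms(1)] p_p[OF assms(1)] by metis+
qed

lemma orbs_disjoint:
  assumes "e \<in> E" "e' \<in> E" "e \<noteq> e'" "lab e = lab e'"
  shows "orb (fst e) \<inter> orb (fst e') = {}"
proof -
  have V: "fst e \<in> V" "fst e' \<in> V" using assms E_edge by auto
  have "r (hi (fst e)) \<le> l (lo (fst e')) \<or> r (hi (fst e')) \<le> l (lo (fst e))"
    using sep[OF assms] r_le_l V lo_in hi_in by blast
  then show ?thesis by (auto simp: orb_def)
qed

lemma g_on_orb: "e \<in> E \<Longrightarrow> q \<in> orb (fst e) \<Longrightarrow> g (lab e) q = K (fst e) q"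
  using g_orb by (simp add: orb_def)

lemma g_off_orb:
  "lb \<in> lab ` E \<Longrightarrow> (\<And>e. e \<in> E \<Longrightarrow> lab e = lb \<Longrightarrow> q \<notin> orb (fst e)) \<Longrightarrow> g lb q = q"
  using g_fix by (simp add: orb_def)

lemma inv_g_on_orb:
  assumes "e \<in> E" "q \<in> orb (fst e)"
  shows "inv (g (lab e)) q = K (snd e) q"
proof -
  have V: "fst e \<in> V" "snd e = p (fst e)" "p (fst e) \<in> V" using assms E_edge p_in by auto
  have "K (snd e) q \<in> orb (fst e)" using assms V K_orb_iff[of "p (fst e)" q] orb_p by simp
  then have "g (lab e) (K (snd e) q) = q" using g_on_orb[OF assms(1)] K_K_p V by simp
  then show ?thesis using homeo_plus_inv_f[OF g_homeo] assms(1) by (metis imageI)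
qed

lemma inv_g_off_orb:
  assumes "lb \<in> lab ` E" "\<And>e. e \<in> E \<Longrightarrow> lab e = lb \<Longrightarrow> q \<notin> orb (fst e)"
  shows "inv (g lb) q = q"
  using g_off_orb[OF assms] homeo_plus_inv_f[OF g_homeo[OF assms(1)]] by metis

lemma supt_g: "lb \<in> lab ` E \<Longrightarrow> supt (g lb) = (\<Union>e\<in>{e\<in>E. lab e = lb}. orb (fst e))"
proof -
  assume lb: "lb \<in> lab ` E"
  have "g lb q \<noteq> q \<longleftrightarrow> (\<exists>e\<in>E. lab e = lb \<and> q \<in> orb (fst e))" for q
    using g_off_orb[OF lb, of q] g_on_orb[of _ q] K_neq_iff[of _ q] E_edge by metis
  then show ?thesis using homeo_plus_supt[OF g_homeo[OF lb]] by auto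
qed

lemma g_neq_id: "lb \<in> lab ` E \<Longrightarrow> g lb \<noteq> id"
proof -
  assume lb: "lb \<in> lab ` E"
  then obtain e where e: "e \<in> E" "lab e = lb" by auto
  have V: "lo (fst e) \<in> V" "lt (lo (fst e)) (p (lo (fst e)))" "p (lo (fst e)) = hi (fst e)"
    using e E_edge lo_in lt_lo p_lo by auto
  then have "(l (lo (fst e)) + r (hi (fst e))) / 2 \<in> orb (fst e)"
    using l_less_r_p[OF V(1,2)] by (simp add: orb_def)
  then have "supt (g lb) \<noteq> {}" using supt_g[OF lb] e by blast
  then show ?thesis using supt_empty_iff[OF g_homeo[OF lb]] by auto
qed

end

section \<open>The piecewise linear model\<close>

context diagram_pairing
begin

definition gaps :: "'v set" where
  "gaps = {v \<in> V. lt v (p v) \<and> (\<forall>w\<in>V. \<not> (lt v w \<and> lt w (p v)))}"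

definition N :: real where "N = real (card V + card gaps)"

text \<open>The feet of the model have length \<open>1 / N\<close> and are packed into the unit interval without gaps,
  except that the two feet of a bump which are adjacent in the order are separated by \<open>1 / N\<close>:
  there the bump would otherwise fix its marker.\<close>

definition L :: "'v \<Rightarrow> real" where
  "L v = (real (card {u\<in>V. lt u v}) + real (card {u\<in>gaps. lt u v})) / N"

definition R :: "'v \<Rightarrow> real" where "R v = L v + 1 / N"

text \<open>For a lower vertex \<open>v\<close> the marker is \<open>R v\<close> and its image
  \<open>L (p v)\<close>, so the feet of the bump are exactly the cells of \<open>v\<close> and
  \<open>p v\<close>. The second branch has the two break points exchanged and is therefore the
  inverse of the bump at \<open>p v\<close>.\<close>

definition Kp :: "'v \<Rightarrow> real \<Rightarrow> real" where
  "Kp v = (if lt v (p v) then pl_bump (L v) (R v) (L (p v)) (R (p v))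
           else pl_bump (L (p v)) (L v) (R (p v)) (R v))"

text \<open>The orbitals of one label are disjoint, so this is the product of its signed bumps;
  adding displacements avoids choosing an order of the edges and makes linearity on common pieces
  immediate.\<close>

definition gp :: "'l \<Rightarrow> real \<Rightarrow> real" where
  "gp lb q = q + (\<Sum>e | e \<in> E \<and> lab e = lb. Kp (fst e) q - q)"

lemma gaps_sub: "gaps \<subseteq> V" "finite gaps"
  using finV by (auto simp: gaps_def)

lemma N_pos: "N > 0"
proof -
  have "card V > 0" using finV V_ne by (simp add: card_gt_0_iff)
  then show ?thesis by (simp add: N_def)
qed

lemma L_nonneg: "0 \<le> L v"
  using N_pos by (simp add: L_def)

lemma L_less_R: "L v < R v"
  using N_pos by (simp add: R_def)

lemma card_below_Suc:
  assumes "v \<in> V" "w \<in> V" "lt v w" "A \<subseteq> V"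
  shows "card {u\<in>A. lt u v} \<le> card {u\<in>A. lt u w}"
    and "v \<in> A \<Longrightarrow> card {u\<in>A. lt u v} + 1 \<le> card {u\<in>A. lt u w}"
proof -
  have "finite A" using assms(4) finV by (rule finite_subset)
  then have fin: "finite {u\<in>A. lt u w}" by simp
  have sub: "{u\<in>A. lt u v} \<subseteq> {u\<in>A. lt u w}" using assms lt_trans by blast
  show "card {u\<in>A. lt u v} \<le> card {u\<in>A. lt u w}" using fin sub by (rule card_mono)
  assume "v \<in> A"
  then have "{u\<in>A. lt u v} \<subset> {u\<in>A. lt u w}" using sub assms lt_irrefl by blast
  then show "card {u\<in>A. lt u v} + 1 \<le> card {u\<in>A. lt u w}"
    using psubset_card_mono[OF fin, of "{u\<in>A. lt u v}"] by linarith
qed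

lemma R_le_L:
  assumes "v \<in> V" "w \<in> V" "lt v w"
  shows "R v \<le> L w"
proof -
  have "real (card {u\<in>V. lt u v}) + real (card {u\<in>gaps. lt u v}) + 1
      \<le> real (card {u\<in>V. lt u w}) + real (card {u\<in>gaps. lt u w})"
    using card_below_Suc(2)[OF assms, of V] card_below_Suc(1)[OF assms gaps_sub(1)] assms by simp
  then show ?thesis
    unfolding R_def L_def using N_pos by (simp add: divide_simps)
qed

text \<open>Between the feet of a bump lies either its own gap, counted in \<open>L (p v)\<close>
  but not in \<open>L v\<close>, or the cell of another vertex. Together with the source foot this
  gives a stretch of length at least \<open>2 / N\<close>, which \<open>Kp_contract\<close>
  needs.\<close>

lemma R_gap_le_L:
  assumes "v \<in> V" "lt v (p v)"
  shows "R v + 1 / N \<le> L (p v)"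
proof (cases "v \<in> gaps")
  case True
  have "real (card {u\<in>V. lt u v}) + real (card {u\<in>gaps. lt u v}) + 2
      \<le> real (card {u\<in>V. lt u (p v)}) + real (card {u\<in>gaps. lt u (p v)})"
    using card_below_Suc(2)[OF assms(1) p_in assms(2), of V]
      card_below_Suc(2)[OF assms(1) p_in assms(2) gaps_sub(1)] assms True by simp
  then show ?thesis
    unfolding R_def L_def using N_pos by (simp add: divide_simps)
next
  case False
  then obtain w where "w \<in> V" "lt v w" "lt w (p v)" using assms by (auto simp: gaps_def)
  then have "R v \<le> L w" "R w \<le> L (p v)" using R_le_L assms p_in by auto
  then show ?thesis by (simp add: R_def)
qed

lemma R_le_1:
  assumes "v \<in> V" shows "R v \<le> 1"
proof -
  have "{u\<in>V. lt u v} \<subset> V" using assms lt_irrefl by blast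
  then have "card {u\<in>V. lt u v} + 1 \<le> card V" 
    using psubset_card_mono[OF finV, of "{u\<in>V. lt u v}"] by linarith
  moreover have "card {u\<in>gaps. lt u v} \<le> card gaps" using gaps_sub by (intro card_mono) auto
  ultimately have "real (card {u\<in>V. lt u v}) + real (card {u\<in>gaps. lt u v}) + 1 \<le> N"
    unfolding N_def by simp
  then show ?thesis
    unfolding R_def L_def using N_pos by (simp add: divide_simps)
qed

lemma L_inj: "v \<in> V \<Longrightarrow> w \<in> V \<Longrightarrow> L v = L w \<longleftrightarrow> v = w"
  and R_inj: "v \<in> V \<Longrightarrow> w \<in> V \<Longrightarrow> R v = R w \<longleftrightarrow> v = w"
  using lt_total[of v w] R_le_L[of v w] R_le_L[of w v] L_less_R[of v] L_less_R[of w]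
  by (fastforce simp: R_def)+

lemma feet_order:
  assumes "v \<in> V" "lt v (p v)"
  shows "0 \<le> L v" "L v < R v" "R v < L (p v)" "L (p v) < R (p v)" "R (p v) \<le> 1"
    "L v < L (p v)" "R v < R (p v)"
proof -
  have "1 / N > 0" using N_pos by simp
  then show "0 \<le> L v" "L v < R v" "R v < L (p v)" "L (p v) < R (p v)" "R (p v) \<le> 1"
    "L v < L (p v)" "R v < R (p v)"
    using R_gap_le_L[OF assms] L_nonneg[of v] L_less_R[of v] L_less_R[of "p v"]
      R_le_1[OF p_in[OF assms(1)]] by linarith+
qed

lemma Kp_lo: "lt v (p v) \<Longrightarrow> Kp v = pl_bump (L v) (R v) (L (p v)) (R (p v))"
  and Kp_hi: "\<not> lt v (p v) \<Longrightarrow> Kp v = pl_bump (L (p v)) (L v) (R (p v)) (R v)"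
  by (auto simp: Kp_def)

lemma hi_order:
  assumes "v \<in> V" "\<not> lt v (p v)"
  shows "p v \<in> V" "lt (p v) (p (p v))"
  using assms p_in lt_p_iff p_p by auto

lemma Kp_homeo_inv:
  assumes "v \<in> V"
  shows "homeo_plus (Kp v)" "Kp (p v) = inv (Kp v)"
proof -
  have lo: "homeo_plus (Kp v) \<and> Kp (p v) = inv (Kp v)" if v: "v \<in> V" "lt v (p v)" for v
  proof -
    have "\<not> lt (p v) (p (p v))" using v p_p lt_p_iff by auto
    then have "Kp (p v) = pl_bump (L v) (L (p v)) (R v) (R (p v))"
      using Kp_hi[of "p v"] p_p[OF v(1)] by simp
    then show ?thesis
      using feet_order[OF v] pl_bump_homeo_plus[of "L v" "R v" "R (p v)" "L (p v)"] Kp_lo[OF v(2)] by simp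
  qed
  show "homeo_plus (Kp v)" "Kp (p v) = inv (Kp v)"
  proof (atomize(full), cases "lt v (p v)")
    case False
    then have *: "homeo_plus (Kp (p v))" "Kp v = inv (Kp (p v))"
      using lo[OF hi_order[OF assms]] p_p[OF assms] by auto
    then show "homeo_plus (Kp v) \<and> Kp (p v) = inv (Kp v)"
      using homeo_plus_inv homeo_plus_inv_inv by metis
  qed (use lo assms in auto)
qed

lemma Kp_out: "v \<in> V \<Longrightarrow> q \<le> L (lo v) \<or> R (hi v) \<le> q \<Longrightarrow> Kp v q = q"
  by (auto simp: Kp_def lower_end_def upper_end_def pl_bump_outside split: if_splits)

lemma Kp_supt:
  assumes "v \<in> V" shows "supt (Kp v) \<subseteq> {L (lo v)<..<R (hi v)}"
  using Kp_out[OF assms] homeo_plus_supt[OF Kp_homeo_inv(1)[OF assms]] by force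

lemma model_orbs_disjoint:
  assumes "e \<in> E" "e' \<in> E" "e \<noteq> e'" "lab e = lab e'" "q \<in> {L (lo (fst e))<..<R (hi (fst e))}"
  shows "q \<notin> {L (lo (fst e'))<..<R (hi (fst e'))}"
proof -
  have "R (hi (fst e)) \<le> L (lo (fst e')) \<or> R (hi (fst e')) \<le> L (lo (fst e))"
    using sep[OF assms(1-4)] R_le_L lo_in hi_in E_edge assms(1,2) by metis
  then show ?thesis using assms(5) by auto
qed

text \<open>The model realizes the same diagram, so the facts about orbitals and supports proved
  once in \<open>fast_realization\<close> serve both the given set and, under the prefix
  \<open>model\<close>, its target.\<close>

sublocale model: fast_realization V lt p E lab L R Kp gp
proof
  show "0 \<le> L v" "L v < R v" for v by (rule L_nonneg L_less_R)+
  show "R v \<le> 1" if "v \<in> V" for v using that by (rule R_le_1)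
  show "R v \<le> L w" if "v \<in> V" "w \<in> V" "lt v w" for v w using that by (rule R_le_L)
  show "R v < L (p v)" if "v \<in> V" "lt v (p v)" for v using feet_order[OF that] by simp
  show "homeo_plus (Kp v)" "Kp (p v) = inv (Kp v)" if "v \<in> V" for v using Kp_homeo_inv that by auto
  show "Kp v (R v) = L (p v)" if "v \<in> V" "lt v (p v)" for v
    using feet_order[OF that] that by (simp add: Kp_lo pl_bump_marker)
  show "Kp v q = q" if "v \<in> V" "lt v (p v)" "q \<le> L v \<or> R (p v) \<le> q" for v q
    using that by (simp add: Kp_lo pl_bump_outside)
  show "q < Kp v q" if "v \<in> V" "lt v (p v)" "L v < q" "q < R (p v)" for v q
    using that feet_order[OF that(1,2)] by (simp add: Kp_lo pl_bump_above)
next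
  fix lb
  let ?F = "{e. e \<in> E \<and> lab e = lb}"
  have "homeo_plus (\<lambda>q. q + (\<Sum>e\<in>?F. Kp (fst e) q - q))"
  proof (rule homeo_plus_disjoint_sum)
    show "finite ?F" using finE by simp
    show "homeo_plus (Kp (fst e))" if "e \<in> ?F" for e using that E_edge Kp_homeo_inv by auto
    show "supt (Kp (fst e)) \<inter> supt (Kp (fst e')) = {}" if "e \<in> ?F" "e' \<in> ?F" "e \<noteq> e'" for e e'
    proof -
      have "fst e \<in> V" "fst e' \<in> V" using that E_edge by auto
      moreover have "q \<notin> {L (lo (fst e'))<..<R (hi (fst e'))}"
        if "q \<in> {L (lo (fst e))<..<R (hi (fst e))}" for q
        using \<open>e \<in> ?F\<close> \<open>e' \<in> ?F\<close> \<open>e \<noteq> e'\<close> that by (intro model_orbs_disjoint[of e e' q]) auto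
      ultimately show ?thesis
        using Kp_supt[of "fst e"] Kp_supt[of "fst e'"] by blast
    qed
  qed
  then show "homeo_plus (gp lb)" by (simp add: gp_def[abs_def])
next
  fix e q assume e: "e \<in> E" "L (lo (fst e)) < q" "q < R (hi (fst e))"
  let ?F = "{e'. e' \<in> E \<and> lab e' = lab e}"
  have "Kp (fst e') q - q = 0" if "e' \<in> ?F - {e}" for e'
  proof -
    have "q \<notin> {L (lo (fst e'))<..<R (hi (fst e'))}"
      using that e by (intro model_orbs_disjoint[of e e' q]) auto
    then show ?thesis using Kp_out[of "fst e'" q] that E_edge by auto
  qed
  then have "(\<Sum>e'\<in>?F. Kp (fst e') q - q) = Kp (fst e) q - q"
    using finE e by (subst sum.remove[of _ e]) (auto intro!: sum.neutral)
  then show "gp (lab e) q = Kp (fst e) q" by (simp add: gp_def)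
next
  fix lb q assume *: "\<And>e. e \<in> E \<Longrightarrow> lab e = lb \<Longrightarrow> q \<notin> {L (lo (fst e))<..<R (hi (fst e))}"
  have "Kp (fst e) q - q = 0" if "e \<in> E" "lab e = lb" for e
    using *[OF that] Kp_out[of "fst e" q] E_edge[OF that(1)] by auto
  then show "gp lb q = q" by (auto simp: gp_def intro!: sum.neutral)
qed

lemma gp_piecewise_linear: "piecewise_linear (gp lb)"
  unfolding piecewise_linear_def
proof (rule exI[of _ "{0, 1} \<union> L ` V \<union> R ` V"], intro conjI ballI impI)
  let ?S = "{0, 1} \<union> L ` V \<union> R ` V"
  show "finite ?S" using finV by simp
  show "?S \<subseteq> {0..1}"
  proof -
    have "L v \<in> {0..1}" "R v \<in> {0..1}" if "v \<in> V" for v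
      using L_nonneg[of v] R_le_1[OF that] L_less_R[of v] by auto
    then show ?thesis by auto
  qed
  show "0 \<in> ?S" "1 \<in> ?S" by auto
  fix a b assume ab: "a \<in> ?S" "b \<in> ?S" "a < b \<and> {a<..<b} \<inter> ?S = {}"
  have "\<exists>m c. \<forall>t\<in>{a..b}. Kp v t = m * t + c" if v: "v \<in> V" for v
  proof (cases "lt v (p v)")
    case True
    have "{a<..<b} \<inter> {L v, R v, R (p v)} = {}" using ab v p_in[OF v] by blast
    then show ?thesis using ab feet_order[OF v True]
      unfolding Kp_lo[OF True] by (intro pl_bump_affine) simp_all
  next
    case False
    have "{a<..<b} \<inter> {L (p v), L v, R v} = {}" using ab v p_in[OF v] by blast
    then show ?thesis using ab feet_order[OF hi_order[OF v False]] p_p[OF v]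
      unfolding Kp_hi[OF False] by (intro pl_bump_affine) simp_all
  qed
  then have "\<forall>e\<in>E. \<exists>m c. \<forall>t\<in>{a..b}. Kp (fst e) t = m * t + c" using E_edge by blast
  then obtain m c where mc: "\<And>e t. e \<in> E \<Longrightarrow> t \<in> {a..b} \<Longrightarrow> Kp (fst e) t = m e * t + c e"
    by metis
  have "gp lb t = (1 + (\<Sum>e | e \<in> E \<and> lab e = lb. m e - 1)) * t + (\<Sum>e | e \<in> E \<and> lab e = lb. c e)"
    if "t \<in> {a..b}" for t
  proof -
    have "(\<Sum>e | e \<in> E \<and> lab e = lb. Kp (fst e) t - t) = (\<Sum>e | e \<in> E \<and> lab e = lb. (m e - 1) * t + c e)"
      using mc that by (intro sum.cong) (auto simp: algebra_simps)
    then show ?thesis by (simp add: gp_def sum.distrib sum_distrib_right distrib_right)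
  qed
  then show "\<exists>m c. \<forall>t\<in>{a..b}. gp lb t = m * t + c" by blast
qed

end

section \<open>The model set is geometrically fast\<close>

context diagram_pairing
begin

definition model_bumps :: "(real \<Rightarrow> real) set" where
  "model_bumps = Kp ` {v \<in> V. lt v (p v)}"

lemma supt_Kp_lo: "v \<in> V \<Longrightarrow> lt v (p v) \<Longrightarrow> supt (Kp v) = {L v<..<R (p v)}"
  using model.supt_K model.orb_lo by simp

lemma positive_bump_Kp:
  assumes "v \<in> V" "lt v (p v)"
  shows "positive_bump (Kp v)"
proof -
  have "bump (Kp v)"
    using bump_of_interval[OF model.K_homeo[OF assms(1)] supt_Kp_lo[OF assms]] model.l_less_r_p[OF assms] .
  then show ?thesis
    unfolding positive_bump_def supt_Kp_lo[OF assms] using model.K_up[OF assms] by auto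
qed

lemma Inf_supt_Kp: "v \<in> V \<Longrightarrow> lt v (p v) \<Longrightarrow> Inf (supt (Kp v)) = L v"
  and Sup_supt_Kp: "v \<in> V \<Longrightarrow> lt v (p v) \<Longrightarrow> Sup (supt (Kp v)) = R (p v)"
  using supt_Kp_lo model.l_less_r_p by auto

lemma Kp_inj:
  assumes "v \<in> V" "lt v (p v)" "w \<in> V" "lt w (p w)" "Kp v = Kp w"
  shows "v = w"
proof -
  have "L v = L w" using Inf_supt_Kp assms by metis
  then show ?thesis using L_inj assms by blast
qed

lemma left_tp_Kp: "v \<in> V \<Longrightarrow> lt v (p v) \<Longrightarrow> left_tp (Kp v) t \<Longrightarrow> t = L v"
  using left_tp_supt_Union[of "{v}" "Kp v" L "\<lambda>v. R (p v)" t] supt_Kp_lo by simp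

lemma right_tp_Kp: "v \<in> V \<Longrightarrow> lt v (p v) \<Longrightarrow> right_tp (Kp v) t \<Longrightarrow> t = R (p v)"
  using right_tp_supt_Union[of "{v}" "Kp v" L "\<lambda>v. R (p v)" t] supt_Kp_lo by simp

lemma p_inj: "v \<in> V \<Longrightarrow> w \<in> V \<Longrightarrow> p v = p w \<Longrightarrow> v = w"
  using p_p by metis

lemma model_feet_disjoint:
  assumes "v \<in> V" "w \<in> V" "v \<noteq> w" shows "{L v..<R v} \<inter> {L w..<R w} = {}"
  using lt_total[OF assms] R_le_L[of v w] R_le_L[of w v] assms by auto

lemma model_bumps_fast: "geom_fast_bumps model_bumps"
  unfolding geom_fast_bumps_def
proof (intro conjI ballI)
  show "positive_bump a" if "a \<in> model_bumps" for a
    using that positive_bump_Kp by (auto simp: model_bumps_def)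
  show "geom_proper model_bumps"
    unfolding geom_proper_def
  proof (intro conjI ballI allI impI notI)
    show "model_bumps \<subseteq> {f. homeo_plus f}" using model.K_homeo by (auto simp: model_bumps_def)
  next
    fix f h t assume *: "f \<in> model_bumps" "h \<in> model_bumps" "f \<noteq> h" "left_tp f t \<and> left_tp h t"
    then obtain v w where "v \<in> V" "lt v (p v)" "f = Kp v" "w \<in> V" "lt w (p w)" "h = Kp w"
      by (auto simp: model_bumps_def)
    then show False using * left_tp_Kp[of v t] left_tp_Kp[of w t] L_inj by metis
  next
    fix f h t assume *: "f \<in> model_bumps" "h \<in> model_bumps" "f \<noteq> h" "right_tp f t \<and> right_tp h t"
    then obtain v w where "v \<in> V" "lt v (p v)" "f = Kp v" "w \<in> V" "lt w (p w)" "h = Kp w"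
      by (auto simp: model_bumps_def)
    then show False using * right_tp_Kp[of v t] right_tp_Kp[of w t] R_inj[of "p v" "p w"] p_in p_inj by metis
  qed
  \<comment> \<open>A marking takes bumps as arguments, not vertices; the vertex is recovered from
    the bump because the left end of its support determines it.\<close>
  define m where "m a = R (SOME v. v \<in> V \<and> lt v (p v) \<and> Kp v = a)" for a
  have m: "m (Kp v) = R v" if v: "v \<in> V" "lt v (p v)" for v
  proof -
    have "(SOME w. w \<in> V \<and> lt w (p w) \<and> Kp w = Kp v) = v"
      by (rule some_equality) (use v Kp_inj in auto)
    then show ?thesis by (simp add: m_def)
  qed
  have feet: "src_foot (Kp v) (m (Kp v)) = {L v<..<R v}" "dest_foot (Kp v) (m (Kp v)) = {L (p v)..<R (p v)}"
    if v: "v \<in> V" "lt v (p v)" for v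
    using v m model.K_r[OF v] Inf_supt_Kp[OF v] Sup_supt_Kp[OF v] by (auto simp: src_foot_def dest_foot_def)
  have "good_marking model_bumps m"
    unfolding good_marking_def
  proof (intro conjI ballI impI)
    fix a assume "a \<in> model_bumps"
    then obtain v where v: "v \<in> V" "lt v (p v)" and a: "a = Kp v" by (auto simp: model_bumps_def)
    show "m a \<in> supt a" using a m[OF v] supt_Kp_lo[OF v] feet_order[OF v] by simp
    show "src_foot a (m a) \<inter> dest_foot a (m a) = {}"
      using a feet[OF v] feet_order[OF v] by auto
    fix b assume "b \<in> model_bumps" "a \<noteq> b"
    then obtain w where w: "w \<in> V" "lt w (p w)" and b: "b = Kp w" by (auto simp: model_bumps_def)
    have "v \<noteq> w" "p v \<noteq> p w" using \<open>a \<noteq> b\<close> a b p_inj v w by auto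
    moreover have "v \<noteq> p w" "p v \<noteq> w" using v w p_p lt_p_iff by metis+
    ultimately have "{L v..<R v} \<inter> {L w..<R w} = {}" "{L v..<R v} \<inter> {L (p w)..<R (p w)} = {}"
      "{L (p v)..<R (p v)} \<inter> {L w..<R w} = {}" "{L (p v)..<R (p v)} \<inter> {L (p w)..<R (p w)} = {}"
      using v w p_in model_feet_disjoint by blast+
    moreover have "src_foot a (m a) \<subseteq> {L v..<R v}" "src_foot b (m b) \<subseteq> {L w..<R w}"
      using feet[OF v] feet[OF w] a b by auto
    ultimately show "(src_foot a (m a) \<union> dest_foot a (m a)) \<inter> (src_foot b (m b) \<union> dest_foot b (m b)) = {}"
      unfolding a b feet(2)[OF v] feet(2)[OF w] by blast
  qed
  then show "\<exists>m. good_marking model_bumps m" by blast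
qed

definition XD :: "(real \<Rightarrow> real) set" where "XD = gp ` lab ` E"

lemma XD_PL: "XD \<subseteq> {f. PL_plus f}"
  using model.g_homeo gp_piecewise_linear by (auto simp: XD_def PL_plus_def)

text \<open>A common lower end forces the same pair of vertices, and \<open>E_asym\<close> excludes
  that the pair is joined in both directions. So distinct edges of the model give distinct left
  transition points.\<close>

lemma edges_same_lo:
  assumes "e \<in> E" "e' \<in> E" "lo (fst e) = lo (fst e')" shows "e = e'"
proof -
  have V: "fst e \<in> V" "fst e' \<in> V" "snd e = p (fst e)" "snd e' = p (fst e')" using assms E_edge by auto
  have "fst e = fst e' \<or> fst e = p (fst e')"
    using assms(3) p_p[OF V(1)] p_p[OF V(2)] unfolding lower_end_def by metis
  moreover have "fst e \<noteq> p (fst e')"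
  proof
    assume "fst e = p (fst e')"
    then have "e = (p (fst e'), fst e')" using V p_p by (metis prod.collapse)
    moreover have "e' = (fst e', p (fst e'))" using V by (metis prod.collapse)
    ultimately show False using E_asym assms by metis
  qed
  ultimately show ?thesis using V by (metis prod.collapse)
qed

lemma edges_same_hi:
  assumes "e \<in> E" "e' \<in> E" "hi (fst e) = hi (fst e')" shows "e = e'"
  using assms edges_same_lo[of e e'] p_lo E_edge lo_in p_inj by metis

lemma left_tp_gp:
  assumes "lb \<in> lab ` E" "left_tp (gp lb) t"
  shows "\<exists>e\<in>E. lab e = lb \<and> t = L (lo (fst e))"
  using left_tp_supt_Union[of "{e\<in>E. lab e = lb}" "gp lb" "\<lambda>e. L (lo (fst e))" "\<lambda>e. R (hi (fst e))" t]
    finE model.supt_g[OF assms(1)] assms(2) by (auto simp: model.orb_def)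

lemma right_tp_gp:
  assumes "lb \<in> lab ` E" "right_tp (gp lb) t"
  shows "\<exists>e\<in>E. lab e = lb \<and> t = R (hi (fst e))"
  using right_tp_supt_Union[of "{e\<in>E. lab e = lb}" "gp lb" "\<lambda>e. L (lo (fst e))" "\<lambda>e. R (hi (fst e))" t]
    finE model.supt_g[OF assms(1)] assms(2) by (auto simp: model.orb_def)

lemma XD_proper: "geom_proper XD"
  unfolding geom_proper_def
proof (intro conjI ballI allI impI notI)
  show "XD \<subseteq> {f. homeo_plus f}" using model.g_homeo by (auto simp: XD_def)
next
  fix f h t assume *: "f \<in> XD" "h \<in> XD" "f \<noteq> h" "left_tp f t \<and> left_tp h t"
  then obtain lb lb' where lb: "lb \<in> lab ` E" "f = gp lb" "lb' \<in> lab ` E" "h = gp lb'"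
    unfolding XD_def by blast
  then obtain e e' where e: "e \<in> E" "lab e = lb" "t = L (lo (fst e))" "e' \<in> E" "lab e' = lb'" "t = L (lo (fst e'))"
    using left_tp_gp * by metis
  then have "lo (fst e) = lo (fst e')" using L_inj lo_in E_edge by metis
  then show False using edges_same_lo e lb * by metis
next
  fix f h t assume *: "f \<in> XD" "h \<in> XD" "f \<noteq> h" "right_tp f t \<and> right_tp h t"
  then obtain lb lb' where lb: "lb \<in> lab ` E" "f = gp lb" "lb' \<in> lab ` E" "h = gp lb'"
    unfolding XD_def by blast
  then obtain e e' where e: "e \<in> E" "lab e = lb" "t = R (hi (fst e))" "e' \<in> E" "lab e' = lb'" "t = R (hi (fst e'))"
    using right_tp_gp * by metis
  then have "hi (fst e) = hi (fst e')" using R_inj hi_in E_edge by metis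
  then show False using edges_same_hi e lb * by metis
qed

lemma gp_agrees_Kp:
  assumes "e \<in> E"
  defines "v \<equiv> lo (fst e)"
  shows "agrees_on (gp (lab e)) (Kp v) (supt (Kp v)) \<or> agrees_on (gp (lab e)) (inv (Kp v)) (supt (Kp v))"
proof -
  have V: "fst e \<in> V" using assms E_edge by auto
  have v: "v \<in> V" "lt v (p v)" unfolding v_def using V lo_in lt_lo by auto
  have "model.orb v = model.orb (fst e)" 
    using model.orb_lo[OF v] p_lo[OF V] by (simp add: model.orb_def v_def)
  then have *: "gp (lab e) q = Kp (fst e) q" if "q \<in> supt (Kp v)" for q
    using that model.supt_K[OF v(1)] model.g_on_orb[OF assms(1)] by simp
  show ?thesis
  proof (cases "lt (fst e) (p (fst e))")
    case True
    then have "v = fst e" by (simp add: v_def lower_end_def)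
    then show ?thesis using * by (simp add: agrees_on_def)
  next
    case False
    then have "v = p (fst e)" by (simp add: v_def lower_end_def)
    then have "fst e = p v" using p_p[OF V] by simp
    then show ?thesis using * model.K_p[OF v(1)] by (simp add: agrees_on_def)
  qed
qed

text \<open>A used bump meets some orbital of the model; both are orbitals of the same element, so
  the supports coincide, and a positive bump is determined by that element on its support. Fastness
  then passes from \<open>model_bumps\<close> to the subset.\<close>

lemma used_bumps_XD: "used_bumps XD \<subseteq> model_bumps"
proof
  fix c assume "c \<in> used_bumps XD"
  then obtain lb where c: "positive_bump c" and lb: "lb \<in> lab ` E"
    and ag: "agrees_on (gp lb) c (supt c) \<or> agrees_on (gp lb) (inv c) (supt c)"
    by (auto simp: used_bumps_def XD_def)
  have h: "homeo_plus (gp lb)" using lb model.g_homeo by auto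
  have bc: "bump c" using c positive_bump_def by auto
  have "supt c \<noteq> {}" using connected_supt_bump(2)[OF bc] .
  then obtain q where q: "q \<in> supt c" by blast
  then have "q \<in> supt (gp lb)" using bump_agrees_fixes_endpoints(3)[OF h bc ag] by auto
  then obtain e where e: "e \<in> E" "lab e = lb" "q \<in> model.orb (fst e)" using model.supt_g[OF lb] by auto
  define v where "v = lo (fst e)"
  have v: "v \<in> V" "lt v (p v)" "p v = hi (fst e)" unfolding v_def using e E_edge lo_in lt_lo p_lo by auto
  have qv: "q \<in> supt (Kp v)" using e(3) supt_Kp_lo[OF v(1,2)] v(3) by (simp add: model.orb_def v_def)
  have agv: "agrees_on (gp lb) (Kp v) (supt (Kp v)) \<or> agrees_on (gp lb) (inv (Kp v)) (supt (Kp v))"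
    using gp_agrees_Kp[OF e(1)] e(2) by (simp add: v_def)
  have bv: "positive_bump (Kp v)" using positive_bump_Kp v by auto
  then have "supt c = supt (Kp v)"
    using overlapping_bumps_same_supt[OF h bc _ ag agv] q qv by (auto simp: positive_bump_def)
  then have "c = Kp v" using positive_bump_eqI[OF h c bv ag agv] by simp
  then show "c \<in> model_bumps" using v by (auto simp: model_bumps_def)
qed

lemma XD_fast: "geom_fast XD"
  unfolding geom_fast_def using XD_proper geom_fast_bumps_subset[OF model_bumps_fast used_bumps_XD] by simp

end

section \<open>The semiconjugacy as a fixed point\<close>

context diagram_pairing
begin

text \<open>The closure of the image of the foot of \<open>v\<close> under \<open>Kp v\<close>. It
  is closed so that it also contains the images of both ends of the foot.\<close>

definition cover :: "'v \<Rightarrow> real set" where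
  "cover v = (if lt v (p v) then {L v..L (p v)} else {R (p v)..R v})"

lemma Kp_foot_cover:
  assumes v: "v \<in> V" and q: "q \<in> {L v..<R v}"
  shows "Kp v q \<in> cover v"
proof (cases "lt v (p v)")
  case True
  have "Kp v (L v) \<le> Kp v q" "Kp v q \<le> Kp v (R v)"
    using q homeo_plus_le[OF model.K_homeo[OF v]] by auto
  then show ?thesis using model.K_l[OF v True] model.K_r[OF v True] True by (simp add: cover_def)
next
  case False
  have "Kp v (L v) \<le> Kp v q" "Kp v q \<le> Kp v (R v)"
    using q homeo_plus_le[OF model.K_homeo[OF v]] by auto
  then show ?thesis using model.K_hi[OF v False] False by (simp add: cover_def)
qed

text \<open>The ping-pong step. Half-open feet make it exact at the marker: for a lower vertex,
  \<open>R v\<close> is already outside the foot of \<open>v\<close> and goes to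
  \<open>L (p v)\<close>, the first point of the foot of \<open>p v\<close>.\<close>

lemma Kp_off_foot:
  assumes v: "v \<in> V" and q: "q \<in> model.orb v" "q \<notin> {L v..<R v}"
  shows "q \<in> cover (p v)" "Kp v q \<in> {L (p v)..<R (p v)}"
proof -
  have "q \<in> cover (p v) \<and> Kp v q \<in> {L (p v)..<R (p v)}"
  proof (cases "lt v (p v)")
    case True
    then have hi: "\<not> lt (p v) (p (p v))" using v p_p lt_p_iff by auto
    have "R v \<le> q" "q < R (p v)" using q model.orb_lo[OF v True] by auto
    then have "Kp v (R v) \<le> Kp v q" "Kp v q < Kp v (R (p v))"
      using homeo_plus_le[OF model.K_homeo[OF v]] homeo_plus_less[OF model.K_homeo[OF v]] by auto
    then show ?thesis using model.K_r[OF v True] model.K_r_p[OF v True] hi p_p[OF v] \<open>R v \<le> q\<close> \<open>q < R (p v)\<close>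
      by (simp add: cover_def)
  next
    case False
    note pv = hi_order[OF v False]
    have "q < L v" "L (p v) < q" using q model.orb_lo[OF pv] model.orb_p[OF v] p_p[OF v] by auto
    then have "Kp v (L (p v)) < Kp v q" "Kp v q < Kp v (L v)"
      using homeo_plus_less[OF model.K_homeo[OF v]] by auto
    then show ?thesis using model.K_hi[OF v False] pv p_p[OF v] \<open>q < L v\<close> \<open>L (p v) < q\<close>
      by (simp add: cover_def)
  qed
  then show "q \<in> cover (p v)" "Kp v q \<in> {L (p v)..<R (p v)}" by auto
qed

text \<open>On \<open>cover v\<close> the map \<open>Kp (p v)\<close> is affine with image a closed
  foot of length \<open>1 / N\<close>, while the cover has length at least \<open>2 / N\<close>;
  hence slope at most \<open>1/2\<close>.\<close>

lemma Kp_contract: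
  assumes v: "v \<in> V" and u: "u \<in> cover v" and w: "w \<in> cover v"
  shows "\<bar>Kp (p v) u - Kp (p v) w\<bar> \<le> \<bar>u - w\<bar> / 2"
proof -
  have N1: "1 / N > 0" using N_pos by simp
  have half: "(1 / N) / d \<le> 1 / 2" "0 \<le> (1 / N) / d" if "2 / N \<le> d" for d
  proof -
    have "d > 0" using that N1 by (simp add: less_le_trans[of 0 "2/N" d])
    then show "(1 / N) / d \<le> 1 / 2" "0 \<le> (1 / N) / d"
      using that N_pos by (simp_all add: divide_simps mult.commute)
  qed
  have fin: "\<bar>(u - w) * k\<bar> \<le> \<bar>u - w\<bar> / 2" if "k \<le> 1 / 2" "0 \<le> k" for k
    using mult_left_mono[of k "1/2" "\<bar>u - w\<bar>"] that by (simp add: abs_mult)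
  show ?thesis
  proof (cases "lt v (p v)")
    case True
    then have hi: "\<not> lt (p v) (p (p v))" using v p_p lt_p_iff by auto
    define k where "k = (R v - L v) / (L (p v) - L v)"
    note o = feet_order[OF v True]
    have "2 / N \<le> L (p v) - L v" using R_gap_le_L[OF v True] by (simp add: R_def)
    then have k: "k \<le> 1 / 2" "0 \<le> k" using half unfolding k_def by (simp_all add: R_def)
    have "Kp (p v) q = L v + (q - L v) * k" if "q \<in> cover v" for q
      using that True o unfolding Kp_hi[OF hi] p_p[OF v] k_def cover_def
      by (intro pl_bump_left) auto
    then have "Kp (p v) u - Kp (p v) w = (u - w) * k"
      unfolding left_diff_distrib using u w by simp
    then show ?thesis using fin[OF k] by simp
  next
    case False
    note pv = hi_order[OF v False]
    define k where "k = (R v - L v) / (R v - R (p v))"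
    note o = feet_order[OF pv]
    have "2 / N \<le> R v - R (p v)" using R_gap_le_L[OF pv] p_p[OF v] by (simp add: R_def)
    then have k: "k \<le> 1 / 2" "0 \<le> k" using half unfolding k_def by (simp_all add: R_def)
    have "Kp (p v) q = R v - (R v - q) * k" if "q \<in> cover v" for q
      using that False o unfolding Kp_lo[OF pv(2)] p_p[OF v] k_def cover_def
      by (intro pl_bump_right) auto
    then have "Kp (p v) u - Kp (p v) w = (u - w) * k"
      unfolding left_diff_distrib using u w by simp
    then show ?thesis using fin[OF k] by simp
  qed
qed

end

section \<open>A monotone first approximation with the right values at the ends of the feet\<close>

definition ramp :: "real \<Rightarrow> real \<Rightarrow> real \<Rightarrow> real" where
  "ramp a b x = max 0 (min 1 ((x - a) / (b - a)))"

lemma ramp_0: "a < b \<Longrightarrow> x \<le> a \<Longrightarrow> ramp a b x = 0"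
  and ramp_1: "a < b \<Longrightarrow> b \<le> x \<Longrightarrow> ramp a b x = 1"
  and ramp_mono: "a < b \<Longrightarrow> x \<le> y \<Longrightarrow> ramp a b x \<le> ramp a b y"
  and ramp_cont: "a < b \<Longrightarrow> continuous_on S (ramp a b)"
proof -
  assume ab: "a < b"
  show "x \<le> a \<Longrightarrow> ramp a b x = 0" "b \<le> x \<Longrightarrow> ramp a b x = 1"
    using ab by (auto simp: ramp_def divide_simps min_def max_def)
  show "ramp a b x \<le> ramp a b y" if "x \<le> y"
    using that ab divide_right_mono[of "x - a" "y - a" "b - a"] by (auto simp: ramp_def)
  show "continuous_on S (ramp a b)"
    unfolding ramp_def[abs_def] using ab by (intro continuous_intros) auto
qed

context fast_realization
begin

text \<open>Each foot and each gap contributes a rise of \<open>1 / N\<close>. At \<open>l w\<close>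
  the sum therefore counts the feet and gaps to the left of \<open>w\<close>, which is the
  definition of \<open>L w\<close>.\<close>

definition theta0 :: "real \<Rightarrow> real" where
  "theta0 x = ((\<Sum>v\<in>V. ramp (l v) (r v) x) + (\<Sum>v\<in>gaps. ramp (r v) (l (p v)) x)) / N"

lemma gapsD: "v \<in> gaps \<Longrightarrow> v \<in> V \<and> lt v (p v) \<and> r v < l (p v)"
  using r_less_l by (auto simp: gaps_def)

lemma theta0_mono: "x \<le> y \<Longrightarrow> theta0 x \<le> theta0 y"
  unfolding theta0_def using N_pos l_less_r gapsD
  by (intro divide_right_mono add_mono sum_mono ramp_mono) auto

lemma theta0_cont: "continuous_on S theta0"
  unfolding theta0_def[abs_def] using N_pos l_less_r gapsD
  by (intro continuous_intros ramp_cont) auto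

lemma not_lt_cases: "v \<in> V \<Longrightarrow> w \<in> V \<Longrightarrow> \<not> lt v w \<Longrightarrow> v = w \<or> lt w v"
  using lt_total by blast

lemma l_mono_r: "v \<in> V \<Longrightarrow> w \<in> V \<Longrightarrow> \<not> lt v w \<Longrightarrow> l w \<le> l v \<and> r w \<le> r v"
  using not_lt_cases[of v w] r_le_l[of w v] l_less_r[of v] l_less_r[of w] by auto

text \<open>A gap belongs to two neighbours in the order, so each foot lies entirely to its left or
  entirely to its right, and the ramp is 0 or 1 on both ends of the foot.\<close>

lemma ramp_gap:
  assumes "v \<in> gaps" "w \<in> V" "x \<in> {l w, r w}"
  shows "ramp (r v) (l (p v)) x = of_bool (lt v w)"
proof (cases "lt v w")
  case True
  note v = gapsD[OF assms(1)]
  have "\<not> lt w (p v)" using assms(1,2) True by (auto simp: gaps_def)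
  then have "l (p v) \<le> l w" using l_mono_r[of w "p v"] assms(2) v p_in by auto
  then show ?thesis using True v assms l_less_r[of w] by (auto intro!: ramp_1)
next
  case False
  note v = gapsD[OF assms(1)]
  have "r w \<le> r v" "l w < r w" using l_mono_r[of v w] v assms False l_less_r by auto
  then show ?thesis using False v assms by (auto intro!: ramp_0)
qed

lemma sum_of_bool_lt: "finite A \<Longrightarrow> (\<Sum>v\<in>A. of_bool (lt v w)) = real (card {v\<in>A. lt v w})"
  by (simp add: Int_def)

lemma theta0_l: assumes "w \<in> V" shows "theta0 (l w) = L w"
proof -
  have "ramp (l v) (r v) (l w) = of_bool (lt v w)" if "v \<in> V" for v
    using that assms l_less_r[of v] r_le_l[of v w] l_mono_r[of v w] by (auto intro!: ramp_0 ramp_1)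
  then have "(\<Sum>v\<in>V. ramp (l v) (r v) (l w)) = real (card {v\<in>V. lt v w})"
    using sum_of_bool_lt[OF finV] by simp
  moreover have "(\<Sum>v\<in>gaps. ramp (r v) (l (p v)) (l w)) = real (card {v\<in>gaps. lt v w})"
    using ramp_gap[OF _ assms] sum_of_bool_lt[OF gaps_sub(2)] by simp
  ultimately show ?thesis by (simp add: theta0_def L_def)
qed

lemma theta0_r: assumes "w \<in> V" shows "theta0 (r w) = R w"
proof -
  have "ramp (l v) (r v) (r w) = of_bool (lt v w)" if "v \<in> V - {w}" for v
  proof (cases "lt v w")
    case True
    then show ?thesis using that assms l_less_r[of v] r_le_l[of v w] l_less_r[of w] by (auto intro!: ramp_1)
  next
    case False
    then show ?thesis using that assms l_less_r[of v] r_le_l[of w v] not_lt_cases[of v w] by (auto intro!: ramp_0)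
  qed
  then have "(\<Sum>v\<in>V-{w}. ramp (l v) (r v) (r w)) = (\<Sum>v\<in>V-{w}. of_bool (lt v w))"
    by (intro sum.cong) auto
  moreover have "ramp (l w) (r w) (r w) = 1" using assms l_less_r by (auto intro!: ramp_1)
  moreover have "(\<Sum>v\<in>V. of_bool (lt v w)) = (\<Sum>v\<in>V-{w}. of_bool (lt v w) :: real)"
    using assms lt_irrefl finV by (subst sum.remove[of V w]) auto
  ultimately have "(\<Sum>v\<in>V. ramp (l v) (r v) (r w)) = 1 + real (card {v\<in>V. lt v w})"
    using sum_of_bool_lt[OF finV] finV assms by (subst sum.remove[of V w]) auto
  moreover have "(\<Sum>v\<in>gaps. ramp (r v) (l (p v)) (r w)) = real (card {v\<in>gaps. lt v w})"
    using ramp_gap[OF _ assms] sum_of_bool_lt[OF gaps_sub(2)] by simp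
  ultimately show ?thesis using N_pos by (simp add: theta0_def L_def R_def divide_simps)
qed

lemma theta0_0: "theta0 0 = 0"
proof -
  have "ramp (l v) (r v) 0 = 0" if "v \<in> V" for v using that l_ge l_less_r by (auto intro!: ramp_0)
  moreover have "ramp (r v) (l (p v)) 0 = 0" if "v \<in> gaps" for v
    using gapsD[OF that] l_ge[of v] l_less_r[of v] by (auto intro!: ramp_0)
  ultimately show ?thesis by (simp add: theta0_def)
qed

lemma theta0_1: "theta0 1 = 1"
proof -
  have "ramp (l v) (r v) 1 = 1" if "v \<in> V" for v using that r_le l_less_r by (auto intro!: ramp_1)
  moreover have "ramp (r v) (l (p v)) 1 = 1" if "v \<in> gaps" for v
    using gapsD[OF that] r_le[of "p v"] l_less_r[of "p v"] p_in[of v] by (auto intro!: ramp_1)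
  ultimately show ?thesis using N_pos by (simp add: theta0_def N_def)
qed

lemma feet_disjoint: "v \<in> V \<Longrightarrow> w \<in> V \<Longrightarrow> x \<in> {l v<..<r v} \<Longrightarrow> x \<in> {l w<..<r w} \<Longrightarrow> v = w"
  using lt_total[of v w] r_le_l[of v w] r_le_l[of w v] by auto

lemma ends_not_in_feet: "v \<in> V \<Longrightarrow> w \<in> V \<Longrightarrow> l v \<notin> {l w<..<r w} \<and> r v \<notin> {l w<..<r w}"
  using lt_total[of v w] r_le_l[of v w] r_le_l[of w v] l_less_r[of v] l_less_r[of w] by force

text \<open>The space on which \<open>T\<close> contracts: the conditions survive \<open>T\<close>
  and uniform limits, and the prescribed values at the ends of the feet keep
  \<open>\<theta> (K v x)\<close> inside \<open>cover v\<close>, where \<open>Kp (p v)\<close> has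
  slope at most \<open>1/2\<close>.\<close>

definition adm :: "(real \<Rightarrow> real) \<Rightarrow> bool" where
  "adm \<theta> \<longleftrightarrow> continuous_on {0..1} \<theta> \<and> mono_on {0..1} \<theta> \<and>
     (\<forall>v\<in>V. \<theta> (l v) = L v \<and> \<theta> (r v) = R v) \<and> \<theta> 0 = 0 \<and> \<theta> 1 = 1"

lemma adm_theta0: "adm theta0"
  unfolding adm_def using theta0_cont theta0_mono theta0_l theta0_r theta0_0 theta0_1
  by (auto intro: mono_onI)

text \<open>A fixed point satisfies the conjugacy equation on every open foot. Open feet are
  pairwise disjoint, so the description picks a unique vertex, whereas closed feet may
  touch.\<close>

definition T :: "(real \<Rightarrow> real) \<Rightarrow> real \<Rightarrow> real" where
  "T \<theta> x = (if \<exists>v\<in>V. x \<in> {l v<..<r v}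
     then let v = THE v. v \<in> V \<and> x \<in> {l v<..<r v} in Kp (p v) (\<theta> (K v x)) else theta0 x)"

lemma T_off: "(\<And>v. v \<in> V \<Longrightarrow> x \<notin> {l v<..<r v}) \<Longrightarrow> T \<theta> x = theta0 x"
  by (auto simp: T_def)

lemma T_open_foot:
  assumes "v \<in> V" "x \<in> {l v<..<r v}"
  shows "T \<theta> x = Kp (p v) (\<theta> (K v x))"
proof -
  have "(THE v. v \<in> V \<and> x \<in> {l v<..<r v}) = v"
    using assms feet_disjoint by (intro the_equality) blast+
  then show ?thesis using assms unfolding T_def Let_def by auto
qed

lemma T_ends:
  assumes "v \<in> V" shows "T \<theta> (l v) = L v" "T \<theta> (r v) = R v"
  using T_off[of "l v" \<theta>] T_off[of "r v" \<theta>] ends_not_in_feet[OF assms] theta0_l[OF assms] theta0_r[OF assms]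
  by metis+

lemma foot_in_unit: "v \<in> V \<Longrightarrow> {l v..r v} \<subseteq> {0..1}"
  using l_ge[of v] r_le[of v] by auto

lemma adm_K_cover:
  assumes \<theta>: "adm \<theta>" and v: "v \<in> V" and x: "x \<in> {l v..r v}"
  shows "\<theta> (K v x) \<in> cover v"
proof -
  have x01: "x \<in> {0..1}" "K v x \<in> {0..1}" "l v \<in> {0..1}" "r v \<in> {0..1}"
    using x foot_in_unit[OF v] homeo_plus_in_unit[OF K_homeo[OF v]] by auto
  have ul: "l (p v) \<in> {0..1}" "r (p v) \<in> {0..1}" using foot_in_unit[OF p_in[OF v]] l_less_r[OF p_in[OF v]] by auto
  have mono: "\<theta> a \<le> \<theta> b" if "a \<in> {0..1}" "b \<in> {0..1}" "a \<le> b" for a b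
    using \<theta> that by (auto simp: adm_def mono_on_def)
  have ends: "\<theta> (l v) = L v" "\<theta> (r v) = R v" "\<theta> (l (p v)) = L (p v)" "\<theta> (r (p v)) = R (p v)"
    using \<theta> v p_in by (auto simp: adm_def)
  have K: "K v (l v) \<le> K v x" "K v x \<le> K v (r v)"
    using x homeo_plus_le[OF K_homeo[OF v]] by auto
  show ?thesis
  proof (cases "lt v (p v)")
    case True
    then show ?thesis
      using K K_l[OF v True] K_r[OF v True] mono[of "l v" "K v x"] mono[of "K v x" "l (p v)"] x01 ul ends
      by (simp add: cover_def)
  next
    case False
    then show ?thesis
      using K K_hi[OF v False] mono[of "r (p v)" "K v x"] mono[of "K v x" "r v"] x01 ul ends
      by (simp add: cover_def)
  qed
qed

lemma Kp_p_ends: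
  assumes \<theta>: "adm \<theta>" and v: "v \<in> V"
  shows "Kp (p v) (\<theta> (K v (l v))) = L v" "Kp (p v) (\<theta> (K v (r v))) = R v"
proof -
  have ends: "\<theta> (l v) = L v" "\<theta> (r v) = R v" "\<theta> (l (p v)) = L (p v)" "\<theta> (r (p v)) = R (p v)"
    using \<theta> v p_in by (auto simp: adm_def)
  have "Kp (p v) (\<theta> (K v (l v))) = L v \<and> Kp (p v) (\<theta> (K v (r v))) = R v"
  proof (cases "lt v (p v)")
    case True
    then have hi: "\<not> lt (p v) (p (p v))" using v p_p lt_p_iff by auto
    show ?thesis using K_l[OF v True] K_r[OF v True] ends model.K_hi[OF p_in[OF v] hi] p_p[OF v] by simp
  next
    case False
    note pv = hi_order[OF v False]
    show ?thesis using K_hi[OF v False] ends model.K_r[OF pv] model.K_r_p[OF pv] p_p[OF v] by simp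
  qed
  then show "Kp (p v) (\<theta> (K v (l v))) = L v" "Kp (p v) (\<theta> (K v (r v))) = R v" by auto
qed

text \<open>At the ends of a foot the value of \<open>theta0\<close> and the conjugacy formula
  agree, both being \<open>L v\<close> or \<open>R v\<close>. This is what glues the two branches of
  \<open>T\<close> continuously.\<close>

lemma T_closed_foot:
  assumes \<theta>: "adm \<theta>" and v: "v \<in> V" and x: "x \<in> {l v..r v}"
  shows "T \<theta> x = Kp (p v) (\<theta> (K v x))"
proof -
  consider "x = l v" | "x = r v" | "x \<in> {l v<..<r v}" using x by force
  then show ?thesis
    using Kp_p_ends[OF \<theta> v] T_ends[OF v] T_open_foot[OF v] by cases auto
qed

lemma T_cont:
  assumes \<theta>: "adm \<theta>" shows "continuous_on {0..1} (T \<theta>)"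
proof -
  \<comment> \<open>The closed set \<open>C\<close>, on which \<open>T \<theta>\<close> is
    \<open>theta0\<close>, and the finitely many closed feet cover the interval, so continuity can
    be checked on each piece.\<close>
  define C where "C = {0..1} - (\<Union>v\<in>V. {l v<..<r v})"
  have "continuous_on C (T \<theta>) \<longleftrightarrow> continuous_on C theta0"
    by (rule continuous_on_cong) (auto simp: C_def intro!: T_off)
  then have c1: "continuous_on C (T \<theta>)" using theta0_cont by blast
  have c2: "continuous_on {l v..r v} (T \<theta>)" if v: "v \<in> V" for v
  proof -
    have cK: "continuous_on S (K v)" "continuous_on S (Kp (p v))" for S
      using homeo_plus_isCont[OF K_homeo[OF v]] homeo_plus_isCont[OF model.K_homeo[OF p_in[OF v]]]
      by (auto intro!: continuous_at_imp_continuous_on)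
    have "K v ` {l v..r v} \<subseteq> {0..1}"
      using foot_in_unit[OF v] homeo_plus_in_unit[OF K_homeo[OF v]] by blast
    then have "continuous_on {l v..r v} (\<lambda>x. Kp (p v) (\<theta> (K v x)))"
      using \<theta> unfolding adm_def
      by (intro continuous_on_compose2[OF cK(2)[of UNIV]] continuous_on_compose2[OF _ cK(1), of "{0..1}" \<theta>]) auto
    then show ?thesis
      using T_closed_foot[OF \<theta> v] by (subst continuous_on_cong[OF refl]) auto
  qed
  have "closed C" unfolding C_def by (intro closed_Diff) auto
  moreover have "continuous_on (\<Union>v\<in>V. {l v..r v}) (T \<theta>)"
    using finV c2 by (intro continuous_on_closed_Union) auto
  moreover have "closed (\<Union>v\<in>V. {l v..r v})" using finV by auto
  ultimately have "continuous_on (C \<union> (\<Union>v\<in>V. {l v..r v})) (T \<theta>)"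
    using c1 by (intro continuous_on_closed_Un) auto
  moreover have "C \<union> (\<Union>v\<in>V. {l v..r v}) = {0..1}"
    unfolding C_def using foot_in_unit by (auto simp: subset_iff)
  ultimately show ?thesis by simp
qed

lemma T_foot_mono:
  assumes \<theta>: "adm \<theta>" and v: "v \<in> V" and "l v \<le> x" "x \<le> y" "y \<le> r v"
  shows "T \<theta> x \<le> T \<theta> y"
proof -
  have "K v x \<in> {0..1}" "K v y \<in> {0..1}" "K v x \<le> K v y"
    using assms foot_in_unit[OF v] homeo_plus_in_unit[OF K_homeo[OF v]] homeo_plus_le[OF K_homeo[OF v]]
    by (auto simp del: atLeastAtMost_iff) (auto simp: subset_iff)
  then have "\<theta> (K v x) \<le> \<theta> (K v y)" using \<theta> by (auto simp: adm_def mono_on_def)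
  then have "Kp (p v) (\<theta> (K v x)) \<le> Kp (p v) (\<theta> (K v y))"
    using homeo_plus_le[OF model.K_homeo[OF p_in[OF v]]] by simp
  then show ?thesis using T_closed_foot[OF \<theta> v] assms by auto
qed

lemma T_mono:
  assumes \<theta>: "adm \<theta>" shows "mono_on {0..1} (T \<theta>)"
proof (rule mono_onI)
  fix x y :: real assume "x \<le> y"
  \<comment> \<open>Moving \<open>x\<close> to the end of its foot reaches a point where
    \<open>T \<theta>\<close> equals \<open>theta0\<close>; the monotonicity of
    \<open>theta0\<close> then compares points in different feet.\<close>
  have right: "T \<theta> x \<le> theta0 c" if "x \<le> c" and nin: "\<And>v. v \<in> V \<Longrightarrow> x \<in> {l v<..<r v} \<Longrightarrow> r v \<le> c" for c
  proof (cases "\<exists>v\<in>V. x \<in> {l v<..<r v}")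
    case True
    then obtain v where v: "v \<in> V" "x \<in> {l v<..<r v}" by blast
    then have "T \<theta> x \<le> T \<theta> (r v)" using T_foot_mono[OF \<theta> v(1), of x "r v"] by auto
    also have "\<dots> = theta0 (r v)" using T_ends theta0_r v by simp
    also have "\<dots> \<le> theta0 c" using theta0_mono nin v by auto
    finally show ?thesis .
  next
    case False
    then show ?thesis using T_off[of x \<theta>] theta0_mono[OF \<open>x \<le> c\<close>] by auto
  qed
  show "T \<theta> x \<le> T \<theta> y"
  proof (cases "\<exists>v\<in>V. y \<in> {l v<..<r v}")
    case True
    then obtain w where w: "w \<in> V" "y \<in> {l w<..<r w}" by blast
    show ?thesis
    proof (cases "l w \<le> x")
      case True
      then show ?thesis using T_foot_mono[OF \<theta> w(1), of x y] \<open>x \<le> y\<close> w by auto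
    next
      case False
      have le: "r v \<le> l w" if "v \<in> V" "x \<in> {l v<..<r v}" for v
      proof -
        have "v \<noteq> w" using False that by auto
        moreover have "\<not> lt w v" using r_le_l[of w v] that w False l_less_r[of w] by auto
        ultimately show ?thesis using lt_total[of v w] r_le_l[of v w] that w by auto
      qed
      have "T \<theta> x \<le> theta0 (l w)" using right[of "l w"] le False by auto
      also have "\<dots> = T \<theta> (l w)" using T_ends theta0_l w by simp
      also have "\<dots> \<le> T \<theta> y" using T_foot_mono[OF \<theta> w(1), of "l w" y] w by auto
      finally show ?thesis .
    qed
  next
    case False
    have "r v \<le> y" if "v \<in> V" "x \<in> {l v<..<r v}" for v
      using False that \<open>x \<le> y\<close> by force
    then show ?thesis using right[OF \<open>x \<le> y\<close>] T_off[of y \<theta>] False by auto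
  qed
qed

lemma adm_T:
  assumes "adm \<theta>" shows "adm (T \<theta>)"
proof -
  have "T \<theta> 0 = 0" using T_off[of 0 \<theta>] theta0_0 l_ge by force
  moreover have "T \<theta> 1 = 1" using T_off[of 1 \<theta>] theta0_1 r_le by force
  ultimately show ?thesis
    unfolding adm_def using T_cont[OF assms] T_mono[OF assms] T_ends by auto
qed

lemma T_contract:
  assumes "adm \<theta>" "adm \<eta>" "\<And>x. x \<in> {0..1} \<Longrightarrow> \<bar>\<theta> x - \<eta> x\<bar> \<le> d" "x \<in> {0..1}"
  shows "\<bar>T \<theta> x - T \<eta> x\<bar> \<le> d / 2"
proof (cases "\<exists>v\<in>V. x \<in> {l v<..<r v}")
  case True
  then obtain v where v: "v \<in> V" "x \<in> {l v<..<r v}" by blast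
  then have xc: "x \<in> {l v..r v}" by auto
  have "\<bar>T \<theta> x - T \<eta> x\<bar> \<le> \<bar>\<theta> (K v x) - \<eta> (K v x)\<bar> / 2"
    using Kp_contract[OF v(1) adm_K_cover[OF assms(1) v(1) xc] adm_K_cover[OF assms(2) v(1) xc]]
    by (simp add: T_open_foot[OF v])
  also have "\<dots> \<le> d / 2"
    using assms(3)[of "K v x"] homeo_plus_in_unit[OF K_homeo[OF v(1)], of x] assms(4) by simp
  finally show ?thesis .
next
  case False
  have "0 \<le> d" using assms(3)[OF assms(4)] by linarith
  then show ?thesis using T_off[of x] False by auto
qed

lemma ex_theta:
  "\<exists>\<theta>. adm \<theta> \<and> (\<forall>v\<in>V. \<forall>x\<in>{l v<..<r v}. \<theta> x = Kp (p v) (\<theta> (K v x)))"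
proof -
  define th where "th n = (T ^^ n) theta0" for n
  have thS: "th (Suc n) = T (th n)" for n by (simp add: th_def)
  have admth: "adm (th n)" for n
    by (induction n) (auto simp: th_def adm_theta0 intro: adm_T)
  have unit: "\<theta> x \<in> {0..1}" if "adm \<theta>" "x \<in> {0..1}" for \<theta> x
  proof -
    have "mono_on {0..1} \<theta>" using that by (simp add: adm_def)
    then have "\<theta> 0 \<le> \<theta> x" "\<theta> x \<le> \<theta> 1" using that(2) by (auto elim!: mono_onD)
    then show ?thesis using that by (simp add: adm_def)
  qed
  \<comment> \<open>The bound is 1 at \<open>n = 0\<close> because all iterates take values in the
    unit interval; each application of \<open>T\<close> halves it.\<close>
  have diff: "\<bar>th (Suc n) x - th n x\<bar> \<le> (1/2)^n" if "x \<in> {0..1}" for n x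
    using that
  proof (induction n arbitrary: x)
    case 0
    then show ?case using unit[OF admth, of x 0] unit[OF admth, of x "Suc 0"] by auto
  next
    case (Suc n)
    have "\<bar>T (th (Suc n)) x - T (th n) x\<bar> \<le> (1/2)^n / 2"
      by (rule T_contract[OF admth admth]) (use Suc in auto)
    then show ?case by (simp add: thS[of "Suc n"] thS[of n])
  qed
  \<comment> \<open>The limit of the iterates as a telescoping series, so that the Weierstrass test
    yields uniform convergence and with it continuity.\<close>
  define \<theta> where "\<theta> x = th 0 x + (\<Sum>i. th (Suc i) x - th i x)" for x
  have "uniform_limit {0..1} (\<lambda>n x. \<Sum>i<n. th (Suc i) x - th i x) (\<lambda>x. \<Sum>i. th (Suc i) x - th i x) sequentially"
    by (rule Weierstrass_m_test[of _ _ "\<lambda>n. (1/2)^n"]) (use diff in \<open>auto simp: summable_geometric\<close>)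
  then have "uniform_limit {0..1} (\<lambda>n x. th 0 x + (\<Sum>i<n. th (Suc i) x - th i x)) \<theta> sequentially"
    unfolding \<theta>_def[abs_def] by (intro uniform_limit_intros)
  moreover have "th 0 x + (\<Sum>i<n. th (Suc i) x - th i x) = th n x" for n x
    by (induction n) simp_all
  ultimately have ul: "uniform_limit {0..1} th \<theta> sequentially"
    by simp
  have lim: "(\<lambda>n. th n x) \<longlonglongrightarrow> \<theta> x" if "x \<in> {0..1}" for x
    using tendsto_uniform_limitI[OF ul that] .
  have const: "\<theta> x = c" if "x \<in> {0..1}" "\<And>n. th n x = c" for x c
    using LIMSEQ_unique[OF lim[OF that(1)]] that(2) by simp
  have "continuous_on {0..1} \<theta>"
    using admth by (intro uniform_limit_theorem[OF _ ul]) (auto simp: adm_def)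
  moreover have "mono_on {0..1} \<theta>"
  proof (rule mono_onI)
    fix x y :: real assume "x \<in> {0..1}" "y \<in> {0..1}" "x \<le> y"
    then show "\<theta> x \<le> \<theta> y"
      using admth by (intro LIMSEQ_le[OF lim lim]) (auto simp: adm_def mono_on_def)
  qed
  moreover have "\<theta> (l v) = L v \<and> \<theta> (r v) = R v" if "v \<in> V" for v
    using that foot_in_unit[OF that] l_less_r[OF that] admth
    by (auto intro!: const simp: adm_def)
  moreover have "\<theta> 0 = 0" "\<theta> 1 = 1" using admth by (auto intro!: const simp: adm_def)
  ultimately have "adm \<theta>" by (auto simp: adm_def)
  moreover have "\<theta> x = Kp (p v) (\<theta> (K v x))" if v: "v \<in> V" "x \<in> {l v<..<r v}" for v x
  proof -
    have x: "x \<in> {0..1}" "K v x \<in> {0..1}"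
      using v foot_in_unit[OF v(1)] homeo_plus_in_unit[OF K_homeo[OF v(1)]] by auto
    have "(\<lambda>n. Kp (p v) (th n (K v x))) \<longlonglongrightarrow> Kp (p v) (\<theta> (K v x))"
      using lim[OF x(2)] homeo_plus_isCont[OF model.K_homeo[OF p_in[OF v(1)]]] by (rule isCont_tendsto_compose[rotated])
    moreover have "(\<lambda>n. th (Suc n) x) \<longlonglongrightarrow> \<theta> x" using lim[OF x(1)] by (rule LIMSEQ_Suc)
    ultimately show ?thesis
      using LIMSEQ_unique T_open_foot[OF v] by (simp add: thS) blast
  qed
  ultimately show ?thesis by blast
qed

lemma ex_semiconjugacy:
  "\<exists>\<theta>. continuous_on {0..1} \<theta> \<and> mono_on {0..1} \<theta> \<and> \<theta> ` {0..1} = {0..1} \<and>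
    (\<forall>v\<in>V. \<forall>z\<in>{0..1}. \<theta> (K v z) = Kp v (\<theta> z)) \<and>
    (\<forall>v\<in>V. \<forall>z\<in>{0..1}. \<theta> z \<in> model.orb v \<longleftrightarrow> z \<in> orb v)"
proof -
  obtain \<theta> where adm: "adm \<theta>"
    and fixp: "\<And>v x. v \<in> V \<Longrightarrow> x \<in> {l v<..<r v} \<Longrightarrow> \<theta> x = Kp (p v) (\<theta> (K v x))"
    using ex_theta by blast
  have cont: "continuous_on {0..1} \<theta>" and mo: "mono_on {0..1} \<theta>"
    and ends: "\<And>v. v \<in> V \<Longrightarrow> \<theta> (l v) = L v" "\<And>v. v \<in> V \<Longrightarrow> \<theta> (r v) = R v" and e01: "\<theta> 0 = 0" "\<theta> 1 = 1"
    using adm by (auto simp: adm_def)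
  have mono: "\<theta> a \<le> \<theta> b" if "a \<in> {0..1}" "b \<in> {0..1}" "a \<le> b" for a b
    using mo that by (auto simp: mono_on_def)
  have surj: "\<theta> ` {0..1} = {0..1}"
  proof (intro equalityI subsetI)
    fix u assume "u \<in> \<theta> ` {0..1}"
    then obtain z where "z \<in> {0..1}" "u = \<theta> z" by blast
    then show "u \<in> {0..1}" using mono[of 0 z] mono[of z 1] e01 by auto
  next
    fix u :: real assume "u \<in> {0..1}"
    then show "u \<in> \<theta> ` {0..1}" using IVT'[of \<theta> 0 u 1] cont e01 by auto
  qed
  have unit: "l (lo v) \<in> {0..1}" "r (hi v) \<in> {0..1}" if "v \<in> V" for v
    using foot_in_unit[OF lo_in[OF that]] foot_in_unit[OF hi_in[OF that]]
      l_less_r[OF lo_in[OF that]] l_less_r[OF hi_in[OF that]] by auto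
  have off: "\<theta> z \<notin> model.orb v" if "v \<in> V" "z \<in> {0..1}" "z \<notin> orb v" for v z
  proof -
    have "z \<le> l (lo v) \<or> r (hi v) \<le> z" using that(3) by (auto simp: orb_def)
    then have "\<theta> z \<le> L (lo v) \<or> R (hi v) \<le> \<theta> z"
      using mono[of z "l (lo v)"] mono[of "r (hi v)" z] unit[OF that(1)] that
        ends(1)[OF lo_in[OF that(1)]] ends(2)[OF hi_in[OF that(1)]] by auto
    then show ?thesis by (auto simp: model.orb_def)
  qed
  have conj: "\<theta> (K v z) = Kp v (\<theta> z)" if v: "v \<in> V" and z: "z \<in> {0..1}" for v z
  proof (cases "z \<in> orb v")
    case False
    then have "K v z = z" "Kp v (\<theta> z) = \<theta> z"
      using K_neq_iff[OF v] model.K_neq_iff[OF v] off[OF v z] by blast+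
    then show ?thesis by simp
  next
    case True
    have pv: "p v \<in> V" "p (p v) = v" using v p_in p_p by auto
    \<comment> \<open>A point of the orbital lies in the open source foot, or lands in the open
      destination foot, or is the break point between these cases. The first two use the fixed point
      equation, at \<open>z\<close> for \<open>v\<close> or at \<open>K v z\<close> for
      \<open>p v\<close>; at the break point all values are known.\<close>
    consider "z \<in> {l v<..<r v}" | "K v z \<in> {l (p v)<..<r (p v)}"
      | "lt v (p v)" "z = r v" | "\<not> lt v (p v)" "z = l v"
    proof (cases "lt v (p v)")
      case lo: True
      have "l v < z" "z < r (p v)" using True orb_lo[OF v lo] by auto
      then have "r v < z \<Longrightarrow> K v (r v) < K v z" "K v z < K v (r (p v))"
        using homeo_plus_less[OF K_homeo[OF v]] by auto
      then show ?thesis using that lo \<open>l v < z\<close> K_r[OF v lo] K_r_p[OF v lo]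
        by (cases "z < r v"; cases "z = r v") auto
    next
      case hi: False
      have "l (p v) < z" "z < r v" using True orb_lo[OF hi_order[OF v hi]] orb_p[OF v] pv by auto
      then have "z < l v \<Longrightarrow> K v z < K v (l v)" "K v (l (p v)) < K v z"
        using homeo_plus_less[OF K_homeo[OF v]] by auto
      then show ?thesis using that hi \<open>z < r v\<close> K_hi[OF v hi]
        by (cases "l v < z"; cases "z = l v") auto
    qed
    then show ?thesis
    proof cases
      case 1
      then show ?thesis using fixp[OF v] model.K_K_p[OF v] by metis
    next
      case 2
      then show ?thesis using fixp[OF pv(1)] K_p_K[OF v] pv(2) by metis
    next
      case 3
      then show ?thesis using K_r[OF v] model.K_r[OF v] ends v pv by simp
    next
      case 4
      then show ?thesis using K_hi(2)[OF v] model.K_hi(2)[OF v] ends v pv by simp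
    qed
  qed
  have on_lo: "\<theta> z \<in> model.orb v" if v: "v \<in> V" "lt v (p v)" and z: "z \<in> orb v" for v z
  proof -
    note pv = p_in[OF v(1)]
    have ul: "l v \<in> {0..1}" "r (p v) \<in> {0..1}" using unit[OF v(1)] v(2) by (auto simp: lower_end_def upper_end_def)
    have z': "l v < z" "z < r (p v)" using z orb_lo[OF v] by auto
    then have z01: "z \<in> {0..1}" using ul by auto
    have le: "L v \<le> \<theta> z" "\<theta> z \<le> R (p v)"
      using mono[OF ul(1) z01] mono[OF z01 ul(2)] z' ends v pv by auto
    have LR: "L v < R (p v)" using model.l_less_r_p[OF v] .
    \<comment> \<open>If \<open>\<theta>\<close> took an end \<open>c\<close> of the model orbital
      as a value inside the orbital, the level set of \<open>c\<close> would be compact and, as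
      \<open>Kp\<close> fixes \<open>c\<close>, invariant under \<open>K v\<close> and its inverse.
      Its largest point (for the left end) or least point (for the right end) still lies in the
      orbital and would be moved past itself.\<close>
    have stuck: False if c: "c = L v \<or> c = R (p v)" "\<theta> z = c" for c
    proof -
      define S where "S = {0..1} \<inter> \<theta> -` {c}"
      have "compact S"
        unfolding compact_eq_bounded_closed
      proof
        show "bounded S" by (rule bounded_subset[of "{0..1}"]) (auto simp: S_def)
        show "closed S" unfolding S_def using cont by (rule continuous_closed_preimage) auto
      qed
      moreover have zS: "z \<in> S" using z01 c by (simp add: S_def)
      ultimately obtain a b where ab: "a \<in> S" "\<And>s. s \<in> S \<Longrightarrow> s \<le> a" "b \<in> S" "\<And>s. s \<in> S \<Longrightarrow> b \<le> s"
        using compact_attains_sup[of S] compact_attains_inf[of S] by blast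
      have fixc: "Kp w c = c" if "w \<in> {v, p v}" for w
        using that c(1) model.K_l[OF v] model.K_r_p[OF v] model.K_p_K[OF v(1)] by auto metis+
      have inS: "K w s \<in> S" if "w \<in> {v, p v}" "s \<in> S" for w s
        using that fixc[OF that(1)] conj[of w s] v pv homeo_plus_in_unit[OF K_homeo[of w]] by (auto simp: S_def)
      from c(1) show False
      proof
        assume cL: "c = L v"
        have "a < r (p v)"
        proof (rule ccontr)
          assume "\<not> a < r (p v)"
          then have "R (p v) \<le> \<theta> a" using mono[OF ul(2), of a] ab(1) ends(2)[OF pv] by (auto simp: S_def)
          then show False using ab(1) cL LR by (simp add: S_def)
        qed
        moreover have "l v < a" using ab(2)[OF zS] z' by simp
        ultimately have "a < K v a" using K_up[OF v] by blast
        then show False using ab(2)[OF inS[OF _ ab(1)], of v] by simp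
      next
        assume cR: "c = R (p v)"
        have "l v < b"
        proof (rule ccontr)
          assume "\<not> l v < b"
          then have "\<theta> b \<le> L v" using mono[OF _ ul(1), of b] ab(3) ends(1)[OF v(1)] by (auto simp: S_def)
          then show False using ab(3) cR LR by (simp add: S_def)
        qed
        moreover have "b < r (p v)" using ab(4)[OF zS] z' by simp
        ultimately have "K (p v) b \<in> orb v" using K_orb_iff[OF pv, of b] orb_p[OF v(1)] orb_lo[OF v] by auto
        then have "K (p v) b < b" using K_up[OF v, of "K (p v) b"] K_K_p[OF v(1)] orb_lo[OF v] by auto
        then show False using ab(4)[OF inS[OF _ ab(3)], of "p v"] by simp
      qed
    qed
    then have "\<theta> z \<noteq> L v" "\<theta> z \<noteq> R (p v)" by auto
    then show ?thesis using le model.orb_lo[OF v] by auto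
  qed
  have on: "\<theta> z \<in> model.orb v" if v: "v \<in> V" and z: "z \<in> orb v" for v z
  proof (cases "lt v (p v)")
    case False
    then show ?thesis using on_lo[OF hi_order[OF v False], of z] z orb_p[OF v] model.orb_p[OF v] by simp
  qed (use on_lo v z in blast)
  have "\<theta> z \<in> model.orb v \<longleftrightarrow> z \<in> orb v" if "v \<in> V" "z \<in> {0..1}" for v z
    using on off that by blast
  then show ?thesis using cont mo surj conj by blast
qed

end

section \<open>Ping-pong in the model\<close>

context diagram_pairing
begin

text \<open>Every letter must move the point it is applied to. Without this, a reduced word whose
  letters are supported elsewhere would be the identity near \<open>q\<close>.\<close>

fun loc :: "'v list \<Rightarrow> real \<Rightarrow> bool" where
  "loc [] q \<longleftrightarrow> True"
| "loc (v # bs) q \<longleftrightarrow> v \<in> V \<and> q \<in> model.orb v \<and> loc bs (Kp v q)"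

definition reduced :: "'v list \<Rightarrow> bool" where
  "reduced bs \<longleftrightarrow> (\<forall>cs v ds. bs \<noteq> cs @ v # p v # ds)"

lemma loc_append: "loc (bs @ cs) q \<longleftrightarrow> loc bs q \<and> loc cs (fold Kp bs q)"
  by (induction bs arbitrary: q) auto

lemma loc_set: "loc bs q \<Longrightarrow> set bs \<subseteq> V"
  by (induction bs arbitrary: q) auto

lemma reduced_infix: "reduced (as @ bs @ cs) \<Longrightarrow> reduced bs"
  unfolding reduced_def by (metis append.assoc append_Cons)

lemma reduced_Cons: "reduced (v # bs) \<Longrightarrow> reduced bs"
  using reduced_infix[of "[v]" bs "[]"] by simp

lemma reduced_Cons_Cons: "reduced (v # w # bs) \<Longrightarrow> w \<noteq> p v"
  unfolding reduced_def by (metis append_Nil)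

lemma fold_Kp_homeo: "set bs \<subseteq> V \<Longrightarrow> homeo_plus (fold Kp bs)"
  by (induction bs) (auto intro: homeo_plus_id homeo_plus_comp model.K_homeo)

lemma Kp_contract_off_foot:
  assumes v: "v \<in> V" and q: "q \<in> model.orb v" "q \<notin> {L v..<R v}" "q' \<in> model.orb v" "q' \<notin> {L v..<R v}"
  shows "\<bar>Kp v q - Kp v q'\<bar> \<le> \<bar>q - q'\<bar> / 2"
  using Kp_contract[OF p_in[OF v] Kp_off_foot(1)[OF v q(1,2)] Kp_off_foot(1)[OF v q(3,4)]] p_p[OF v] by simp

lemma Kp_expand_on_foot:
  assumes v: "v \<in> V" and q: "q \<in> {L v..<R v}" "q' \<in> {L v..<R v}"
  shows "\<bar>q - q'\<bar> \<le> \<bar>Kp v q - Kp v q'\<bar> / 2"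
  using Kp_contract[OF v Kp_foot_cover[OF v q(1)] Kp_foot_cover[OF v q(2)]] model.K_p_K[OF v] by simp

lemma feet_eq: "v \<in> V \<Longrightarrow> w \<in> V \<Longrightarrow> q \<in> {L v..<R v} \<Longrightarrow> q \<in> {L w..<R w} \<Longrightarrow> v = w"
  using lt_total[of v w] R_le_L[of v w] R_le_L[of w v] by auto

text \<open>After a contracting step the point lies in the foot where only the inverse letter expands, so a
  reduced word goes on contracting.\<close>

lemma reduced_contracts:
  assumes "reduced (v # bs)" "loc (v # bs) q" "loc (v # bs) q'" "q \<notin> {L v..<R v}" "q' \<notin> {L v..<R v}"
  shows "\<bar>fold Kp (v # bs) q - fold Kp (v # bs) q'\<bar> \<le> \<bar>q - q'\<bar> / 2"
  using assms
proof (induction bs arbitrary: v q q')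
  case Nil
  then show ?case using Kp_contract_off_foot[of v q q'] by simp
next
  case (Cons w bs)
  have v: "v \<in> V" "q \<in> model.orb v" "q' \<in> model.orb v" and w: "w \<in> V" using Cons.prems by auto
  have 1: "\<bar>Kp v q - Kp v q'\<bar> \<le> \<bar>q - q'\<bar> / 2"
    using Kp_contract_off_foot v Cons.prems by blast
  have "w \<noteq> p v" using reduced_Cons_Cons Cons.prems(1) by blast
  then have "Kp v q \<notin> {L w..<R w}" "Kp v q' \<notin> {L w..<R w}"
    using Kp_off_foot(2)[OF v(1)] v w Cons.prems feet_eq[OF w p_in[OF v(1)]] by blast+
  then have "\<bar>fold Kp (w # bs) (Kp v q) - fold Kp (w # bs) (Kp v q')\<bar> \<le> \<bar>Kp v q - Kp v q'\<bar> / 2"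
    using Cons.IH[of w "Kp v q" "Kp v q'"] Cons.prems reduced_Cons by auto
  then have "\<bar>fold Kp (v # w # bs) q - fold Kp (v # w # bs) q'\<bar> \<le> \<bar>Kp v q - Kp v q'\<bar> / 2" by simp
  also have "\<dots> \<le> \<bar>Kp v q - Kp v q'\<bar>" by simp
  also note 1
  finally show ?case .
qed

text \<open>The mirror image of \<open>reduced_contracts\<close>, read from the last letter
  backwards: had the letter before \<open>w\<close> acted off its own foot, it would have landed in
  the foot of its inverse, which differs from the foot of \<open>w\<close> in a reduced word. So
  every letter acts on its own foot, where it expands.\<close>

lemma reduced_expands:
  assumes "reduced (bs @ [w])" "loc (bs @ [w]) q" "loc (bs @ [w]) q'"
    "fold Kp bs q \<in> {L w..<R w}" "fold Kp bs q' \<in> {L w..<R w}"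
  shows "\<bar>q - q'\<bar> \<le> \<bar>fold Kp (bs @ [w]) q - fold Kp (bs @ [w]) q'\<bar> / 2"
  using assms
proof (induction bs arbitrary: w rule: rev_induct)
  case Nil
  then show ?case using Kp_expand_on_foot[of w q q'] by simp
next
  case (snoc v bs)
  let ?y = "fold Kp bs q" and ?y' = "fold Kp bs q'"
  have v: "v \<in> V" "?y \<in> model.orb v" "?y' \<in> model.orb v" and w: "w \<in> V"
    using snoc.prems by (auto simp: loc_append)
  have "w \<noteq> p v" using snoc.prems(1) unfolding reduced_def by auto
  then have y: "?y \<in> {L v..<R v}" "?y' \<in> {L v..<R v}"
    using Kp_off_foot(2)[OF v(1)] v w snoc.prems(4,5) feet_eq[OF w p_in[OF v(1)]] by fastforce+
  have "reduced (bs @ [v])" using reduced_infix[of "[]" "bs @ [v]" "[w]"] snoc.prems(1) by simp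
  moreover have "loc (bs @ [v]) q" "loc (bs @ [v]) q'" using snoc.prems(2,3) by (auto simp: loc_append)
  ultimately have "\<bar>q - q'\<bar> \<le> \<bar>fold Kp (bs @ [v]) q - fold Kp (bs @ [v]) q'\<bar> / 2"
    using snoc.IH y by blast
  also have "\<dots> \<le> \<bar>fold Kp (bs @ [v]) q - fold Kp (bs @ [v]) q'\<bar>" by simp
  also have "\<bar>fold Kp (bs @ [v]) q - fold Kp (bs @ [v]) q'\<bar>
      \<le> \<bar>fold Kp ((bs @ [v]) @ [w]) q - fold Kp ((bs @ [v]) @ [w]) q'\<bar> / 2"
    using Kp_expand_on_foot[OF w snoc.prems(4,5)] by simp
  finally show ?case .
qed

text \<open>If the germ starts off the foot of the first letter, the whole word contracts; if it
  reaches the last letter on the foot of that letter, the whole word expands. Either contradicts the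
  identity at two points. The remaining case is a conjugate of a shorter word, whence the induction
  on length with the base point free.\<close>

lemma reduced_local_not_id:
  assumes "reduced bs" "bs \<noteq> []" "\<forall>\<^sub>F q in at_right P. loc bs q \<and> fold Kp bs q = q"
  shows False
  using assms
proof (induction "length bs" arbitrary: bs P rule: less_induct)
  case less
  obtain v cs where bs: "bs = v # cs" using less.prems(2) by (cases bs) auto
  obtain ds w where bs': "bs = ds @ [w]" using less.prems(2) by (cases bs rule: rev_cases) auto
  note ev = less.prems(3)
  have dsV: "set bs \<subseteq> V"
    using eventually_at_right_two[OF ev] loc_set by blast
  have v: "v \<in> V" using dsV unfolding bs by simp
  have w: "w \<in> V" and ds: "set ds \<subseteq> V" using dsV unfolding bs' by auto
  have foot: "(\<forall>\<^sub>F q in at_right u. q \<in> {L x..<R x}) \<or> (\<forall>\<^sub>F q in at_right u. q \<notin> {L x..<R x})" for u x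
  proof (cases "L x \<le> u \<and> u < R x")
    case True
    then have "\<forall>\<^sub>F q in at_right u. q \<in> {L x<..<R x}" using eventually_at_right_interval by blast
    then show ?thesis by (auto elim: eventually_mono)
  qed (use eventually_at_right_interval in blast)
  show False
  proof (cases "\<forall>\<^sub>F q in at_right P. q \<notin> {L v..<R v}")
    case True
    obtain q q' where q: "q \<noteq> q'" "loc bs q" "fold Kp bs q = q" "q \<notin> {L v..<R v}"
        "loc bs q'" "fold Kp bs q' = q'" "q' \<notin> {L v..<R v}"
      using eventually_at_right_two[OF eventually_conj[OF ev True]] by blast
    then have "\<bar>q - q'\<bar> \<le> \<bar>q - q'\<bar> / 2"
      using reduced_contracts[of v cs q q'] less.prems(1) unfolding bs by metis
    then show False using q(1) by simp
  next
    case False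
    then have ev1: "\<forall>\<^sub>F q in at_right P. q \<in> {L v..<R v}" using foot by blast
    have "(\<forall>\<^sub>F q in at_right P. fold Kp ds q \<in> {L w..<R w}) \<or> (\<forall>\<^sub>F q in at_right P. fold Kp ds q \<notin> {L w..<R w})"
      using foot[where u="fold Kp ds P" and x=w] homeo_plus_eventually_at_right[OF fold_Kp_homeo[OF ds]] by blast
    then show False
    proof
      assume "\<forall>\<^sub>F q in at_right P. fold Kp ds q \<in> {L w..<R w}"
      then obtain q q' where q: "q \<noteq> q'" "loc bs q" "fold Kp bs q = q" "fold Kp ds q \<in> {L w..<R w}"
          "loc bs q'" "fold Kp bs q' = q'" "fold Kp ds q' \<in> {L w..<R w}"
        using eventually_at_right_two[OF eventually_conj[OF ev]] by blast
      then have "\<bar>q - q'\<bar> \<le> \<bar>q - q'\<bar> / 2"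
        using reduced_expands[of ds w q q'] less.prems(1) unfolding bs' by metis
      then show False using q(1) by simp
    next
      \<comment> \<open>The last letter \<open>w\<close> is applied off its foot, so the image,
        which is \<open>q\<close> itself, lies in the foot of \<open>p w\<close>; it also lies in
        the foot of \<open>v\<close>. Hence \<open>w = p v\<close>, and the middle part
        \<open>ms\<close> is the identity just to the right of \<open>Kp v P\<close>.\<close>
      assume ev2: "\<forall>\<^sub>F q in at_right P. fold Kp ds q \<notin> {L w..<R w}"
      obtain q where q: "loc bs q" "fold Kp bs q = q" "q \<in> {L v..<R v}" "fold Kp ds q \<notin> {L w..<R w}"
        using eventually_at_right_two[OF eventually_conj[OF ev eventually_conj[OF ev1 ev2]]] by blast
      then have "Kp w (fold Kp ds q) \<in> {L (p w)..<R (p w)}"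
        using Kp_off_foot(2)[OF w, of "fold Kp ds q"] unfolding bs' by (auto simp: loc_append)
      then have "q \<in> {L (p w)..<R (p w)}" using q(2) unfolding bs' by simp
      then have "v = p w" using feet_eq[OF v p_in[OF w] q(3)] by blast
      then have wv: "w = p v" using p_p w by simp
      obtain ms where ms: "bs = v # ms @ [p v]"
        using bs bs' wv p_ne[OF v] by (cases ds) auto
      have "ms \<noteq> []" using less.prems(1) ms reduced_Cons_Cons[of v "p v" "[]"] by auto
      moreover have "reduced ms" using reduced_infix[of "[v]" ms "[p v]"] less.prems(1) ms by simp
      moreover have "\<forall>\<^sub>F u in at_right (Kp v P). loc ms u \<and> fold Kp ms u = u"
      proof -
        have "\<forall>\<^sub>F q in at_right P. loc ms (Kp v q) \<and> fold Kp ms (Kp v q) = Kp v q"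
          using ev
        proof (rule eventually_mono)
          fix q assume "loc bs q \<and> fold Kp bs q = q"
          then have "loc ms (Kp v q)" "Kp (p v) (fold Kp ms (Kp v q)) = q"
            unfolding ms by (auto simp: loc_append)
          then show "loc ms (Kp v q) \<and> fold Kp ms (Kp v q) = Kp v q"
            using model.K_K_p[OF v] by metis
        qed
        then have "\<forall>\<^sub>F u in at_right (Kp v P).
            loc ms (Kp v (Kp (p v) u)) \<and> fold Kp ms (Kp v (Kp (p v) u)) = Kp v (Kp (p v) u)"
          using homeo_plus_eventually_at_right[OF model.K_homeo[OF p_in[OF v]], of _ "Kp v P"]
            model.K_p_K[OF v] by simp
        then show ?thesis using model.K_K_p[OF v] by simp
      qed
      ultimately show False using less.hyps[of ms "Kp v P"] ms by simp
    qed
  qed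
qed

end

section \<open>Transfer of words along the semiconjugacy\<close>

lemma (in fast_realization) fold_K_cancel:
  "v \<in> V \<Longrightarrow> fold K (cs @ v # p v # ds) z = fold K (cs @ ds) z"
  by (simp add: K_p_K)

locale semiconjugated = fast_realization V lt p E lab l r K g
  for V :: "'v set" and lt :: "'v \<Rightarrow> 'v \<Rightarrow> bool" and p :: "'v \<Rightarrow> 'v"
    and E :: "('v \<times> 'v) set" and lab :: "'v \<times> 'v \<Rightarrow> 'l"
    and l r :: "'v \<Rightarrow> real" and K :: "'v \<Rightarrow> real \<Rightarrow> real" and g :: "'l \<Rightarrow> real \<Rightarrow> real" +
  fixes \<theta> :: "real \<Rightarrow> real"
  assumes th_cont: "continuous_on {0..1} \<theta>" and th_mono: "mono_on {0..1} \<theta>"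
    and th_surj: "\<theta> ` {0..1} = {0..1}"
    and th_K: "v \<in> V \<Longrightarrow> z \<in> {0..1} \<Longrightarrow> \<theta> (K v z) = Kp v (\<theta> z)"
    and th_orb: "v \<in> V \<Longrightarrow> z \<in> {0..1} \<Longrightarrow> \<theta> z \<in> model.orb v \<longleftrightarrow> z \<in> orb v"
begin

text \<open>The graph of the isomorphism, built letter by letter because an element of the group has
  many words. That it is a function and injective is shown afterwards in \<open>rel_fun\<close> and
  \<open>rel_inj\<close>.\<close>

inductive rel :: "(real \<Rightarrow> real) \<Rightarrow> (real \<Rightarrow> real) \<Rightarrow> bool" where
  rel_id: "rel id id"
| rel_g: "rel f f' \<Longrightarrow> lb \<in> lab ` E \<Longrightarrow> rel (g lb \<circ> f) (gp lb \<circ> f')"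
| rel_inv_g: "rel f f' \<Longrightarrow> lb \<in> lab ` E \<Longrightarrow> rel (inv (g lb) \<circ> f) (inv (gp lb) \<circ> f')"

lemma rel_homeo: "rel f f' \<Longrightarrow> homeo_plus f \<and> homeo_plus f'"
proof (induction rule: rel.induct)
  case rel_id
  then show ?case using homeo_plus_id by (simp add: id_def)
next
  case (rel_g f f' lb)
  then show ?case
    using homeo_plus_comp[of f "g lb"] homeo_plus_comp[of f' "gp lb"] g_homeo model.g_homeo
    by (simp add: comp_def)
next
  case (rel_inv_g f f' lb)
  then show ?case
    using homeo_plus_comp[of f "inv (g lb)"] homeo_plus_comp[of f' "inv (gp lb)"] g_homeo model.g_homeo
    by (simp add: comp_def homeo_plus_inv)
qed

lemma rel_base: "lb \<in> lab ` E \<Longrightarrow> rel (g lb) (gp lb)" "lb \<in> lab ` E \<Longrightarrow> rel (inv (g lb)) (inv (gp lb))"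
  using rel_g[OF rel_id] rel_inv_g[OF rel_id] by auto

lemma rel_comp: "rel h h' \<Longrightarrow> rel f f' \<Longrightarrow> rel (h \<circ> f) (h' \<circ> f')"
  by (induction rule: rel.induct) (auto simp: comp_assoc intro: rel.intros)

lemma rel_inv: "rel f f' \<Longrightarrow> rel (inv f) (inv f')"
proof (induction rule: rel.induct)
  case rel_id
  then show ?case using rel.rel_id inv_id by (simp add: id_def)
next
  case (rel_g f f' lb)
  have "rel (inv (g lb \<circ> f)) (inv (gp lb \<circ> f'))"
    using rel_comp[OF rel_g.IH rel_base(2)[OF rel_g.hyps(2)]] rel_homeo[OF rel_g.hyps(1)]
      g_homeo[OF rel_g.hyps(2)] model.g_homeo[OF rel_g.hyps(2)] by (simp add: homeo_plus_inv_comp)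
  then show ?case by (simp add: comp_def)
next
  case (rel_inv_g f f' lb)
  have "rel (inv (inv (g lb) \<circ> f)) (inv (inv (gp lb) \<circ> f'))"
    using rel_comp[OF rel_inv_g.IH rel_base(1)[OF rel_inv_g.hyps(2)]] rel_homeo[OF rel_inv_g.hyps(1)]
      g_homeo[OF rel_inv_g.hyps(2)] model.g_homeo[OF rel_inv_g.hyps(2)]
    by (simp add: homeo_plus_inv_comp homeo_plus_inv homeo_plus_inv_inv)
  then show ?case by (simp add: comp_def)
qed

lemma th_g:
  assumes "lb \<in> lab ` E" "z \<in> {0..1}"
  shows "\<theta> (g lb z) = gp lb (\<theta> z)" "\<theta> (inv (g lb) z) = inv (gp lb) (\<theta> z)"
proof -
  have "\<theta> (g lb z) = gp lb (\<theta> z) \<and> \<theta> (inv (g lb) z) = inv (gp lb) (\<theta> z)"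
  proof (cases "\<exists>e\<in>E. lab e = lb \<and> z \<in> orb (fst e)")
    case True
    then obtain e where e: "e \<in> E" "lab e = lb" "z \<in> orb (fst e)" by blast
    then have V: "fst e \<in> V" "snd e \<in> V" using E_edge p_in by auto
    have "\<theta> z \<in> model.orb (fst e)" using th_orb V e assms by blast
    then show ?thesis
      using g_on_orb[of e z] inv_g_on_orb[of e z] model.g_on_orb[of e "\<theta> z"] model.inv_g_on_orb[of e "\<theta> z"]
        th_K V e assms(2) by auto
  next
    case False
    then have 1: "\<And>e. e \<in> E \<Longrightarrow> lab e = lb \<Longrightarrow> z \<notin> orb (fst e)" by blast
    then have 2: "\<And>e. e \<in> E \<Longrightarrow> lab e = lb \<Longrightarrow> \<theta> z \<notin> model.orb (fst e)"
      using th_orb E_edge assms(2) by metis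
    show ?thesis
      using g_off_orb[OF assms(1) 1] inv_g_off_orb[OF assms(1) 1] model.g_off_orb[OF assms(1) 2]
        model.inv_g_off_orb[OF assms(1) 2] by simp
  qed
  then show "\<theta> (g lb z) = gp lb (\<theta> z)" "\<theta> (inv (g lb) z) = inv (gp lb) (\<theta> z)" by auto
qed

lemma rel_th: "rel f f' \<Longrightarrow> z \<in> {0..1} \<Longrightarrow> \<theta> (f z) = f' (\<theta> z)"
proof (induction rule: rel.induct)
  case (rel_g f f' lb)
  then show ?case using th_g(1)[of lb "f z"] homeo_plus_in_unit[of f z] rel_homeo[of f f'] by simp
next
  case (rel_inv_g f f' lb)
  then show ?case using th_g(2)[of lb "f z"] homeo_plus_in_unit[of f z] rel_homeo[of f f'] by simp
qed auto

text \<open>Stated for an arbitrary pair \<open>c\<close>, \<open>c'\<close> to serve a generator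
  (\<open>ve\<close> is \<open>fst\<close>) and its inverse (\<open>ve\<close> is
  \<open>snd\<close>). The right germ of the model at \<open>\<theta> y\<close> selects the letter,
  and the same letter has to be correct at \<open>y\<close>.\<close>

lemma rel_letter_local:
  assumes y: "y \<in> {0..1}" and lb: "lb \<in> lab ` E"
    and on: "\<And>e q. e \<in> E \<Longrightarrow> lab e = lb \<Longrightarrow> q \<in> orb (fst e) \<Longrightarrow> c q = K (ve e) q"
    and off: "\<And>q. (\<And>e. e \<in> E \<Longrightarrow> lab e = lb \<Longrightarrow> q \<notin> orb (fst e)) \<Longrightarrow> c q = q"
    and on': "\<And>e q. e \<in> E \<Longrightarrow> lab e = lb \<Longrightarrow> q \<in> model.orb (fst e) \<Longrightarrow> c' q = Kp (ve e) q"
    and off': "\<And>q. (\<And>e. e \<in> E \<Longrightarrow> lab e = lb \<Longrightarrow> q \<notin> model.orb (fst e)) \<Longrightarrow> c' q = q"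
    and ve: "\<And>e. e \<in> E \<Longrightarrow> ve e \<in> V \<and> orb (ve e) = orb (fst e) \<and> model.orb (ve e) = model.orb (fst e)"
  shows "\<exists>bs. set bs \<subseteq> V \<and> c y = fold K bs y \<and> (\<forall>\<^sub>F q in at_right (\<theta> y). c' q = fold Kp bs q \<and> loc bs q)"
proof (cases "\<exists>e\<in>E. lab e = lb \<and> L (lo (fst e)) \<le> \<theta> y \<and> \<theta> y < R (hi (fst e))")
  case True
  then obtain e where e: "e \<in> E" "lab e = lb" "L (lo (fst e)) \<le> \<theta> y" "\<theta> y < R (hi (fst e))" by blast
  have ev: "\<forall>\<^sub>F q in at_right (\<theta> y). q \<in> model.orb (fst e)"
    unfolding model.orb_def using e eventually_at_right_interval by blast
  have "c y = K (ve e) y"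
  \<comment> \<open>The germ may see an orbital that starts at \<open>\<theta> y\<close> while
    \<open>y\<close> lies outside it. The letter then fixes \<open>y\<close>, and so does
    \<open>c\<close>: another orbital of the label around \<open>y\<close> would meet the same
    germ.\<close>
  proof (cases "y \<in> orb (fst e)")
    case False
    have "y \<notin> orb (fst e')" if e': "e' \<in> E" "lab e' = lb" for e'
    proof
      assume y': "y \<in> orb (fst e')"
      then have "e' \<noteq> e" using False by auto
      have "\<theta> y \<in> model.orb (fst e')" using th_orb y y' e' E_edge by blast
      then have "\<forall>\<^sub>F q in at_right (\<theta> y). q \<in> model.orb (fst e')"
        unfolding model.orb_def using eventually_at_right_interval[of "L (lo (fst e'))" "\<theta> y"] by auto
      then obtain q where "q \<in> model.orb (fst e)" "q \<in> model.orb (fst e')"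
        using eventually_at_right_two[OF eventually_conj[OF ev]] by blast
      then show False using model.orbs_disjoint[of e e'] e e' \<open>e' \<noteq> e\<close> by auto
    qed
    then have "c y = y" using off by blast
    moreover have "K (ve e) y = y" using K_neq_iff[of "ve e" y] ve[OF e(1)] False by blast
    ultimately show ?thesis by simp
  qed (use on e in auto)
  moreover have "\<forall>\<^sub>F q in at_right (\<theta> y). c' q = fold Kp [ve e] q \<and> loc [ve e] q"
    using ev by (rule eventually_mono) (use on' ve e in auto)
  ultimately show ?thesis using ve[OF e(1)] by (intro exI[of _ "[ve e]"]) auto
next
  case False
  have "\<forall>\<^sub>F q in at_right (\<theta> y). \<forall>e\<in>{e\<in>E. lab e = lb}. q \<notin> model.orb (fst e)"
  proof (rule eventually_ball_finite)
    show "\<forall>e\<in>{e\<in>E. lab e = lb}. \<forall>\<^sub>F q in at_right (\<theta> y). q \<notin> model.orb (fst e)"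
    proof
      fix e assume "e \<in> {e\<in>E. lab e = lb}"
      then have "\<forall>\<^sub>F q in at_right (\<theta> y). q \<notin> {L (lo (fst e))..<R (hi (fst e))}"
        using False eventually_at_right_interval by blast
      then show "\<forall>\<^sub>F q in at_right (\<theta> y). q \<notin> model.orb (fst e)"
        by (rule eventually_mono) (auto simp: model.orb_def)
    qed
  qed (use finE in simp)
  then have "\<forall>\<^sub>F q in at_right (\<theta> y). c' q = q"
    by (rule eventually_mono) (use off' in blast)
  moreover have "y \<notin> orb (fst e)" if "e \<in> E" "lab e = lb" for e
    using False that th_orb[of "fst e" y] y E_edge by (auto simp: model.orb_def less_imp_le)
  then have "c y = y" using off by blast
  ultimately show ?thesis by (intro exI[of _ "[]"]) auto
qed

text \<open>Words concatenate because \<open>f'\<close> carries the right germ at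
  \<open>\<theta> z\<close> to the right germ at \<open>f' (\<theta> z)\<close>, which is
  \<open>\<theta> (f z)\<close>.\<close>

lemma local_word_comp:
  assumes f': "homeo_plus f'" "\<theta> (f z) = f' (\<theta> z)"
    and "set bs \<subseteq> V" "f z = fold K bs z" "\<forall>\<^sub>F q in at_right (\<theta> z). f' q = fold Kp bs q \<and> loc bs q"
    and "set cs \<subseteq> V" "c (f z) = fold K cs (f z)"
      "\<forall>\<^sub>F q in at_right (\<theta> (f z)). c' q = fold Kp cs q \<and> loc cs q"
  shows "\<exists>bs. set bs \<subseteq> V \<and> (c \<circ> f) z = fold K bs z \<and>
    (\<forall>\<^sub>F q in at_right (\<theta> z). (c' \<circ> f') q = fold Kp bs q \<and> loc bs q)"
proof (intro exI[of _ "bs @ cs"] conjI)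
  have "\<forall>\<^sub>F q in at_right (\<theta> z). c' (f' q) = fold Kp cs (f' q) \<and> loc cs (f' q)"
    using homeo_plus_eventually_at_right[OF f'(1)] assms(8) f'(2) by simp
  with assms(5) show "\<forall>\<^sub>F q in at_right (\<theta> z). (c' \<circ> f') q = fold Kp (bs @ cs) q \<and> loc (bs @ cs) q"
    by eventually_elim (auto simp: loc_append)
qed (use assms in auto)

lemma rel_local:
  "rel f f' \<Longrightarrow> z \<in> {0..1} \<Longrightarrow>
    \<exists>bs. set bs \<subseteq> V \<and> f z = fold K bs z \<and> (\<forall>\<^sub>F q in at_right (\<theta> z). f' q = fold Kp bs q \<and> loc bs q)"
proof (induction rule: rel.induct)
  case rel_id
  show ?case by (intro exI[of _ "[]"]) auto
next
  case (rel_g f f' lb)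
  have fz: "f z \<in> {0..1}" "homeo_plus f'" "\<theta> (f z) = f' (\<theta> z)"
    using rel_g homeo_plus_in_unit rel_homeo rel_th by blast+
  have "\<exists>bs. set bs \<subseteq> V \<and> g lb (f z) = fold K bs (f z) \<and>
      (\<forall>\<^sub>F q in at_right (\<theta> (f z)). gp lb q = fold Kp bs q \<and> loc bs q)"
  proof (rule rel_letter_local[OF fz(1) rel_g.hyps(2), where ve=fst])
    show "g lb q = K (fst e) q" if "e \<in> E" "lab e = lb" "q \<in> orb (fst e)" for e q
      using that g_on_orb by blast
    show "gp lb q = Kp (fst e) q" if "e \<in> E" "lab e = lb" "q \<in> model.orb (fst e)" for e q
      using that model.g_on_orb by blast
  qed (use g_off_orb[OF rel_g.hyps(2)] model.g_off_orb[OF rel_g.hyps(2)] E_edge in blast)+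
  then show ?case using local_word_comp[where f=f and z=z, OF fz(2,3)] rel_g.IH[OF rel_g.prems] by blast
next
  case (rel_inv_g f f' lb)
  have fz: "f z \<in> {0..1}" "homeo_plus f'" "\<theta> (f z) = f' (\<theta> z)"
    using rel_inv_g homeo_plus_in_unit rel_homeo rel_th by blast+
  have "\<exists>bs. set bs \<subseteq> V \<and> inv (g lb) (f z) = fold K bs (f z) \<and>
      (\<forall>\<^sub>F q in at_right (\<theta> (f z)). inv (gp lb) q = fold Kp bs q \<and> loc bs q)"
  proof (rule rel_letter_local[OF fz(1) rel_inv_g.hyps(2), where ve=snd])
    show "inv (g lb) q = K (snd e) q" if "e \<in> E" "lab e = lb" "q \<in> orb (fst e)" for e q
      using that inv_g_on_orb by blast
    show "inv (gp lb) q = Kp (snd e) q" if "e \<in> E" "lab e = lb" "q \<in> model.orb (fst e)" for e q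
      using that model.inv_g_on_orb by blast
    show "snd e \<in> V \<and> orb (snd e) = orb (fst e) \<and> model.orb (snd e) = model.orb (fst e)" if "e \<in> E" for e
      using E_edge[OF that] p_in orb_p model.orb_p by simp
  qed (use inv_g_off_orb[OF rel_inv_g.hyps(2)] model.inv_g_off_orb[OF rel_inv_g.hyps(2)] in blast)+
  then show ?case using local_word_comp[where f=f and z=z, OF fz(2,3)] rel_inv_g.IH[OF rel_inv_g.prems] by blast
qed

lemma rel_id_imp_id:
  assumes "rel f id" shows "f = id"
proof
  fix z
  show "f z = id z"
  proof (cases "z \<in> {0..1}")
    case False
    then show ?thesis using rel_homeo[OF assms] homeo_plus_outside[of f z] by auto
  next
    case True
    \<comment> \<open>\<open>Q\<close> ties the action at \<open>z\<close> and the germ in the model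
      to one and the same word. Deleting an inverse pair preserves both, so a shortest such word is
      reduced and by ping-pong empty.\<close>
    define Q where "Q bs \<longleftrightarrow> set bs \<subseteq> V \<and> f z = fold K bs z \<and>
      (\<forall>\<^sub>F q in at_right (\<theta> z). loc bs q \<and> fold Kp bs q = q)" for bs
    obtain bs0 where bs0: "set bs0 \<subseteq> V" "f z = fold K bs0 z"
        "\<forall>\<^sub>F q in at_right (\<theta> z). id q = fold Kp bs0 q \<and> loc bs0 q"
      using rel_local[OF assms True] by blast
    have "Q bs0"
      unfolding Q_def using bs0(1,2) eventually_mono[OF bs0(3), of "\<lambda>q. loc bs0 q \<and> fold Kp bs0 q = q"] by simp
    then obtain bs where bs: "Q bs" "\<And>cs. Q cs \<Longrightarrow> length bs \<le> length cs"
      using ex_has_least_nat[of Q bs0 length] by blast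
    have "reduced bs"
      unfolding reduced_def
    proof (intro allI notI)
      fix cs v ds assume eq: "bs = cs @ v # p v # ds"
      have v: "v \<in> V" using bs(1) eq by (simp add: Q_def)
      have "\<forall>\<^sub>F q in at_right (\<theta> z). loc bs q \<and> fold Kp bs q = q" using bs(1) by (simp add: Q_def)
      then have "\<forall>\<^sub>F q in at_right (\<theta> z). loc (cs @ ds) q \<and> fold Kp (cs @ ds) q = q"
        by (rule eventually_mono) (auto simp: eq loc_append model.K_p_K[OF v])
      then have "Q (cs @ ds)"
        using bs(1) fold_K_cancel[OF v, of cs ds z] unfolding Q_def eq by auto
      then show False using bs(2)[of "cs @ ds"] eq by simp
    qed
    then have "bs = []" using reduced_local_not_id[of bs "\<theta> z"] bs(1) unfolding Q_def by blast
    then show ?thesis using bs(1) by (simp add: Q_def)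
  qed
qed

end

section \<open>The marked isomorphism\<close>

lemma (in diagram_pairing) gp_inj:
  assumes "lb \<in> lab ` E" "lb' \<in> lab ` E" "gp lb = gp lb'"
  shows "lb = lb'"
proof -
  have "left_tp (gp lb) (Inf (supt (gp lb)))" "left_tp (gp lb') (Inf (supt (gp lb)))"
    using least_tp_eq_Inf_supt(2)[OF model.g_homeo[OF assms(1)] model.g_neq_id[OF assms(1)]] assms(3) by auto
  then obtain e e' where e: "e \<in> E" "lab e = lb" "e' \<in> E" "lab e' = lb'" "L (lo (fst e)) = L (lo (fst e'))"
    using left_tp_gp assms(1,2) by metis
  then have "lo (fst e) = lo (fst e')" using L_inj lo_in E_edge by metis
  then show ?thesis using edges_same_lo e by metis
qed

context semiconjugated
begin

text \<open>Since \<open>\<theta>\<close> is onto, the equation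
  \<open>\<theta> (f z) = f' (\<theta> z)\<close> determines \<open>f'\<close> on the unit
  interval.\<close>

lemma rel_fun:
  assumes "rel f f'" "rel f f''" shows "f' = f''"
proof
  fix q
  show "f' q = f'' q"
  proof (cases "q \<in> {0..1}")
    case True
    then obtain z where "z \<in> {0..1}" "q = \<theta> z" using th_surj by blast
    then show ?thesis using rel_th[OF assms(1)] rel_th[OF assms(2)] by metis
  next
    case False
    then show ?thesis using rel_homeo[OF assms(1)] rel_homeo[OF assms(2)] homeo_plus_outside[of f' q]
        homeo_plus_outside[of f'' q] by auto
  qed
qed

lemma rel_inj:
  assumes "rel f f'" "rel h f'" shows "f = h"
proof -
  have hh: "homeo_plus f'" "homeo_plus h" using rel_homeo assms by auto
  have "rel (inv h \<circ> f) id"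
    using rel_comp[OF rel_inv[OF assms(2)] assms(1)] homeo_plus_inv_comp_self(1)[OF hh(1)] by simp
  then have "inv h (f z) = z" for z using rel_id_imp_id by (metis comp_apply id_apply)
  then show ?thesis using homeo_plus_f_inv[OF hh(2)] by (metis ext)
qed

lemma rel_total:
  assumes X: "X - {id} = g ` lab ` E" and f: "f \<in> gen_group X"
  shows "\<exists>f'\<in>gen_group XD. rel f f'"
  using f
proof induction
  case gen_id
  show ?case using gen_group.gen_id rel_id by blast
next
  case (gen_base f)
  show ?case
  proof (cases "f = id")
    case True
    then show ?thesis using gen_group.gen_id rel_id by blast
  next
    case False
    then obtain lb where "lb \<in> lab ` E" "f = g lb" using gen_base X by blast
    then show ?thesis using rel_base gen_group.gen_base[of "gp lb" XD] by (auto simp: XD_def)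
  qed
qed (blast intro: gen_group.gen_mult gen_group.gen_inv rel_comp rel_inv)+

lemma rel_surj:
  assumes X: "X - {id} = g ` lab ` E" and f: "f' \<in> gen_group XD"
  shows "\<exists>f\<in>gen_group X. rel f f'"
  using f
proof induction
  case gen_id
  show ?case using gen_group.gen_id rel_id by blast
next
  case (gen_base f')
  then obtain lb where lb: "lb \<in> lab ` E" "f' = gp lb" by (auto simp: XD_def)
  then have "g lb \<in> X" using X by blast
  then show ?case using rel_base lb gen_group.gen_base by blast
qed (blast intro: gen_group.gen_mult gen_group.gen_inv rel_comp rel_inv)+

text \<open>By \<open>th_orb\<close> the support of \<open>g lb\<close> is the preimage under
  \<open>\<theta>\<close> of the support of \<open>gp lb\<close>; monotonicity relates the
  infima.\<close>

lemma th_Inf_supt: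
  assumes lb: "lb \<in> lab ` E"
  shows "\<theta> (Inf (supt (g lb))) = Inf (supt (gp lb))" "Inf (supt (g lb)) \<in> {0..1}"
proof -
  let ?S = "supt (g lb)" and ?S' = "supt (gp lb)"
  have tp: "left_tp (g lb) (Inf ?S)" "left_tp (gp lb) (Inf ?S')"
    using least_tp_eq_Inf_supt(2) g_homeo g_neq_id model.g_homeo model.g_neq_id lb by auto
  then show unit: "Inf ?S \<in> {0..1}" by (simp add: left_tp_def)
  have iff: "\<theta> z \<in> ?S' \<longleftrightarrow> z \<in> ?S" if "z \<in> {0..1}" for z
    using supt_g[OF lb] model.supt_g[OF lb] th_orb that E_edge by auto
  have ne: "?S \<noteq> {}" "?S' \<noteq> {}"
    using supt_empty_iff g_homeo g_neq_id model.g_homeo model.g_neq_id lb by blast+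
  have bd: "bdd_below ?S" "bdd_below ?S'" by (auto intro!: bdd_belowI[of _ 0] simp: supt_def)
  have unitS: "z \<in> {0..1}" if "z \<in> ?S" for z using that by (simp add: supt_def)
  have unitS': "z \<in> {0..1}" if "z \<in> ?S'" for z using that by (simp add: supt_def)
  have "\<theta> (Inf ?S) \<le> Inf ?S'"
  proof (rule cInf_greatest[OF ne(2)])
    fix q assume q: "q \<in> ?S'"
    then obtain z where z: "z \<in> {0..1}" "q = \<theta> z" using unitS' th_surj by blast
    then have "z \<in> ?S" using iff q by blast
    then have "Inf ?S \<le> z" using bd by (intro cInf_lower)
    then show "\<theta> (Inf ?S) \<le> q" using th_mono unit z by (auto simp: mono_on_def)
  qed
  \<comment> \<open>Otherwise a preimage \<open>z\<close> of \<open>Inf ?S'\<close> has a point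
    \<open>s\<close> of \<open>?S\<close> to its left. Then \<open>\<theta> s\<close> is squeezed to
    \<open>Inf ?S'\<close>, which would put this transition point into the support.\<close>
  moreover have "Inf ?S' \<le> \<theta> (Inf ?S)"
  proof (rule ccontr)
    assume "\<not> Inf ?S' \<le> \<theta> (Inf ?S)"
    moreover have "Inf ?S' \<in> {0..1}" using tp(2) by (simp add: left_tp_def)
    ultimately obtain z where z: "z \<in> {0..1}" "Inf ?S' = \<theta> z" using th_surj by blast
    have "Inf ?S < z"
      using z th_mono unit \<open>\<not> Inf ?S' \<le> \<theta> (Inf ?S)\<close> by (auto simp: mono_on_def not_less[symmetric])
    then obtain s where s: "s \<in> ?S" "s < z" using cInf_lessD[OF ne(1)] by blast
    then have "\<theta> s \<in> ?S'" using iff unitS by blast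
    then have "\<theta> z \<le> \<theta> s" using z bd by (metis cInf_lower)
    moreover have "\<theta> s \<le> \<theta> z" using th_mono s unitS z by (auto simp: mono_on_def)
    ultimately have "Inf ?S' \<in> ?S'" using z \<open>\<theta> s \<in> ?S'\<close> by simp
    then show False using tp(2) by (simp add: left_tp_def)
  qed
  ultimately show "\<theta> (Inf ?S) = Inf ?S'" by simp
qed

text \<open>\<open>\<theta>\<close> is only weakly monotone, so strictness has to come from
  elsewhere: equal images would be a common left transition point of two elements of
  \<open>XD\<close>, and properness makes these elements equal.\<close>

lemma least_tp_less_iff:
  assumes lb: "lb \<in> lab ` E" "lb' \<in> lab ` E"
  shows "least_tp (g lb) < least_tp (g lb') \<longleftrightarrow> least_tp (gp lb) < least_tp (gp lb')"
proof -
  let ?a = "Inf (supt (g lb))" and ?b = "Inf (supt (g lb'))"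
  have eq: "least_tp (g lb) = ?a" "least_tp (g lb') = ?b" "least_tp (gp lb) = \<theta> ?a" "least_tp (gp lb') = \<theta> ?b"
    using lb least_tp_eq_Inf_supt(1) g_homeo g_neq_id model.g_homeo model.g_neq_id th_Inf_supt by auto
  have mono: "\<theta> u \<le> \<theta> w" if "u \<in> {0..1}" "w \<in> {0..1}" "u \<le> w" for u w
    using th_mono that by (auto simp: mono_on_def)
  have ab: "?a \<in> {0..1}" "?b \<in> {0..1}" using th_Inf_supt lb by auto
  have "?a = ?b" if "\<theta> ?a = \<theta> ?b"
  proof -
    have "left_tp (gp lb) (\<theta> ?a)" "left_tp (gp lb') (\<theta> ?a)"
      using least_tp_eq_Inf_supt(2)[OF model.g_homeo model.g_neq_id] lb th_Inf_supt(1) that by simp_all metis+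
    then have "gp lb = gp lb'" using XD_proper lb unfolding geom_proper_def XD_def by blast
    then show ?thesis using gp_inj[OF lb] by simp
  qed
  then show ?thesis unfolding eq using mono[OF ab] mono[OF ab(2,1)] by fastforce
qed

theorem ex_marked_iso:
  assumes X: "X - {id} = g ` lab ` E"
  shows "\<exists>\<phi>. marked_iso X XD \<phi> \<and> (\<forall>f\<in>gen_group X. \<forall>x\<in>{0..1}. \<theta> (f x) = \<phi> f (\<theta> x))"
proof -
  define \<phi> where "\<phi> f = (THE f'. rel f f')" for f
  have ph: "\<phi> f = f'" if "rel f f'" for f f'
    unfolding \<phi>_def using that rel_fun by (intro the_equality) auto
  have rph: "rel f (\<phi> f)" "\<phi> f \<in> gen_group XD" if f: "f \<in> gen_group X" for f
    using rel_total[OF X f] ph by auto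
  have idn: "XD - {id} = gp ` lab ` E" using model.g_neq_id by (auto simp: XD_def)
  have phg: "\<phi> (g lb) = gp lb" if "lb \<in> lab ` E" for lb using ph rel_base that by blast
  have "bij_betw \<phi> (gen_group X) (gen_group XD)"
    unfolding bij_betw_def
  proof
    show "inj_on \<phi> (gen_group X)"
      using rph(1) rel_inj by (intro inj_onI) metis
    show "\<phi> ` gen_group X = gen_group XD"
      using rph(2) rel_surj[OF X] ph by (force simp: image_iff)
  qed
  moreover have "\<phi> (h \<circ> f) = \<phi> h \<circ> \<phi> f" if "f \<in> gen_group X" "h \<in> gen_group X" for f h
    using ph rel_comp rph(1) that by blast
  moreover have "bij_betw \<phi> (X - {id}) (XD - {id})"
    unfolding bij_betw_def X idn
  proof
    show "inj_on \<phi> (g ` lab ` E)"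
      using phg rel_base(1) rel_inj by (intro inj_onI) (metis imageE)
    show "\<phi> ` g ` lab ` E = gp ` lab ` E"
      using phg by (force simp: image_iff)
  qed
  moreover have "least_tp f < least_tp h \<longleftrightarrow> least_tp (\<phi> f) < least_tp (\<phi> h)"
    if "f \<in> X - {id}" "h \<in> X - {id}" for f h
    using that least_tp_less_iff phg unfolding X by (metis imageE)
  ultimately have "marked_iso X XD \<phi>" unfolding marked_iso_def by blast
  moreover have "\<theta> (f x) = \<phi> f (\<theta> x)" if "f \<in> gen_group X" "x \<in> {0..1}" for f x
    using rel_th[OF rph(1)] that by blast
  ultimately show ?thesis by blast
qed

end

theorem (in fast_realization) ex_marked_semiconjugacy:
  assumes X: "X - {id} = g ` lab ` E"
  shows "\<exists>\<phi> \<theta>. marked_iso X XD \<phi> \<and>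
    continuous_on {0..1} \<theta> \<and> mono_on {0..1} \<theta> \<and> \<theta> ` {0..1} = {0..1} \<and>
    (\<forall>f\<in>gen_group X. \<forall>x\<in>{0..1}. \<theta> (f x) = \<phi> f (\<theta> x))"
proof -
  obtain \<theta> where th: "continuous_on {0..1} \<theta>" "mono_on {0..1} \<theta>" "\<theta> ` {0..1} = {0..1}"
    "\<forall>v\<in>V. \<forall>z\<in>{0..1}. \<theta> (K v z) = Kp v (\<theta> z)"
    "\<forall>v\<in>V. \<forall>z\<in>{0..1}. \<theta> z \<in> model.orb v \<longleftrightarrow> z \<in> orb v"
    using ex_semiconjugacy by blast
  interpret semiconjugated V lt p E lab l r K g \<theta>
    by unfold_locales (use th in auto)
  show ?thesis using ex_marked_iso[OF X] th by blast
qed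

section \<open>Realizations from geometrically fast sets\<close>

definition partner :: "('v \<times> 'v) set \<Rightarrow> 'v \<Rightarrow> 'v" where
  "partner E v = (THE w. (v, w) \<in> E \<or> (w, v) \<in> E)"

text \<open>Total degree 1 means that one of the two counts is 1 and the other 0; a loop or a pair
  of opposite edges would contribute to both.\<close>

lemma dyn_diagram_partner:
  assumes dd: "dyn_diagram V lt E lab" and v: "v \<in> V"
  shows "\<exists>w. w \<in> V \<and> w \<noteq> v \<and> ((v, w) \<in> E \<and> (w, v) \<notin> E \<or> (w, v) \<in> E \<and> (v, w) \<notin> E) \<and>
    (\<forall>u. (v, u) \<in> E \<or> (u, v) \<in> E \<longrightarrow> u = w)"
proof -
  let ?A = "{e\<in>E. fst e = v}" and ?B = "{e\<in>E. snd e = v}"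
  have EV: "E \<subseteq> V \<times> V" and "finite V" and c: "card ?A + card ?B = 1"
    using dd v by (auto simp: dyn_diagram_def)
  then have "finite E" using finite_subset by blast
  then have fin: "finite ?A" "finite ?B" by auto
  from c consider "card ?A = 1" "card ?B = 0" | "card ?A = 0" "card ?B = 1" by linarith
  then show ?thesis
  proof cases
    case 1
    then obtain e where e: "?A = {e}" and B: "?B = {}" using fin by (auto simp: card_1_singleton_iff)
    then have e': "e \<in> E" "fst e = v" by blast+
    have "snd e \<noteq> v" using e' B by blast
    moreover have "snd e \<in> V" using e' EV by force
    moreover have "(v, snd e) \<in> E" using e' by (metis prod.collapse)
    moreover have "(u, v) \<notin> E" for u using B by force
    moreover have "u = snd e" if "(v, u) \<in> E" for u
    proof -
      have "(v, u) \<in> ?A" using that by simp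
      then show ?thesis using e by (metis singletonD snd_conv)
    qed
    ultimately show ?thesis by blast
  next
    case 2
    then obtain e where e: "?B = {e}" and A: "?A = {}" using fin by (auto simp: card_1_singleton_iff)
    then have e': "e \<in> E" "snd e = v" by blast+
    have "fst e \<noteq> v" using e' A by blast
    moreover have "fst e \<in> V" using e' EV by force
    moreover have "(fst e, v) \<in> E" using e' by (metis prod.collapse)
    moreover have "(v, u) \<notin> E" for u using A by force
    moreover have "u = fst e" if "(u, v) \<in> E" for u
    proof -
      have "(u, v) \<in> ?B" using that by simp
      then show ?thesis using e by (metis singletonD fst_conv)
    qed
    ultimately show ?thesis by blast
  qed
qed

lemma partner_eq:
  assumes dd: "dyn_diagram V lt E lab" and v: "v \<in> V" and w: "(v, w) \<in> E \<or> (w, v) \<in> E"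
  shows "partner E v = w"
  unfolding partner_def using w dyn_diagram_partner[OF dd v] by (intro the_equality) blast+

lemma partner_props:
  assumes dd: "dyn_diagram V lt E lab" and v: "v \<in> V"
  shows "partner E v \<in> V" "partner E v \<noteq> v" "partner E (partner E v) = v"
    "(v, partner E v) \<in> E \<or> (partner E v, v) \<in> E"
proof -
  obtain w where w: "w \<in> V" "w \<noteq> v" "(v, w) \<in> E \<or> (w, v) \<in> E"
    using dyn_diagram_partner[OF dd v] by blast
  then have "partner E v = w" "partner E w = v" using partner_eq[OF dd] v by blast+
  then show "partner E v \<in> V" "partner E v \<noteq> v" "partner E (partner E v) = v"
    "(v, partner E v) \<in> E \<or> (partner E v, v) \<in> E" using w by auto
qed

lemma dyn_diagram_asym:
  assumes dd: "dyn_diagram V lt E lab" and "(u, v) \<in> E" shows "(v, u) \<notin> E"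
proof -
  have "u \<in> V" using assms by (auto simp: dyn_diagram_def)
  then show ?thesis using dyn_diagram_partner[OF dd, of u] assms(2) by blast
qed

lemma open_intervals_order:
  fixes a b c d :: real
  assumes "a < b" "c < d" "\<And>u w. u \<in> {a<..<b} \<Longrightarrow> w \<in> {c<..<d} \<Longrightarrow> u < w"
  shows "b \<le> c"
proof (rule ccontr)
  assume "\<not> b \<le> c"
  then have "max a c < b" using assms by auto
  then obtain u where u: "max a c < u" "u < b" using dense by blast
  then have "c < min u d" using assms by auto
  then obtain w where "c < w" "w < min u d" using dense by blast
  then show False using assms(3)[of u w] u by auto
qed

section \<open>From an isomorphism of diagrams to a realization\<close>

locale diagram_of_set =
  fixes V :: "'v set" and lt :: "'v \<Rightarrow> 'v \<Rightarrow> bool"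
    and E :: "('v \<times> 'v) set" and lab :: "'v \<times> 'v \<Rightarrow> 'l"
    and X :: "(real \<Rightarrow> real) set" and m :: "(real \<Rightarrow> real) \<Rightarrow> real"
    and h :: "real set \<Rightarrow> 'v" and \<sigma> :: "(real \<Rightarrow> real) \<Rightarrow> 'l"
  assumes dd: "dyn_diagram V lt E lab" and V_ne: "V \<noteq> {}"
    and proper: "geom_proper X" and good: "good_marking (used_bumps X) m"
    and h_bij: "bij_betw h (diag_vertices X m) V"
    and h_lt: "\<And>F G. F \<in> diag_vertices X m \<Longrightarrow> G \<in> diag_vertices X m \<Longrightarrow> diag_lt F G \<longleftrightarrow> lt (h F) (h G)"
    and h_E: "\<And>F G. F \<in> diag_vertices X m \<Longrightarrow> G \<in> diag_vertices X m \<Longrightarrow> (F, G) \<in> diag_edges X m \<longleftrightarrow> (h F, h G) \<in> E"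
    and \<sigma>_bij: "bij_betw \<sigma> (diag_label X m ` diag_edges X m) (lab ` E)"
    and \<sigma>_lab: "\<And>e. e \<in> diag_edges X m \<Longrightarrow> lab (h (fst e), h (snd e)) = \<sigma> (diag_label X m e)"
begin

abbreviation "A \<equiv> used_bumps X"
abbreviation "p \<equiv> partner E"

definition s :: "(real \<Rightarrow> real) \<Rightarrow> 'v" where "s a = h (src_foot a (m a))"
definition d :: "(real \<Rightarrow> real) \<Rightarrow> 'v" where "d a = h (dest_foot a (m a))"

lemma X_homeo: "f \<in> X \<Longrightarrow> homeo_plus f"
  using proper by (auto simp: geom_proper_def)

lemma A_bump: "a \<in> A \<Longrightarrow> positive_bump a" "a \<in> A \<Longrightarrow> bump a" "a \<in> A \<Longrightarrow> homeo_plus a"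
  by (auto simp: used_bumps_def positive_bump_def bump_def)

lemma in_supt_iff: "a \<in> A \<Longrightarrow> q \<in> supt a \<longleftrightarrow> Inf (supt a) < q \<and> q < Sup (supt a)"
  using supt_bump(1)[OF A_bump(2)] by (metis greaterThanLessThan_iff)

lemma A_points:
  assumes a: "a \<in> A"
  shows "Inf (supt a) < m a" "m a < a (m a)" "a (m a) < Sup (supt a)"
proof -
  have ma: "m a \<in> supt a" using good a by (auto simp: good_marking_def)
  then show "Inf (supt a) < m a" using in_supt_iff[OF a] by blast
  show "m a < a (m a)" using A_bump(1)[OF a] ma by (auto simp: positive_bump_def)
  have "a (m a) \<in> supt a"
    using ma homeo_plus_eq[OF A_bump(3)[OF a]] by (auto simp: homeo_plus_supt[OF A_bump(3)[OF a]])
  then show "a (m a) < Sup (supt a)" using in_supt_iff[OF a] by blast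
qed

lemma src_in: "a \<in> A \<Longrightarrow> src_foot a (m a) \<in> diag_vertices X m"
  and dest_in: "a \<in> A \<Longrightarrow> dest_foot a (m a) \<in> diag_vertices X m"
  by (auto simp: diag_vertices_def)

lemma feet_ne:
  assumes "a \<in> A" shows "src_foot a (m a) \<noteq> {}" "dest_foot a (m a) \<noteq> {}"
  using A_points[OF assms] by (auto simp: src_foot_def dest_foot_def)

lemma src_inj: "a \<in> A \<Longrightarrow> b \<in> A \<Longrightarrow> src_foot a (m a) = src_foot b (m b) \<Longrightarrow> a = b"
  and dest_inj: "a \<in> A \<Longrightarrow> b \<in> A \<Longrightarrow> dest_foot a (m a) = dest_foot b (m b) \<Longrightarrow> a = b"
  and src_neq_dest: "a \<in> A \<Longrightarrow> b \<in> A \<Longrightarrow> src_foot a (m a) \<noteq> dest_foot b (m b)"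
proof -
  have g1: "src_foot a (m a) \<inter> dest_foot a (m a) = {}" if "a \<in> A" for a
    using good that by (auto simp: good_marking_def)
  have g2: "(src_foot a (m a) \<union> dest_foot a (m a)) \<inter> (src_foot b (m b) \<union> dest_foot b (m b)) = {}"
    if "a \<in> A" "b \<in> A" "a \<noteq> b" for a b
    using good that unfolding good_marking_def by blast
  assume ab: "a \<in> A" "b \<in> A"
  show "src_foot a (m a) = src_foot b (m b) \<Longrightarrow> a = b" using g2[OF ab] feet_ne[OF ab(1)] by blast
  show "dest_foot a (m a) = dest_foot b (m b) \<Longrightarrow> a = b" using g2[OF ab] feet_ne[OF ab(1)] by blast
  show "src_foot a (m a) \<noteq> dest_foot b (m b)" using g1[OF ab(1)] g2[OF ab] feet_ne[OF ab(1)] by blast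
qed

lemma h_inj: "F \<in> diag_vertices X m \<Longrightarrow> G \<in> diag_vertices X m \<Longrightarrow> h F = h G \<longleftrightarrow> F = G"
  using h_bij by (auto simp: bij_betw_def inj_on_def)

lemma s_inj: "a \<in> A \<Longrightarrow> b \<in> A \<Longrightarrow> s a = s b \<longleftrightarrow> a = b"
  and d_inj: "a \<in> A \<Longrightarrow> b \<in> A \<Longrightarrow> d a = d b \<longleftrightarrow> a = b"
  and s_neq_d: "a \<in> A \<Longrightarrow> b \<in> A \<Longrightarrow> s a \<noteq> d b" "a \<in> A \<Longrightarrow> b \<in> A \<Longrightarrow> d b \<noteq> s a"
  unfolding s_def d_def using h_inj src_in dest_in src_inj dest_inj src_neq_dest by metis+

lemma s_in: "a \<in> A \<Longrightarrow> s a \<in> V" and d_in: "a \<in> A \<Longrightarrow> d a \<in> V"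
  using h_bij src_in dest_in by (auto simp: s_def d_def bij_betw_def)

lemma V_cases:
  assumes "v \<in> V"
  obtains a where "a \<in> A" "v = s a" | a where "a \<in> A" "v = d a"
proof -
  have "v \<in> h ` diag_vertices X m" using assms h_bij by (simp add: bij_betw_def)
  then show ?thesis using that by (auto simp: diag_vertices_def s_def d_def)
qed

lemma edge_of_bump:
  assumes "a \<in> A" "f \<in> X" "agrees_on f a (supt a) \<or> agrees_on f (inv a) (supt a)"
  shows "(src_foot a (m a), dest_foot a (m a)) \<in> diag_edges X m \<or>
    (dest_foot a (m a), src_foot a (m a)) \<in> diag_edges X m"
  using assms by (auto simp: diag_edges_def sb_edge_def)

lemma bump_edge_E: "a \<in> A \<Longrightarrow> (s a, d a) \<in> E \<or> (d a, s a) \<in> E"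
proof -
  assume a: "a \<in> A"
  then obtain f where "f \<in> X" "agrees_on f a (supt a) \<or> agrees_on f (inv a) (supt a)"
    by (auto simp: used_bumps_def)
  then show ?thesis using edge_of_bump[OF a] h_E src_in[OF a] dest_in[OF a] by (auto simp: s_def d_def)
qed

lemma p_s: "a \<in> A \<Longrightarrow> p (s a) = d a" and p_d: "a \<in> A \<Longrightarrow> p (d a) = s a"
  using bump_edge_E partner_eq[OF dd] s_in d_in by blast+

lemma lt_s_d: "a \<in> A \<Longrightarrow> lt (s a) (d a)"
proof -
  assume a: "a \<in> A"
  have "diag_lt (src_foot a (m a)) (dest_foot a (m a))"
    unfolding diag_lt_def using src_neq_dest[OF a a] A_points[OF a] by (auto simp: src_foot_def dest_foot_def)
  then show ?thesis using h_lt src_in[OF a] dest_in[OF a] by (simp add: s_def d_def)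
qed

lemma lt_irrefl: "v \<in> V \<Longrightarrow> \<not> lt v v"
  and lt_trans: "u \<in> V \<Longrightarrow> v \<in> V \<Longrightarrow> w \<in> V \<Longrightarrow> lt u v \<Longrightarrow> lt v w \<Longrightarrow> lt u w"
  and lt_total: "u \<in> V \<Longrightarrow> v \<in> V \<Longrightarrow> u \<noteq> v \<Longrightarrow> lt u v \<or> lt v u"
  using dd unfolding dyn_diagram_def by blast+

lemma not_lt_d_s: "a \<in> A \<Longrightarrow> \<not> lt (d a) (s a)"
  using lt_s_d lt_trans[of "s a" "d a" "s a"] lt_irrefl[of "s a"] s_in d_in by blast

lemma ends_s: "a \<in> A \<Longrightarrow> lower_end lt p (s a) = s a" "a \<in> A \<Longrightarrow> upper_end lt p (s a) = d a"
  and ends_d: "a \<in> A \<Longrightarrow> lower_end lt p (d a) = s a" "a \<in> A \<Longrightarrow> upper_end lt p (d a) = d a"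
  using p_s p_d lt_s_d not_lt_d_s by (auto simp: lower_end_def upper_end_def)

definition bump_at :: "'v \<Rightarrow> real \<Rightarrow> real" where
  "bump_at v = (THE a. a \<in> A \<and> (v = s a \<or> v = d a))"

definition K :: "'v \<Rightarrow> real \<Rightarrow> real" where
  "K v = (if v = s (bump_at v) then bump_at v else inv (bump_at v))"

definition l :: "'v \<Rightarrow> real" where
  "l v = (if v = s (bump_at v) then Inf (supt (bump_at v)) else bump_at v (m (bump_at v)))"

definition r :: "'v \<Rightarrow> real" where
  "r v = (if v = s (bump_at v) then m (bump_at v) else Sup (supt (bump_at v)))"

text \<open>In the diagram of \<open>X\<close> the labels are the elements themselves, so inverting
  \<open>\<sigma>\<close> turns an abstract label back into an element of \<open>X\<close>.\<close>

definition g :: "'l \<Rightarrow> real \<Rightarrow> real" where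
  "g = inv_into (diag_label X m ` diag_edges X m) \<sigma>"

lemma bump_at: "a \<in> A \<Longrightarrow> bump_at (s a) = a" "a \<in> A \<Longrightarrow> bump_at (d a) = a"
  unfolding bump_at_def using s_inj d_inj s_neq_d by (auto intro!: the_equality)

lemma at_s: "a \<in> A \<Longrightarrow> K (s a) = a" "a \<in> A \<Longrightarrow> l (s a) = Inf (supt a)" "a \<in> A \<Longrightarrow> r (s a) = m a"
  by (auto simp: K_def l_def r_def bump_at)

lemma at_d: "a \<in> A \<Longrightarrow> K (d a) = inv a" "a \<in> A \<Longrightarrow> l (d a) = a (m a)" "a \<in> A \<Longrightarrow> r (d a) = Sup (supt a)"
  using s_neq_d by (auto simp: K_def l_def r_def bump_at)

lemma l_less_r: "v \<in> V \<Longrightarrow> l v < r v"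
  by (erule V_cases) (auto simp: at_s at_d A_points)

text \<open>Only the open interval is common to both kinds of feet: a source foot lacks its left
  end, a destination foot contains it.\<close>

lemma foot_of:
  assumes "v \<in> V" shows "\<exists>F\<in>diag_vertices X m. h F = v \<and> {l v<..<r v} \<subseteq> F"
  using assms
proof (cases rule: V_cases)
  case (1 a)
  then show ?thesis using src_in[of a] at_s[of a] by (auto simp: s_def src_foot_def intro!: bexI[of _ "src_foot a (m a)"])
next
  case (2 a)
  then show ?thesis using dest_in[of a] at_d[of a] by (auto simp: d_def dest_foot_def intro!: bexI[of _ "dest_foot a (m a)"])
qed

lemma r_le_l:
  assumes "v \<in> V" "w \<in> V" "lt v w" shows "r v \<le> l w"
proof -
  obtain F G where F: "F \<in> diag_vertices X m" "h F = v" "{l v<..<r v} \<subseteq> F"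
    and G: "G \<in> diag_vertices X m" "h G = w" "{l w<..<r w} \<subseteq> G"
    using foot_of assms by meson
  then have "diag_lt F G" using h_lt assms by blast
  then show ?thesis
    using F(3) G(3) l_less_r assms by (intro open_intervals_order[of "l v" _ _ "r w"]) (auto simp: diag_lt_def subset_iff)
qed

lemma E_in_V: "e \<in> E \<Longrightarrow> fst e \<in> V" "e \<in> E \<Longrightarrow> snd e \<in> V"
proof -
  have "E \<subseteq> V \<times> V" using dd unfolding dyn_diagram_def by blast
  then show "e \<in> E \<Longrightarrow> fst e \<in> V" "e \<in> E \<Longrightarrow> snd e \<in> V" by auto
qed

lemma edge_bump:
  assumes "e \<in> E"
  obtains a where "a \<in> A" "g (lab e) \<in> X" "e = (s a, d a)" "agrees_on (g (lab e)) a (supt a)"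
  | a where "a \<in> A" "g (lab e) \<in> X" "e = (d a, s a)" "agrees_on (g (lab e)) (inv a) (supt a)"
proof -
  obtain F where F: "F \<in> diag_vertices X m" "h F = fst e" using foot_of[OF E_in_V(1)[OF assms]] by blast
  obtain G where G: "G \<in> diag_vertices X m" "h G = snd e" using foot_of[OF E_in_V(2)[OF assms]] by blast
  note FG = F G
  have e0: "(F, G) \<in> diag_edges X m" using h_E FG assms by simp
  have gl: "g (lab e) = diag_label X m (F, G)"
  proof -
    have "lab e = \<sigma> (diag_label X m (F, G))" using \<sigma>_lab[OF e0] FG by simp
    then show ?thesis unfolding g_def using \<sigma>_bij e0
      by (simp add: bij_betw_def inv_into_f_f)
  qed
  \<comment> \<open>\<open>diag_label\<close> is a choice among the elements that induce the edge,
    so only the defining property of the chosen one is available here; that no other element induces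
    it is settled in \<open>label_of_bump\<close>.\<close>
  have "\<exists>f. sb_edge X m f (F, G)" using e0 by (simp add: diag_edges_def)
  then have "sb_edge X m (g (lab e)) (F, G)"
    unfolding gl diag_label_def by (rule someI_ex)
  then obtain a where a: "a \<in> A" "g (lab e) \<in> X"
    and c: "(F, G) = (src_foot a (m a), dest_foot a (m a)) \<and> agrees_on (g (lab e)) a (supt a) \<or>
      (F, G) = (dest_foot a (m a), src_foot a (m a)) \<and> agrees_on (g (lab e)) (inv a) (supt a)"
    unfolding sb_edge_def by blast
  have e: "e = (h F, h G)" using FG by simp
  from c show ?thesis
  proof
    assume "(F, G) = (src_foot a (m a), dest_foot a (m a)) \<and> agrees_on (g (lab e)) a (supt a)"
    then show ?thesis using that(1)[OF a] e by (auto simp: s_def d_def)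
  next
    assume "(F, G) = (dest_foot a (m a), src_foot a (m a)) \<and> agrees_on (g (lab e)) (inv a) (supt a)"
    then show ?thesis using that(2)[OF a] e by (auto simp: s_def d_def)
  qed
qed

lemma edge_bump':
  assumes "e \<in> E"
  obtains a where "a \<in> A" "g (lab e) \<in> X" "e = (s a, d a) \<or> e = (d a, s a)"
    "agrees_on (g (lab e)) a (supt a) \<or> agrees_on (g (lab e)) (inv a) (supt a)"
    "lower_end lt p (fst e) = s a" "upper_end lt p (fst e) = d a"
  using edge_bump[OF assms] ends_s ends_d by (metis fst_conv)

text \<open>Two elements using the same bump would share the left end of its support as a left
  transition point, which properness forbids.\<close>

lemma label_of_bump:
  assumes a: "a \<in> A" and f: "f \<in> X" and ag: "agrees_on f a (supt a) \<or> agrees_on f (inv a) (supt a)"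
  shows "\<exists>e\<in>E. (e = (s a, d a) \<or> e = (d a, s a)) \<and> f = g (lab e)"
proof -
  obtain e where e: "e \<in> E" "e = (s a, d a) \<or> e = (d a, s a)" using bump_edge_E[OF a] by blast
  obtain b where b: "b \<in> A" "g (lab e) \<in> X" "e = (s b, d b) \<or> e = (d b, s b)"
    "agrees_on (g (lab e)) b (supt b) \<or> agrees_on (g (lab e)) (inv b) (supt b)"
    using edge_bump'[OF e(1)] by metis
  have "b = a" using e(2) b(1,3) a s_inj s_neq_d by (metis prod.inject)
  then have "left_tp (g (lab e)) (Inf (supt a))" "left_tp f (Inf (supt a))"
    using bump_agrees_fixes_endpoints(4) X_homeo b f ag A_bump(2)[OF a] by blast+
  then have "f = g (lab e)" using proper f b(2) unfolding geom_proper_def by blast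
  then show ?thesis using e by blast
qed

lemma label_at_point:
  assumes "f \<in> X" "q \<in> supt f"
  shows "\<exists>a\<in>A. \<exists>e\<in>E. q \<in> supt a \<and> (e = (s a, d a) \<or> e = (d a, s a)) \<and> f = g (lab e)"
proof -
  obtain a where a: "positive_bump a" "q \<in> supt a" "agrees_on f a (supt a) \<or> agrees_on f (inv a) (supt a)"
    using ex_positive_bump_at[OF X_homeo[OF assms(1)] assms(2)] by blast
  then have "a \<in> A" using assms(1) by (auto simp: used_bumps_def)
  then show ?thesis using label_of_bump[OF _ assms(1) a(3)] a(2) by blast
qed

lemma g_inj: "lb \<in> lab ` E \<Longrightarrow> lb' \<in> lab ` E \<Longrightarrow> g lb = g lb' \<Longrightarrow> lb = lb'"
  unfolding g_def using \<sigma>_bij by (metis bij_betw_imp_surj_on f_inv_into_f)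

lemma edges_separated:
  assumes "e \<in> E" "e' \<in> E" "e \<noteq> e'" "lab e = lab e'"
  shows "lt (upper_end lt p (fst e)) (lower_end lt p (fst e')) \<or>
    lt (upper_end lt p (fst e')) (lower_end lt p (fst e))"
proof -
  obtain a where a: "a \<in> A" "g (lab e) \<in> X" "e = (s a, d a) \<or> e = (d a, s a)"
    "agrees_on (g (lab e)) a (supt a) \<or> agrees_on (g (lab e)) (inv a) (supt a)"
    "lower_end lt p (fst e) = s a" "upper_end lt p (fst e) = d a"
    using edge_bump'[OF assms(1)] by metis
  obtain b where b: "b \<in> A" "g (lab e') \<in> X" "e' = (s b, d b) \<or> e' = (d b, s b)"
    "agrees_on (g (lab e')) b (supt b) \<or> agrees_on (g (lab e')) (inv b) (supt b)"
    "lower_end lt p (fst e') = s b" "upper_end lt p (fst e') = d b"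
    using edge_bump'[OF assms(2)] by metis
  have "a \<noteq> b" using a(3) b(3) assms(1-3) dyn_diagram_asym[OF dd] by blast
  note Sa = supt_bump[OF A_bump(2)[OF a(1)]] and Sb = supt_bump[OF A_bump(2)[OF b(1)]]
  \<comment> \<open>Both bumps belong to the same element, so meeting supports would coincide. The
    two source feet would then start at the same point and overlap.\<close>
  have "supt a \<inter> supt b = {}"
  proof (rule ccontr)
    assume "supt a \<inter> supt b \<noteq> {}"
    then have eq: "supt a = supt b"
      using overlapping_bumps_same_supt[OF X_homeo[OF a(2)] A_bump(2)[OF a(1)] A_bump(2)[OF b(1)] a(4)] b(4) assms(4)
      by simp
    have "min (m a) (m b) > Inf (supt a)" using A_points(1)[OF a(1)] A_points(1)[OF b(1)] eq by simp
    then obtain u where "Inf (supt a) < u" "u < min (m a) (m b)" using dense by blast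
    then have "u \<in> src_foot a (m a)" "u \<in> src_foot b (m b)" using eq by (auto simp: src_foot_def)
    then show False using good a(1) b(1) \<open>a \<noteq> b\<close> unfolding good_marking_def by blast
  qed
  then have disj: "Sup (supt a) \<le> Inf (supt b) \<or> Sup (supt b) \<le> Inf (supt a)"
  proof -
    have "\<not> max (Inf (supt a)) (Inf (supt b)) < min (Sup (supt a)) (Sup (supt b))"
    proof
      assume "max (Inf (supt a)) (Inf (supt b)) < min (Sup (supt a)) (Sup (supt b))"
      then obtain u where "max (Inf (supt a)) (Inf (supt b)) < u" "u < min (Sup (supt a)) (Sup (supt b))"
        using dense by blast
      then have "u \<in> {Inf (supt a)<..<Sup (supt a)}" "u \<in> {Inf (supt b)<..<Sup (supt b)}" by auto
      then show False using \<open>supt a \<inter> supt b = {}\<close> Sa(1) Sb(1) by blast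
    qed
    then show ?thesis using Sa(3) Sb(3) by linarith
  qed
  \<comment> \<open>The reverse order of the feet would give \<open>m b \<le> a (m a)\<close>,
    although \<open>a (m a)\<close> lies in the left orbital and \<open>m b\<close> in the right
    one.\<close>
  have key: "lt (d a) (s b)" if "a \<in> A" "b \<in> A" "Sup (supt a) \<le> Inf (supt b)" for a b
  proof (rule ccontr)
    assume "\<not> lt (d a) (s b)"
    then have "lt (s b) (d a)" using lt_total[of "s b" "d a"] s_in d_in s_neq_d that by blast
    then have "m b \<le> a (m a)" using r_le_l[of "s b" "d a"] s_in d_in at_s at_d that by simp
    then show False using A_points[OF that(1)] A_points[OF that(2)] that(3) by simp
  qed
  show ?thesis using disj key a b by metis
qed

lemma realization: "fast_realization V lt p E lab l r K g"
proof
  show "finite V" using dd by (simp add: dyn_diagram_def)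
  show "V \<noteq> {}" by (rule V_ne)
  show "\<not> lt v v" if "v \<in> V" for v using that by (rule lt_irrefl)
  show "lt u w" if "u \<in> V" "v \<in> V" "w \<in> V" "lt u v" "lt v w" for u v w using that by (rule lt_trans)
  show "lt u v \<or> lt v u" if "u \<in> V" "v \<in> V" "u \<noteq> v" for u v using that by (rule lt_total)
  show "p v \<in> V" "p (p v) = v" "p v \<noteq> v" "(v, p v) \<in> E \<or> (p v, v) \<in> E" if "v \<in> V" for v
    using partner_props[OF dd that] by auto
  show "fst e \<in> V \<and> snd e = p (fst e)" if "e \<in> E" for e
  proof -
    have "fst e \<in> V" using that by (rule E_in_V)
    then show ?thesis using partner_eq[OF dd, of "fst e" "snd e"] that by simp
  qed
  show "(v, u) \<notin> E" if "(u, v) \<in> E" for u v using dyn_diagram_asym[OF dd that] .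
  show "lt (upper_end lt p (fst e)) (lower_end lt p (fst e')) \<or> lt (upper_end lt p (fst e')) (lower_end lt p (fst e))"
    if "e \<in> E" "e' \<in> E" "e \<noteq> e'" "lab e = lab e'" for e e' using that by (rule edges_separated)
next
  fix v assume v: "v \<in> V"
  show "l v < r v" using v by (rule l_less_r)
  have "0 \<le> l v \<and> r v \<le> 1 \<and> homeo_plus (K v) \<and> K (p v) = inv (K v)"
    using v
  proof (cases rule: V_cases)
    case (1 a)
    then show ?thesis using supt_bump[OF A_bump(2)[of a]] A_points[of a] A_bump(3)[of a]
      by (simp add: at_s at_d p_s)
  next
    case (2 a)
    then show ?thesis using supt_bump[OF A_bump(2)[of a]] A_points[of a] A_bump(3)[of a]
      by (simp add: at_s at_d p_d homeo_plus_inv homeo_plus_inv_inv)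
  qed
  then show "0 \<le> l v" "r v \<le> 1" "homeo_plus (K v)" "K (p v) = inv (K v)" by auto
  assume "lt v (p v)"
  \<comment> \<open>A lower vertex is a source foot, since a positive bump has its source to the
    left of its destination.\<close>
  with v obtain a where a: "a \<in> A" "v = s a" using V_cases[OF v] p_d not_lt_d_s by metis
  show "r v < l (p v)" "K v (r v) = l (p v)" using a A_points by (auto simp: at_s at_d p_s)
  show "K v q = q" if "q \<le> l v \<or> r (p v) \<le> q" for q
  proof -
    have "q \<notin> supt a" using that a in_supt_iff[OF a(1), of q] by (auto simp: at_s at_d p_s)
    then show ?thesis using a A_bump(3)[OF a(1)] by (simp add: at_s homeo_plus_supt)
  qed
  show "q < K v q" if "l v < q" "q < r (p v)" for q
  proof -
    have "q \<in> supt a" using that a in_supt_iff[OF a(1), of q] by (auto simp: at_s at_d p_s)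
    then show ?thesis using a A_bump(1)[OF a(1)] by (simp add: at_s positive_bump_def)
  qed
next
  show "r v \<le> l w" if "v \<in> V" "w \<in> V" "lt v w" for v w using that by (rule r_le_l)
  show "homeo_plus (g lb)" if "lb \<in> lab ` E" for lb
    using that edge_bump' X_homeo by (metis imageE)
next
  fix e q assume e: "e \<in> E" "l (lower_end lt p (fst e)) < q" "q < r (upper_end lt p (fst e))"
  from e(1) show "g (lab e) q = K (fst e) q"
  proof (cases rule: edge_bump)
    case (1 a)
    then have "q \<in> supt a" using e in_supt_iff[OF 1(1), of q] ends_s at_s at_d by auto
    then show ?thesis using 1 by (simp add: at_s agrees_on_def)
  next
    case (2 a)
    then have "q \<in> supt a" using e in_supt_iff[OF 2(1), of q] ends_d at_s at_d by auto
    then show ?thesis using 2 by (simp add: at_d agrees_on_def)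
  qed
next
  fix lb q assume lb: "lb \<in> lab ` E" and
    out: "\<And>e. e \<in> E \<Longrightarrow> lab e = lb \<Longrightarrow> q \<notin> {l (lower_end lt p (fst e))<..<r (upper_end lt p (fst e))}"
  have gX: "g lb \<in> X" using lb edge_bump' by (metis imageE)
  show "g lb q = q"
  proof (rule ccontr)
    assume "g lb q \<noteq> q"
    then have "q \<in> supt (g lb)" using homeo_plus_supt[OF X_homeo[OF gX]] by simp
    then obtain a e where a: "a \<in> A" "e \<in> E" "q \<in> supt a" "e = (s a, d a) \<or> e = (d a, s a)" "g lb = g (lab e)"
      using label_at_point[OF gX] by blast
    then have "lab e = lb" using g_inj[OF imageI[OF a(2)] lb] by simp
    moreover have "q \<in> {l (lower_end lt p (fst e))<..<r (upper_end lt p (fst e))}"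
      using a(4,3) in_supt_iff[OF a(1), of q] ends_s[OF a(1)] ends_d[OF a(1)] at_s[OF a(1)] at_d[OF a(1)]
      by auto
    ultimately show False using out a(2) by blast
  qed
qed

text \<open>An element other than the identity moves some point and so uses a bump, which yields an
  edge; the identity has no orbital and is invisible in the diagram.\<close>

lemma X_eq: "X - {id} = g ` lab ` E"
proof
  show "X - {id} \<subseteq> g ` lab ` E"
  proof
    fix f assume f: "f \<in> X - {id}"
    then obtain q where "q \<in> supt f" using supt_empty_iff X_homeo by blast
    then show "f \<in> g ` lab ` E" using label_at_point f by blast
  qed
  show "g ` lab ` E \<subseteq> X - {id}"
  proof
    fix f assume "f \<in> g ` lab ` E"
    then obtain e where e: "e \<in> E" "f = g (lab e)" by blast
    then have "f \<noteq> id" using fast_realization.g_neq_id[OF realization imageI[OF e(1)]] by simp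
    moreover have "f \<in> X" unfolding e(2) by (rule edge_bump'[OF e(1)])
    ultimately show "f \<in> X - {id}" by blast
  qed
qed

end

lemma gen_group_trivial:
  assumes "X \<subseteq> {id}" shows "gen_group X = {id}"
proof
  show "gen_group X \<subseteq> {id}"
  proof
    fix f assume "f \<in> gen_group X"
    then show "f \<in> {id}" by induction (use assms in \<open>auto simp: id_def\<close>)
  qed
qed (simp add: gen_group.gen_id)

lemma marked_iso_trivial:
  assumes "X \<subseteq> {id}" shows "marked_iso X {} id"
proof -
  have "X - {id} = {}" using assms by blast
  then show ?thesis
    using gen_group_trivial[OF assms] gen_group_trivial[of "{}"] by (auto simp: marked_iso_def bij_betw_def)
qed

text \<open>The empty diagram is kept apart because lengths in the model are fractions of
  \<open>N\<close>, which would be 0. Without used bumps every element of \<open>X\<close> is the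
  identity.\<close>

lemma has_diagram_iso_cases:
  assumes dd: "dyn_diagram V lt E lab" and X: "geom_proper X" "has_diagram_iso X V lt E lab"
  shows "V = {} \<and> X \<subseteq> {id} \<or>
    (\<exists>l r K g. fast_realization V lt (partner E) E lab l r K g \<and> X - {id} = g ` lab ` E)"
proof -
  obtain m h \<sigma> where good: "good_marking (used_bumps X) m" and bij: "bij_betw h (diag_vertices X m) V"
    and h_lt: "\<forall>u\<in>diag_vertices X m. \<forall>v\<in>diag_vertices X m. diag_lt u v \<longleftrightarrow> lt (h u) (h v)"
    and h_E: "\<forall>u\<in>diag_vertices X m. \<forall>v\<in>diag_vertices X m. (u, v) \<in> diag_edges X m \<longleftrightarrow> (h u, h v) \<in> E"
    and \<sigma>: "bij_betw \<sigma> (diag_label X m ` diag_edges X m) (lab ` E)"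
      "\<forall>e\<in>diag_edges X m. lab (h (fst e), h (snd e)) = \<sigma> (diag_label X m e)"
    using X(2) unfolding has_diagram_iso_def diagram_iso_def by blast
  show ?thesis
  proof (cases "V = {}")
    case True
    then have "used_bumps X = {}" using bij by (auto simp: bij_betw_def diag_vertices_def)
    moreover have "f = id" if "f \<in> X" for f
    proof (rule ccontr)
      assume "f \<noteq> id"
      have f: "homeo_plus f" using X(1) that by (auto simp: geom_proper_def)
      then obtain q where "q \<in> supt f" using supt_empty_iff[of f] \<open>f \<noteq> id\<close> by blast
      then obtain a where "positive_bump a" "agrees_on f a (supt a) \<or> agrees_on f (inv a) (supt a)"
        using ex_positive_bump_at[OF f] by blast
      then have "a \<in> used_bumps X" using that by (auto simp: used_bumps_def)
      then show False using \<open>used_bumps X = {}\<close> by blast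
    qed
    ultimately show ?thesis using True by blast
  next
    case False
    then interpret diagram_of_set V lt E lab X m h \<sigma>
      using dd X(1) good bij h_lt h_E \<sigma> by unfold_locales auto
    show ?thesis by (intro disjI2 exI conjI) (rule realization, rule X_eq)
  qed
qed

theorem theorem1p2:
  fixes V :: "'v set" and lt :: "'v \<Rightarrow> 'v \<Rightarrow> bool"
    and E :: "('v \<times> 'v) set" and lab :: "'v \<times> 'v \<Rightarrow> 'l"
  assumes "dyn_diagram V lt E lab"
  shows "\<exists>XD. XD \<subseteq> {f. PL_plus f} \<and> geom_fast XD \<and>
     (\<forall>X. X \<subseteq> {f. homeo_plus f} \<and> geom_fast X \<and> finite (transition_points X) \<and>
          has_diagram_iso X V lt E lab \<longrightarrow>
        (\<exists>\<phi> \<theta>. marked_iso X XD \<phi> \<and>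
           continuous_on {0..1} \<theta> \<and> mono_on {0..1} \<theta> \<and> \<theta> ` {0..1} = {0..1} \<and>
           (\<forall>f\<in>gen_group X. \<forall>x\<in>{0..1}. \<theta> (f x) = \<phi> f (\<theta> x))))"
proof (cases "diagram_pairing V lt (partner E) E lab")
  case True
  then interpret diagram_pairing V lt "partner E" E lab .
  show ?thesis
  proof (intro exI[of _ XD] conjI allI impI)
    fix X assume X: "X \<subseteq> {f. homeo_plus f} \<and> geom_fast X \<and> finite (transition_points X) \<and>
      has_diagram_iso X V lt E lab"
    then obtain l r K g where "fast_realization V lt (partner E) E lab l r K g" "X - {id} = g ` lab ` E"
      using has_diagram_iso_cases[OF assms, of X] V_ne unfolding geom_fast_def by blast
    then show "\<exists>\<phi> \<theta>. marked_iso X XD \<phi> \<and> continuous_on {0..1} \<theta> \<and> mono_on {0..1} \<theta> \<and>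
        \<theta> ` {0..1} = {0..1} \<and> (\<forall>f\<in>gen_group X. \<forall>x\<in>{0..1}. \<theta> (f x) = \<phi> f (\<theta> x))"
      by (rule fast_realization.ex_marked_semiconjugacy)
  qed (rule XD_PL XD_fast)+
next
  case False
  \<comment> \<open>Only the empty diagram can still occur: a diagram violating the locale axioms has no realization.\<close>
  have "X \<subseteq> {id}" if "geom_fast X" "has_diagram_iso X V lt E lab" for X
  proof -
    have "\<not> fast_realization V lt (partner E) E lab l r K g" for l r K and g :: "'l \<Rightarrow> real \<Rightarrow> real"
      using False fast_realization.axioms(1) by metis
    moreover have "geom_proper X" using that(1) by (simp add: geom_fast_def)
    ultimately show ?thesis using has_diagram_iso_cases[OF assms _ that(2)] by metis
  qed
  then have "marked_iso X {} id \<and> continuous_on {0..1} (id :: real \<Rightarrow> real) \<and> mono_on {0..1} (id :: real \<Rightarrow> real) \<and>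
      id ` {0..1::real} = {0..1} \<and> (\<forall>f\<in>gen_group X. \<forall>x\<in>{0..1}. id (f x) = id f (id x))"
    if "geom_fast X" "has_diagram_iso X V lt E lab" for X
    using marked_iso_trivial[of X] that by (simp add: mono_on_def)
  moreover have "geom_fast {}"
    by (simp add: geom_fast_def geom_proper_def geom_fast_bumps_def used_bumps_def good_marking_def)
  ultimately show ?thesis by (intro exI[of _ "{}"]) blast
qed

end
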